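(* Every $4$-edge-connected graph $G$ that has no edge-cut of any size in $\{6,7,\ldots,20\}$ admits a nowhere-zero $3$-flow.
   Context: Graphs are finite and loopless, but may contain parallel edges. An edge-cut of a graph is an inclusion-minimal set of edges whose removal increases the number of connected components (i.e. a bond); its size is its number of edges. For an integer $k\ge 2$, a nowhere-zero $k$-flow of $G$ is a pair $(D,f)$ where $D$ is an orientation of $G$ and $f:E(G)\to\{1,2,\ldots,k-1\}$ satisfies $\sum_{e\in E_D^+(v)}f(e)=\sum_{e\in E_D^-(v)}f(e)$ for every $v\in V(G)$, where $E_D^+(v)$ and $E_D^-(v)$ are the sets of edges directed away from and toward $v$ in $D$, respectively. *)

theory Defs
  imports Main "Graph_Theory.Digraph"
begin

record ('v, 'e) multigraph =
  vertices :: "'v set"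
  edges :: "'e set"
  ends :: "'e \<Rightarrow> 'v set"

text \<open>Edges are abstract objects with a set of ends, so distinct edges may have equal ends
  (parallel edges).  Demanding two distinct ends excludes loops.\<close>

locale finite_loopless_multigraph =
  fixes G :: "('v, 'e) multigraph"
  assumes finite_vertices: "finite (vertices G)"
    and finite_edges: "finite (edges G)"
    and ends_edge: "e \<in> edges G \<Longrightarrow> ends G e \<subseteq> vertices G \<and> card (ends G e) = 2"

definition adjacency :: "('v, 'e) multigraph \<Rightarrow> 'v rel" where
  "adjacency G = {(u, v). \<exists>e\<in>edges G. ends G e = {u, v}}"

definition components :: "('v, 'e) multigraph \<Rightarrow> 'v set set" where
  "components G = vertices G // {(u, v) \<in> vertices G \<times> vertices G. (u, v) \<in> (adjacency G)\<^sup>*}"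

definition delete_edges :: "('v, 'e) multigraph \<Rightarrow> 'e set \<Rightarrow> ('v, 'e) multigraph" where
  "delete_edges G S = G\<lparr>edges := edges G - S\<rparr>"

definition connected_multigraph :: "('v, 'e) multigraph \<Rightarrow> bool" where
  "connected_multigraph G \<longleftrightarrow> card (components G) = 1"

text \<open>The graph with a single vertex (and hence no edges) is \<open>k\<close>-edge-connected for every \<open>k\<close>;
  the graph without vertices is not, for \<open>k \<ge> 1\<close>.\<close>

definition edge_connected :: "nat \<Rightarrow> ('v, 'e) multigraph \<Rightarrow> bool" where
  "edge_connected k G \<longleftrightarrow>
    (\<forall>S \<subseteq> edges G. card S < k \<longrightarrow> connected_multigraph (delete_edges G S))"

definition separating :: "('v, 'e) multigraph \<Rightarrow> 'e set \<Rightarrow> bool" where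
  "separating G S \<longleftrightarrow>
    S \<subseteq> edges G \<and> card (components G) < card (components (delete_edges G S))"

definition edge_cut :: "('v, 'e) multigraph \<Rightarrow> 'e set \<Rightarrow> bool" where
  "edge_cut G S \<longleftrightarrow> separating G S \<and> (\<forall>T. T \<subset> S \<longrightarrow> \<not> separating G T)"

definition orientation :: "('v, 'e) multigraph \<Rightarrow> ('v, 'e) pre_digraph \<Rightarrow> bool" where
  "orientation G D \<longleftrightarrow> verts D = vertices G \<and> arcs D = edges G \<and>
    (\<forall>e\<in>edges G. {tail D e, head D e} = ends G e)"

definition nowhere_zero_flow ::
    "nat \<Rightarrow> ('v, 'e) multigraph \<Rightarrow> ('v, 'e) pre_digraph \<Rightarrow> ('e \<Rightarrow> nat) \<Rightarrow> bool" where
  "nowhere_zero_flow k G D f \<longleftrightarrow> orientation G D \<and>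
    (\<forall>e\<in>edges G. f e \<in> {1..k - 1}) \<and>
    (\<forall>v\<in>vertices G. (\<Sum>e\<in>out_arcs D v. f e) = (\<Sum>e\<in>in_arcs D v. f e))"

end

theory Submission
  imports Defs "HOL-Library.Disjoint_Sets"
begin

text \<open>A graph has a nowhere-zero 3-flow as soon as it has an orientation in which out-degree minus
in-degree is divisible by 3 at every vertex: starting from the value 1 on every arc, augmenting
paths that exchange the values \<open>1\<close> and \<open>-2\<close> remove all remaining excess (\<open>flow_if_excess_dvd_3\<close>).
Whether such an orientation exists depends only on the numbers \<open>w u v\<close> of edges between \<open>u\<close> and \<open>v\<close>,
so almost everything below concerns symmetric multiplicity functions.

Call a vertex set \<open>Z\<^sub>3\<close>-connected if inside it every assignment of residues with sum divisible
by 3 is the out-minus-in assignment of some orientation.  Such a set may be contracted, and this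
drives an induction on the number of vertices (\<open>orientable_if_sparse_bonds\<close>).  Two vertices joined
by parallel edges form a \<open>Z\<^sub>3\<close>-connected set, so the graph may be taken to be simple.  Choose
\<open>X\<close> minimal among the sets with at least two vertices that are left by at most 5 edges or are the
whole vertex set.  Both sides of such a cut are connected, because every cut has at least 4 edges,
so the bonds of the graph obtained by contracting \<open>X\<close> are bonds of the given graph.  Thus it is
enough to see that \<open>X\<close> is \<open>Z\<^sub>3\<close>-connected (\<open>Z3_connected_region\<close>).

The gap between 5 and 21 in the sizes of bonds, together with the minimality of \<open>X\<close>, has the
following consequence: if a connected part \<open>S\<close> of \<open>X\<close> is left by at least 6 and at most 20 edges,
then all other vertices of \<open>X\<close> have degree at most 5 and send all their edges to \<open>S\<close>
(\<open>thin_region\<close>).  Hence the vertices of \<open>X\<close> of degree at most 5 are pairwise non-adjacent, and every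
subset of \<open>X\<close> that separates two of the other vertices, the big ones, is left by at least 21 edges.
Regard a vertex of degree at most 5 as a hyperedge on its big neighbours.  Counting the edges
leaving the parts of a partition of the big vertices into \<open>q\<close> parts shows that at least
\<open>4 * (q - 1)\<close> edges and hyperedges cross it (\<open>big_hyper_dense\<close>).  A suitable pair of edges at each
small vertex can be replaced by one edge between two big vertices without destroying this density
(\<open>hyper_dense_lift\<close>), after which the small vertex still has degree at least 2 and can be removed.
What remains is a graph on the big vertices with at least \<open>4 * (q - 1)\<close> edges across every partition
into \<open>q\<close> parts.

Such a graph is \<open>Z\<^sub>3\<close>-connected (\<open>Z3_connected_if_dense\<close>).  In a minimal counterexample proper
subsets are sparse and the graph has exactly \<open>4 * (n - 1)\<close> edges, so all degrees are at least 5; at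
a vertex of degree 5 one pair of edges is lifted, and if all degrees are at least 6, then so are all
cuts.

Graphs in which all cuts have at least 6 edges are \<open>Z\<^sub>3\<close>-connected by a theorem of Lovasz,
Thomassen, Wu and Zhang (\<open>admissible_orientable\<close>), proved by induction for a statement about labels
modulo 6 in which the arcs at one vertex are already oriented.  Tight sets are contracted, arcs and
edges are deleted as long as the labels permit, and the labellings that admit none of this have all
labels equal to 1 or 2, up to reversal of all arcs.  There some vertex can be made a sink, possibly
after lifting a pair of its edges, and merged into the preoriented vertex.\<close>

section \<open>Orientations modulo three\<close>

definition multiplicity_fun :: "('v \<Rightarrow> 'v \<Rightarrow> int) \<Rightarrow> bool" where
  "multiplicity_fun w \<longleftrightarrow> (\<forall>u v. w u v = w v u \<and> 0 \<le> w u v) \<and> (\<forall>v. w v v = 0)"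

definition cut :: "('v \<Rightarrow> 'v \<Rightarrow> int) \<Rightarrow> 'v set \<Rightarrow> 'v set \<Rightarrow> int" where
  "cut w A B = (\<Sum>u\<in>A. \<Sum>v\<in>B. w u v)"

text \<open>Only the surplus \<open>f u v\<close> of arcs from \<open>u\<close> to \<open>v\<close> over arcs from \<open>v\<close> to \<open>u\<close> is recorded: the
orientations of \<open>w u v\<close> parallel edges yield exactly the surpluses of the same parity as \<open>w u v\<close> and
of absolute value at most \<open>w u v\<close>.\<close>

definition net_orientation :: "'v set \<Rightarrow> ('v \<Rightarrow> 'v \<Rightarrow> int) \<Rightarrow> ('v \<Rightarrow> 'v \<Rightarrow> int) \<Rightarrow> bool" where
  "net_orientation V w f \<longleftrightarrow>
    (\<forall>u\<in>V. \<forall>v\<in>V. f u v = - f v u \<and> \<bar>f u v\<bar> \<le> w u v \<and> even (f u v - w u v))"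

definition orientable :: "'v set \<Rightarrow> ('v \<Rightarrow> 'v \<Rightarrow> int) \<Rightarrow> ('v \<Rightarrow> int) \<Rightarrow> bool" where
  "orientable V w T \<longleftrightarrow>
    (\<exists>f. net_orientation V w f \<and> (\<forall>v\<in>V. 3 dvd (T v - sum (f v) V)))"

definition Z3_connected :: "'v set \<Rightarrow> ('v \<Rightarrow> 'v \<Rightarrow> int) \<Rightarrow> bool" where
  "Z3_connected V w \<longleftrightarrow> (\<forall>T. 3 dvd sum T V \<longrightarrow> orientable V w T)"

definition edge :: "'v \<Rightarrow> 'v \<Rightarrow> 'v \<Rightarrow> 'v \<Rightarrow> int" where
  "edge a b u v = (if a \<noteq> b \<and> (u = a \<and> v = b \<or> u = b \<and> v = a) then 1 else 0)"

text \<open>The vertex \<open>r\<close> of \<open>X\<close> takes the role of the whole set, so that contraction stays within the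
same vertex type; edges inside \<open>X\<close> disappear.\<close>

definition contract :: "'v set \<Rightarrow> 'v \<Rightarrow> ('v \<Rightarrow> 'v \<Rightarrow> int) \<Rightarrow> 'v \<Rightarrow> 'v \<Rightarrow> int" where
  "contract X r w u v = (if u = r \<and> v = r then 0 else if u = r then \<Sum>x\<in>X. w x v
     else if v = r then \<Sum>x\<in>X. w u x else w u v)"

lemma multiplicity_fun_sym: "multiplicity_fun w \<Longrightarrow> w u v = w v u"
  and multiplicity_fun_nonneg: "multiplicity_fun w \<Longrightarrow> 0 \<le> w u v"
  and multiplicity_fun_diag: "multiplicity_fun w \<Longrightarrow> w v v = 0"
  unfolding multiplicity_fun_def by blast+

lemma edge_sym: "edge a b u v = edge a b v u"
  and edge_nonneg: "0 \<le> edge a b u v"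
  and edge_diag: "edge a b u u = 0"
  and edge_self: "edge a a u v = 0"
  unfolding edge_def by auto

lemma multiplicity_fun_contract:
  assumes "multiplicity_fun w"
  shows "multiplicity_fun (contract X r w)"
  using assms unfolding multiplicity_fun_def contract_def
  by (auto intro!: sum.cong sum_nonneg)

text \<open>This orients the edges at a single vertex: every net outflow with the right parity that the
degree permits can be split among the neighbours.\<close>

lemma split_sum:
  fixes m :: "'a \<Rightarrow> int"
  assumes "finite X" "\<forall>x\<in>X. 0 \<le> m x" "\<bar>s\<bar> \<le> sum m X" "even (s - sum m X)"
  shows "\<exists>g. (\<forall>x\<in>X. \<bar>g x\<bar> \<le> m x \<and> even (g x - m x)) \<and> sum g X = s"
  using assms
proof (induction X arbitrary: s rule: finite_induct)
  case empty
  then show ?case by auto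
next
  case (insert x X)
  define M where "M = sum m X"
  have M0: "0 \<le> M" unfolding M_def using insert.prems by (intro sum_nonneg) auto
  have mx: "0 \<le> m x" using insert.prems by auto
  have s: "\<bar>s\<bar> \<le> m x + M" "even (s - (m x + M))"
    using insert.prems insert.hyps unfolding M_def by auto
  define s' where "s' = (if s - m x \<ge> - M then s - m x else - M)"
  have s': "\<bar>s'\<bar> \<le> M" "even (s' - M)" "\<bar>s - s'\<bar> \<le> m x" "even (s - s' - m x)"
    using s M0 mx unfolding s'_def by (auto simp: abs_le_iff split: if_splits)
  obtain g where g: "\<forall>y\<in>X. \<bar>g y\<bar> \<le> m y \<and> even (g y - m y)" "sum g X = s'"
    using insert.IH[of s'] s' insert.prems unfolding M_def by auto
  have "sum (g(x := s - s')) (insert x X) = s"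
  proof -
    have "sum (g(x := s - s')) X = sum g X"
      using insert.hyps by (intro sum.cong) auto
    then show ?thesis using insert.hyps g(2) by simp
  qed
  then show ?case
    using g(1) s' insert.hyps by (intro exI[of _ "g(x := s - s')"]) auto
qed

text \<open>Once the edges at \<open>x\<close> are oriented by \<open>g\<close>, they only shift the demands of the other vertices.\<close>

lemma orientable_drop_vertex:
  assumes fin: "finite V" and x: "x \<in> V" and w: "multiplicity_fun w"
    and g: "\<forall>y\<in>V - {x}. \<bar>g y\<bar> \<le> w x y \<and> even (g y - w x y)"
    and Tx: "3 dvd (T x - sum g (V - {x}))"
    and sol: "orientable (V - {x}) w (\<lambda>y. T y + g y)"
  shows "orientable V w T"
proof -
  obtain f where f: "net_orientation (V - {x}) w f"
    and fT: "\<forall>v\<in>V - {x}. 3 dvd (T v + g v - sum (f v) (V - {x}))"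
    using sol unfolding orientable_def by blast
  define h where "h u v = (if u = x then (if v = x then 0 else g v)
    else if v = x then - g u else f u v)" for u v
  have "net_orientation V w h"
    unfolding net_orientation_def
  proof (intro ballI)
    fix u v assume uv: "u \<in> V" "v \<in> V"
    have s: "w u x = w x u" "w x x = 0"
      using multiplicity_fun_sym[OF w] multiplicity_fun_diag[OF w] by blast+
    have ff: "f u v = - f v u \<and> \<bar>f u v\<bar> \<le> w u v \<and> even (f u v - w u v)" if "u \<noteq> x" "v \<noteq> x"
      using f uv that unfolding net_orientation_def by blast
    have gg: "\<bar>g v\<bar> \<le> w x v \<and> even (g v - w x v)" if "v \<noteq> x" using g uv that by blast
    have gg': "\<bar>g u\<bar> \<le> w x u \<and> even (g u - w x u)" if "u \<noteq> x" using g uv that by blast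
    consider "u = x" "v = x" | "u = x" "v \<noteq> x" | "u \<noteq> x" "v = x" | "u \<noteq> x" "v \<noteq> x" by blast
    then show "h u v = - h v u \<and> \<bar>h u v\<bar> \<le> w u v \<and> even (h u v - w u v)"
    proof cases
      case 1 then show ?thesis using s(2) by (simp add: h_def)
    next
      case 2 then show ?thesis using gg by (simp add: h_def)
    next
      case 3 then show ?thesis using gg' s(1) by (simp add: h_def)
    next
      case 4 then have "h u v = f u v" "h v u = f v u" by (simp_all add: h_def)
      then show ?thesis using ff[OF 4] by presburger
    qed
  qed
  moreover have "3 dvd (T v - sum (h v) V)" if v: "v \<in> V" for v
  proof (cases "v = x")
    case True
    have "sum (h x) V = sum g (V - {x})"
      unfolding sum.remove[OF fin x] by (auto simp: h_def intro: sum.cong)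
    then show ?thesis using Tx True by simp
  next
    case False
    have "sum (h v) V = - g v + sum (f v) (V - {x})"
      unfolding sum.remove[OF fin x] using False by (auto simp: h_def intro: sum.cong)
    then have "T v - sum (h v) V = T v + g v - sum (f v) (V - {x})" by simp
    moreover have "3 dvd (T v + g v - sum (f v) (V - {x}))" using fT False v by blast
    ultimately show ?thesis by (simp only:)
  qed
  ultimately show ?thesis unfolding orientable_def by blast
qed

text \<open>Orient one edge from \<open>a\<close> to \<open>b\<close> and charge it to the demands.\<close>

lemma orientable_delete:
  assumes fin: "finite V" and ab: "a \<in> V" "b \<in> V" "a \<noteq> b"
    and sol: "orientable V (\<lambda>u v. w u v - edge a b u v) (T(a := T a - 1, b := T b + 1))"
  shows "orientable V w T"
proof -
  obtain f where f: "net_orientation V (\<lambda>u v. w u v - edge a b u v) f"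
    and fT: "\<forall>v\<in>V. 3 dvd ((T(a := T a - 1, b := T b + 1)) v - sum (f v) V)"
    using sol unfolding orientable_def by blast
  define d :: "'a \<Rightarrow> 'a \<Rightarrow> int" where
    "d u v = (if u = a \<and> v = b then 1 else 0) - (if u = b \<and> v = a then 1 else 0)" for u v
  define h where "h u v = f u v + d u v" for u v
  have ds: "sum (d u) V = (if u = a then 1 else 0) - (if u = b then 1 else 0)" for u
    unfolding d_def using ab fin by (auto simp: sum_subtractf)
  have "net_orientation V w h"
    unfolding net_orientation_def
  proof (intro ballI)
    fix u v assume uv: "u \<in> V" "v \<in> V"
    have "f u v = - f v u" "\<bar>f u v\<bar> \<le> w u v - edge a b u v" "even (f u v - (w u v - edge a b u v))"
      using f uv unfolding net_orientation_def by blast+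
    then show "h u v = - h v u \<and> \<bar>h u v\<bar> \<le> w u v \<and> even (h u v - w u v)"
      using ab unfolding h_def d_def edge_def
      by (auto simp: abs_le_iff split: if_splits)
  qed
  moreover have "3 dvd (T v - sum (h v) V)" if v: "v \<in> V" for v
  proof -
    have "T v - sum (h v) V = (T(a := T a - 1, b := T b + 1)) v - sum (f v) V"
      unfolding h_def sum.distrib ds using ab by auto
    then show ?thesis using fT v by metis
  qed
  ultimately show ?thesis unfolding orientable_def by blast
qed

text \<open>An arc between \<open>a\<close> and \<open>b\<close> is subdivided at \<open>x\<close>; this does not change the net outflow of any
vertex, and in particular contributes nothing at \<open>x\<close>.\<close>

lemma orientable_lift:
  assumes fin: "finite V" and w: "multiplicity_fun w"
    and V: "x \<in> V" "a \<in> V" "b \<in> V" and ne: "a \<noteq> x" "b \<noteq> x"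
    and sol: "orientable V (\<lambda>u v. w u v - edge x a u v - edge x b u v + edge a b u v) T"
  shows "orientable V w T"
proof -
  let ?w = "\<lambda>u v. w u v - edge x a u v - edge x b u v + edge a b u v"
  obtain f where f: "net_orientation V ?w f"
    and fT: "\<forall>v\<in>V. 3 dvd (T v - sum (f v) V)"
    using sol unfolding orientable_def by blast
  have fD: "f u v = - f v u" "\<bar>f u v\<bar> \<le> ?w u v" "even (f u v - ?w u v)"
    if "u \<in> V" "v \<in> V" for u v
    using f that unfolding net_orientation_def by blast+
  show ?thesis
  proof (cases "a = b")
    case True
    have "net_orientation V w f" unfolding net_orientation_def
    proof (intro ballI)
      fix u v assume uv: "u \<in> V" "v \<in> V"
      show "f u v = - f v u \<and> \<bar>f u v\<bar> \<le> w u v \<and> even (f u v - w u v)"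
        using fD[OF uv] True by (auto simp: edge_self edge_def split: if_splits)
    qed
    then show ?thesis using fT unfolding orientable_def by blast
  next
    case False
    have ab: "f a b = - f b a" "\<bar>f a b\<bar> \<le> w a b + 1" "even (f a b - (w a b + 1))"
      using fD[OF V(2,3)] False ne by (auto simp: edge_def)
    have w0: "0 \<le> w a b" "w a b = w b a" using w by (auto simp: multiplicity_fun_def)
    \<comment> \<open>The lifted arc whose removal from the bundle between \<open>a\<close> and \<open>b\<close> leaves an admissible
    surplus.\<close>
    define \<epsilon> :: int where "\<epsilon> = (if f a b \<ge> 0 then 1 else -1)"
    have eps: "\<epsilon> = 1 \<or> \<epsilon> = -1" "\<bar>f a b - \<epsilon>\<bar> \<le> w a b" "even (f a b - \<epsilon> - w a b)"
    proof -
      show "\<bar>f a b - \<epsilon>\<bar> \<le> w a b"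
      proof (cases "f a b = 0")
        case True
        then have "w a b \<noteq> 0" using ab(3) by auto
        then show ?thesis using w0 True unfolding \<epsilon>_def by auto
      next
        case False
        then show ?thesis using ab(2) unfolding \<epsilon>_def by auto
      qed
    qed (use ab(3) in \<open>auto simp: \<epsilon>_def\<close>)
    define i :: "'a \<Rightarrow> 'a \<Rightarrow> 'a \<Rightarrow> 'a \<Rightarrow> int" where
      "i p q u v = (if u = p \<and> v = q then 1 else 0)" for p q u v
    have i_sym: "i p q u v = i q p v u" for p q u v unfolding i_def by meson
    define d where
      "d u v = i a x u v - i x a u v + i x b u v - i b x u v - i a b u v + i b a u v" for u v
    define h where "h u v = f u v + \<epsilon> * d u v" for u v
    have delta: "sum (i c c' u) V = (if u = c then 1 else 0)" if "c' \<in> V" for u c c'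
      using that fin unfolding i_def by auto
    have ds: "sum (d u) V = 0" for u
      unfolding d_def by (simp add: sum.distrib sum_subtractf delta V)
    have "net_orientation V w h"
      unfolding net_orientation_def
    proof (intro ballI)
      fix u v assume uv: "u \<in> V" "v \<in> V"
      have anti: "d u v = - d v u"
        unfolding d_def using i_sym[of a x u v] i_sym[of x a u v] i_sym[of b x u v] i_sym[of x b u v]
          i_sym[of a b u v] i_sym[of b a u v] by linarith
      have anti': "h u v = - h v u" unfolding h_def using anti fD(1)[OF uv] by simp
      let ?ab = "u = a \<and> v = b \<or> u = b \<and> v = a"
      let ?x = "u = a \<and> v = x \<or> u = x \<and> v = a \<or> u = b \<and> v = x \<or> u = x \<and> v = b"
      consider (1) ?ab | (2) ?x | (3) "\<not> ?ab" "\<not> ?x"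
        by argo
      then have "\<bar>h u v\<bar> \<le> w u v \<and> even (h u v - w u v)"
      proof cases
        case 1
        have "h a b = f a b - \<epsilon>" "h b a = - (f a b - \<epsilon>)"
          using ab(1) ne False unfolding h_def d_def i_def by auto
        then show ?thesis using 1 eps(2,3) w0(2) by auto
      next
        case 2
        then have "edge x a u v - edge a b u v + edge x b u v = 1" "d u v = 1 \<or> d u v = -1"
          using ne False by (auto simp: edge_def d_def i_def)
        moreover have "edge a b u v = 0" using 2 ne False by (auto simp: edge_def)
        ultimately have "\<bar>f u v\<bar> \<le> w u v - 1" "even (f u v - (w u v - 1))"
          "h u v = f u v + 1 \<or> h u v = f u v - 1"
          using fD(2,3)[OF uv] eps(1) unfolding h_def by (auto simp: algebra_simps)
        then show ?thesis by (elim disjE) (auto simp: abs_le_iff)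
      next
        case 3
        have "edge a b u v = 0" "edge x a u v = 0" "edge x b u v = 0"
          unfolding edge_def by (rule if_not_P; use 3 in blast)+
        moreover have "i a x u v = 0" "i x a u v = 0" "i x b u v = 0" "i b x u v = 0"
          "i a b u v = 0" "i b a u v = 0"
          unfolding i_def by (rule if_not_P; use 3 in blast)+
        ultimately show ?thesis using fD(2,3)[OF uv] unfolding h_def d_def by simp
      qed
      then show "h u v = - h v u \<and> \<bar>h u v\<bar> \<le> w u v \<and> even (h u v - w u v)"
        using anti' by blast
    qed
    moreover have "3 dvd (T v - sum (h v) V)" if v: "v \<in> V" for v
      using fT v unfolding h_def sum.distrib by (simp add: sum_distrib_left[symmetric] ds)
    ultimately show ?thesis unfolding orientable_def by blast
  qed
qed

text \<open>An orientation of the contracted graph first fixes the arcs between \<open>X\<close> and the rest.  What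
these leave to be realised inside \<open>X\<close> depends on how they are distributed, hence the quantification
over \<open>g\<close>.\<close>

lemma orientable_contract:
  assumes fin: "finite V" and w: "multiplicity_fun w" and X: "X \<subseteq> V" and r: "r \<in> X"
    and outer: "orientable (insert r (V - X)) (contract X r w) (\<lambda>v. if v = r then sum T X else T v)"
    and inner: "\<And>g. \<forall>x\<in>X. \<forall>v\<in>V - X. \<bar>g x v\<bar> \<le> w x v \<and> even (g x v - w x v) \<Longrightarrow>
      3 dvd (\<Sum>x\<in>X. T x - (\<Sum>v\<in>V - X. g x v)) \<Longrightarrow>
      orientable X w (\<lambda>x. T x - (\<Sum>v\<in>V - X. g x v))"
  shows "orientable V w T"
proof -
  let ?V = "insert r (V - X)" and ?w = "contract X r w"
  have finX: "finite X" using fin X finite_subset by blast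
  obtain f1 where f1: "net_orientation ?V ?w f1"
    and f1T: "\<forall>v\<in>?V. 3 dvd ((if v = r then sum T X else T v) - sum (f1 v) ?V)"
    using outer unfolding orientable_def by blast
  have f1D: "f1 u v = - f1 v u" "\<bar>f1 u v\<bar> \<le> ?w u v" "even (f1 u v - ?w u v)"
    if "u \<in> ?V" "v \<in> ?V" for u v
    using f1 that unfolding net_orientation_def by blast+
  have "\<forall>v\<in>V - X. \<exists>g. (\<forall>x\<in>X. \<bar>g x\<bar> \<le> w x v \<and> even (g x - w x v)) \<and> sum g X = f1 r v"
  proof
    fix v assume v: "v \<in> V - X"
    then have "?w r v = (\<Sum>x\<in>X. w x v)" using r by (auto simp: contract_def)
    then show "\<exists>g. (\<forall>x\<in>X. \<bar>g x\<bar> \<le> w x v \<and> even (g x - w x v)) \<and> sum g X = f1 r v"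
      using split_sum[OF finX, of "\<lambda>x. w x v" "f1 r v"] f1D(2,3)[of r v] v w
      by (auto simp: multiplicity_fun_def)
  qed
  then obtain G where G: "\<forall>v\<in>V - X. (\<forall>x\<in>X. \<bar>G v x\<bar> \<le> w x v \<and> even (G v x - w x v)) \<and> sum (G v) X = f1 r v"
    by metis
  define g where "g x v = G v x" for x v
  have g: "\<forall>x\<in>X. \<forall>v\<in>V - X. \<bar>g x v\<bar> \<le> w x v \<and> even (g x v - w x v)"
    and gs: "\<And>v. v \<in> V - X \<Longrightarrow> (\<Sum>x\<in>X. g x v) = f1 r v"
    using G unfolding g_def by auto
  have rr: "f1 r r = 0" using f1D(1)[of r r] by simp
  have sr: "(\<Sum>x\<in>X. \<Sum>v\<in>V - X. g x v) = sum (f1 r) ?V"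
  proof -
    have "(\<Sum>x\<in>X. \<Sum>v\<in>V - X. g x v) = (\<Sum>v\<in>V - X. \<Sum>x\<in>X. g x v)" by (rule sum.swap)
    also have "\<dots> = sum (f1 r) (V - X)" by (intro sum.cong) (auto simp: gs)
    finally show ?thesis using rr r fin by simp
  qed
  have "3 dvd (\<Sum>x\<in>X. T x - (\<Sum>v\<in>V - X. g x v))"
    using f1T sr by (simp add: sum_subtractf)
  then obtain f2 where f2: "net_orientation X w f2"
    and f2T: "\<forall>v\<in>X. 3 dvd (T v - (\<Sum>u\<in>V - X. g v u) - sum (f2 v) X)"
    using inner[OF g] unfolding orientable_def by blast
  define h where "h u v = (if u \<in> X then (if v \<in> X then f2 u v else g u v)
    else if v \<in> X then - g v u else f1 u v)" for u v
  have "net_orientation V w h" unfolding net_orientation_def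
  proof (intro ballI)
    fix u v assume uv: "u \<in> V" "v \<in> V"
    have 1: "?w u v = w u v" if "u \<notin> X" "v \<notin> X" using that r by (auto simp: contract_def)
    have 2: "f2 u v = - f2 v u \<and> \<bar>f2 u v\<bar> \<le> w u v \<and> even (f2 u v - w u v)" if "u \<in> X" "v \<in> X"
      using f2 that unfolding net_orientation_def by blast
    have 3: "w u v = w v u" using w by (rule multiplicity_fun_sym)
    consider "u \<in> X" "v \<in> X" | "u \<in> X" "v \<notin> X" | "u \<notin> X" "v \<in> X" | "u \<notin> X" "v \<notin> X" by blast
    then show "h u v = - h v u \<and> \<bar>h u v\<bar> \<le> w u v \<and> even (h u v - w u v)"
    proof cases
      case 1 then have "h u v = f2 u v" "h v u = f2 v u" by (simp_all add: h_def)
      then show ?thesis using 2[OF 1] by presburger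
    next
      case 2 then have "\<bar>g u v\<bar> \<le> w u v \<and> even (g u v - w u v)" using g uv by blast
      then show ?thesis using 2 by (simp add: h_def)
    next
      case 3 then have "\<bar>g v u\<bar> \<le> w v u \<and> even (g v u - w v u)" using g uv by blast
      then show ?thesis using 3 \<open>w u v = w v u\<close> by (simp add: h_def)
    next
      case 4 then have "h u v = f1 u v" "h v u = f1 v u" by (simp_all add: h_def)
      then show ?thesis using f1D[of u v] uv 1[OF 4] 4 by simp
    qed
  qed
  moreover have "3 dvd (T v - sum (h v) V)" if v: "v \<in> V" for v
  proof -
    have *: "sum (h v) V = sum (h v) X + sum (h v) (V - X)"
      using sum.subset_diff[OF X fin] by (simp add: add.commute)
    show ?thesis
    proof (cases "v \<in> X")
      case True
      have "sum (h v) X = sum (f2 v) X" "sum (h v) (V - X) = sum (g v) (V - X)"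
        using True by (auto simp: h_def intro: sum.cong)
      then show ?thesis using f2T True * by (simp add: algebra_simps)
    next
      case False
      have "sum (h v) X = - (\<Sum>x\<in>X. g x v)" "sum (h v) (V - X) = sum (f1 v) (V - X)"
        using False by (auto simp: h_def sum_negf[symmetric] intro: sum.cong)
      then have "sum (h v) V = sum (f1 v) ?V"
        using * gs[of v] False v f1D(1)[of r v] r fin by simp
      then show ?thesis using f1T False v r by (auto split: if_splits)
    qed
  qed
  ultimately show ?thesis unfolding orientable_def by blast
qed

lemma Z3_connected_contract:
  assumes "finite V" "multiplicity_fun w" "X \<subseteq> V" "r \<in> X"
    and "Z3_connected X w"
    and "orientable (insert r (V - X)) (contract X r w) (\<lambda>v. if v = r then sum T X else T v)"
  shows "orientable V w T"
  using orientable_contract[OF assms(1-4,6)] assms(5) unfolding Z3_connected_def by blast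

text \<open>Two edges at \<open>x\<close> contribute -2, 0 or 2 to its net outflow, that is, every residue modulo 3.\<close>

lemma Z3_connected_drop_vertex:
  assumes fin: "finite V" and x: "x \<in> V" and w: "multiplicity_fun w"
    and Z: "Z3_connected (V - {x}) w" and deg: "2 \<le> sum (w x) (V - {x})"
  shows "Z3_connected V w"
  unfolding Z3_connected_def
proof (intro allI impI)
  fix T :: "'a \<Rightarrow> int" assume T: "3 dvd sum T V"
  define D where "D = sum (w x) (V - {x})"
  have "\<exists>s. \<bar>s\<bar> \<le> D \<and> even (s - D) \<and> 3 dvd (T x - s)"
  proof -
    have D2: "2 \<le> D" using deg D_def by simp
    have r: "T x mod 3 = 0 \<or> T x mod 3 = 1 \<or> T x mod 3 = 2" by presburger
    show ?thesis
    proof (cases "even D")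
      case True
      then show ?thesis using r D2
        by (elim disjE; intro exI[of _ "if T x mod 3 = 0 then 0 else if T x mod 3 = 1 then -2 else 2"])
          (simp_all, presburger+)
    next
      case False
      then have "3 \<le> D" using D2 by presburger
      then show ?thesis using r False
        by (elim disjE; intro exI[of _ "if T x mod 3 = 0 then 3 else if T x mod 3 = 1 then 1 else -1"])
          (simp_all, presburger+)
    qed
  qed
  then obtain s where s: "\<bar>s\<bar> \<le> D" "even (s - D)" "3 dvd (T x - s)" by blast
  obtain g where g: "\<forall>y\<in>V - {x}. \<bar>g y\<bar> \<le> w x y \<and> even (g y - w x y)" "sum g (V - {x}) = s"
    using split_sum[of "V - {x}" "w x" s] s fin w unfolding D_def by (auto simp: multiplicity_fun_def)
  have "sum T V = T x + sum T (V - {x})" by (rule sum.remove[OF fin x])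
  then have "(\<Sum>y\<in>V - {x}. T y + g y) = sum T V - (T x - s)" by (simp add: sum.distrib g(2))
  then have "3 dvd (\<Sum>y\<in>V - {x}. T y + g y)" using T s(3) by simp
  then have "orientable (V - {x}) w (\<lambda>y. T y + g y)"
    using Z unfolding Z3_connected_def by blast
  then show "orientable V w T"
    using orientable_drop_vertex[OF fin x w g(1)] s(3) g(2) by simp
qed

lemma Z3_connected_lift:
  assumes "finite V" "multiplicity_fun w" "x \<in> V" "a \<in> V" "b \<in> V" "a \<noteq> x" "b \<noteq> x"
    and "Z3_connected V (\<lambda>u v. w u v - edge x a u v - edge x b u v + edge a b u v)"
  shows "Z3_connected V w"
  using assms(8) orientable_lift[OF assms(1-7)] unfolding Z3_connected_def by blast

lemma Z3_connected_delete:
  assumes fin: "finite V" and ab: "a \<in> V" "b \<in> V" "a \<noteq> b"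
    and Z: "Z3_connected V (\<lambda>u v. w u v - edge a b u v)"
  shows "Z3_connected V w"
  unfolding Z3_connected_def
proof (intro allI impI)
  fix T :: "'a \<Rightarrow> int" assume T: "3 dvd sum T V"
  have "sum (T(a := T a - 1, b := T b + 1)) V = sum T V"
  proof -
    have "(T(a := T a - 1, b := T b + 1)) v = T v - (if v = a then 1 else 0) + (if v = b then 1 else 0)" for v
      using ab by auto
    then show ?thesis using ab fin by (simp add: sum.distrib sum_subtractf)
  qed
  then have "orientable V (\<lambda>u v. w u v - edge a b u v) (T(a := T a - 1, b := T b + 1))"
    using Z T unfolding Z3_connected_def by simp
  then show "orientable V w T" by (rule orientable_delete[OF fin ab])
qed

section \<open>Distance to the multiples of six, and boundaries of vertex sets\<close>

text \<open>If the parity of the net outflow of a set and its residue modulo 3 are prescribed, that is,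
its residue \<open>k\<close> modulo 6, then this is the least number of edges that must leave the set.\<close>

definition dist6 :: "int \<Rightarrow> int" where
  "dist6 k = (if k mod 6 \<le> 3 then k mod 6 else 6 - k mod 6)"

lemma dist6_attained: "\<exists>j. dist6 k = \<bar>k - 6 * j\<bar>"
  and dist6_least: "dist6 k \<le> \<bar>k - 6 * j\<bar>"
proof -
  obtain q r where k: "k = 6 * q + r" "0 \<le> r" "r < 6" "k mod 6 = r"
    using that[of "k div 6" "k mod 6"] by auto
  have n: "dist6 k = (if r \<le> 3 then r else 6 - r)" unfolding dist6_def k(4) ..
  show "\<exists>j. dist6 k = \<bar>k - 6 * j\<bar>"
  proof (cases "r \<le> 3")
    case True
    then show ?thesis using k n by (intro exI[of _ q]) auto
  next
    case False
    then show ?thesis using k n by (intro exI[of _ "q + 1"]) auto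
  qed
  consider "j \<le> q" | "q + 1 \<le> j" by linarith
  then show "dist6 k \<le> \<bar>k - 6 * j\<bar>" unfolding n using k(1-3) by cases auto
qed

lemma dist6_nonneg: "0 \<le> dist6 k" and dist6_le: "dist6 k \<le> 3"
proof -
  have "0 \<le> k mod 6" "k mod 6 < 6" by auto
  then show "0 \<le> dist6 k" "dist6 k \<le> 3" unfolding dist6_def by auto
qed

lemma dist6_parity: "even (dist6 k - k)"
proof -
  obtain j where "dist6 k = \<bar>k - 6 * j\<bar>" using dist6_attained by blast
  then show ?thesis by (auto simp: abs_if)
qed

lemma dist6_add: "dist6 (a + b) \<le> dist6 a + dist6 b"
proof -
  obtain i j where "dist6 a = \<bar>a - 6 * i\<bar>" "dist6 b = \<bar>b - 6 * j\<bar>" using dist6_attained by metis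
  then show ?thesis using dist6_least[of "a + b" "i + j"] by simp
qed

lemma dist6_uminus: "dist6 (- k) = dist6 k"
proof -
  have "dist6 (- k) \<le> dist6 k" for k
  proof -
    obtain j where "dist6 k = \<bar>k - 6 * j\<bar>" using dist6_attained by blast
    then show ?thesis using dist6_least[of "- k" "- j"] by simp
  qed
  from this[of k] this[of "- k"] show ?thesis by simp
qed

lemma dist6_1: "dist6 1 = 1" unfolding dist6_def by simp

lemma dist6_step: "dist6 (k + 1) \<le> dist6 k + 1" "dist6 (k - 1) \<le> dist6 k + 1"
  "dist6 k \<le> dist6 (k + 1) + 1" "dist6 k \<le> dist6 (k - 1) + 1"
proof -
  have *: "dist6 (k + 1) \<le> dist6 k + 1" "dist6 (k - 1) \<le> dist6 k + 1" for k
    using dist6_add[of k 1] dist6_add[of k "-1"] dist6_uminus[of 1] dist6_1 by auto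
  show "dist6 (k + 1) \<le> dist6 k + 1" "dist6 (k - 1) \<le> dist6 k + 1" by (rule *)+
  show "dist6 k \<le> dist6 (k + 1) + 1" "dist6 k \<le> dist6 (k - 1) + 1" using *[of "k + 1"] *[of "k - 1"] by auto
qed

lemma cut_Un_left: "finite A \<Longrightarrow> finite B \<Longrightarrow> A \<inter> B = {} \<Longrightarrow> cut w (A \<union> B) C = cut w A C + cut w B C"
  unfolding cut_def by (rule sum.union_disjoint)

lemma cut_Un_right: "finite A \<Longrightarrow> finite B \<Longrightarrow> A \<inter> B = {} \<Longrightarrow> cut w C (A \<union> B) = cut w C A + cut w C B"
  unfolding cut_def by (simp add: sum.union_disjoint sum.distrib)

lemma cut_sym: "multiplicity_fun w \<Longrightarrow> cut w A B = cut w B A"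
  unfolding cut_def by (subst sum.swap) (simp add: multiplicity_fun_sym)

lemma cut_nonneg: "multiplicity_fun w \<Longrightarrow> 0 \<le> cut w A B"
  unfolding cut_def by (intro sum_nonneg) (simp add: multiplicity_fun_nonneg)

lemma cut_singleton_left: "cut w {x} B = sum (w x) B"
  and cut_singleton_right: "cut w A {x} = (\<Sum>u\<in>A. w u x)"
  unfolding cut_def by auto

lemma cut_empty [simp]: "cut w {} B = 0" "cut w A {} = 0"
  unfolding cut_def by auto

lemma cut_mono: "multiplicity_fun w \<Longrightarrow> finite A \<Longrightarrow> finite B \<Longrightarrow> A' \<subseteq> A \<Longrightarrow> B' \<subseteq> B \<Longrightarrow> cut w A' B' \<le> cut w A B"
  unfolding cut_def
  by (rule order.trans[OF sum_mono2 sum_mono]) (auto intro!: sum_nonneg sum_mono2 simp: multiplicity_fun_nonneg)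

lemma cut_add: "cut (\<lambda>u v. w u v + w' u v) A B = cut w A B + cut w' A B"
  unfolding cut_def by (simp add: sum.distrib)

lemma cut_edge:
  assumes "finite A" "finite B" "A \<inter> B = {}" "a \<in> A \<union> B" "b \<in> A \<union> B"
  shows "cut (edge a b) A B = of_bool ((a \<in> A) \<noteq> (b \<in> A))"
proof (cases "a = b")
  case True
  then show ?thesis by (simp add: cut_def edge_def)
next
  case False
  have "(\<Sum>v\<in>B. edge a b u v) = (if u = a \<and> b \<in> B then 1 else 0) + (if u = b \<and> a \<in> B then 1 else 0)" for u
  proof -
    have "edge a b u v = (if v = b then (if u = a then 1 else 0) else 0) + (if v = a then (if u = b then 1 else 0) else 0)" for v
      using False by (auto simp: edge_def)
    then show ?thesis using assms by (simp add: sum.distrib)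
  qed
  then have "cut (edge a b) A B = of_bool (a \<in> A \<and> b \<in> B) + of_bool (b \<in> A \<and> a \<in> B)"
    unfolding cut_def using assms(1,2)
    by (cases "b \<in> B"; cases "a \<in> B") (simp_all add: sum.distrib)
  then show ?thesis using assms by auto
qed

lemma even_cut_self:
  assumes "finite A" "multiplicity_fun w"
  shows "even (cut w A A)"
  using assms(1)
proof (induction rule: finite_induct)
  case (insert x A)
  have "cut w (insert x A) (insert x A) = cut w {x} {x} + cut w {x} A + cut w A {x} + cut w A A"
    using insert.hyps cut_Un_left[of "{x}" A w] cut_Un_right[of "{x}" A w] by simp
  moreover have "cut w {x} A = cut w A {x}" by (rule cut_sym[OF assms(2)])
  moreover have "cut w {x} {x} = 0" using assms(2) by (simp add: cut_def multiplicity_fun_diag)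
  ultimately show ?case using insert.IH by simp
qed simp

text \<open>The number of edges leaving \<open>A\<close> when each vertex \<open>v\<close> is also joined by \<open>c v\<close> edges to one
further vertex outside \<open>V\<close>.\<close>

definition boundary :: "'v set \<Rightarrow> ('v \<Rightarrow> 'v \<Rightarrow> int) \<Rightarrow> ('v \<Rightarrow> int) \<Rightarrow> 'v set \<Rightarrow> int" where
  "boundary V w c A = cut w A (V - A) + sum c A"

lemma boundary_Un:
  assumes fin: "finite V" and w: "multiplicity_fun w" and AB: "A \<subseteq> V" "B \<subseteq> V" "A \<inter> B = {}"
  shows "boundary V w c (A \<union> B) = boundary V w c A + boundary V w c B - 2 * cut w A B"
proof -
  have f: "finite A" "finite B" "finite (V - (A \<union> B))" using fin AB finite_subset by blast+
  have 1: "V - A = B \<union> (V - (A \<union> B))" "V - B = A \<union> (V - (A \<union> B))" using AB by auto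
  have "cut w A (V - A) = cut w A B + cut w A (V - (A \<union> B))"
    unfolding 1(1) by (rule cut_Un_right) (use f in auto)
  moreover have "cut w B (V - B) = cut w B A + cut w B (V - (A \<union> B))"
    unfolding 1(2) by (rule cut_Un_right) (use f in auto)
  moreover have "cut w (A \<union> B) (V - (A \<union> B)) = cut w A (V - (A \<union> B)) + cut w B (V - (A \<union> B))"
    by (rule cut_Un_left) (use f AB in auto)
  moreover have "sum c (A \<union> B) = sum c A + sum c B" by (rule sum.union_disjoint) (use f AB in auto)
  moreover have "cut w B A = cut w A B" by (rule cut_sym[OF w])
  ultimately show ?thesis unfolding boundary_def by simp
qed

lemma boundary_insert:
  assumes "finite V" "multiplicity_fun w" "A \<subseteq> V" "x \<in> V" "x \<notin> A"
  shows "boundary V w c (insert x A) = boundary V w c A + boundary V w c {x} - 2 * sum (w x) A"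
  using boundary_Un[OF assms(1,2), of "{x}" A c] assms by (simp add: cut_singleton_left)

lemma boundary_singleton:
  assumes "finite V" "multiplicity_fun w" "x \<in> V"
  shows "boundary V w c {x} = sum (w x) V + c x"
  using assms sum.remove[of V x "w x"] by (simp add: boundary_def cut_singleton_left multiplicity_fun_diag)

lemma boundary_uncross_pieces:
  assumes fin: "finite V" and w: "multiplicity_fun w" and A: "A \<subseteq> V" and B: "B \<subseteq> V"
  shows "boundary V w c A + boundary V w c B = boundary V w c (A \<inter> B) + boundary V w c (A \<union> B) + 2 * cut w (A - B) (B - A)"
    and "boundary V w c A + boundary V w c B = boundary V w c (A - B) + boundary V w c (B - A)
      + 2 * cut w (A \<inter> B) (V - (A \<union> B)) + 2 * sum c (A \<inter> B)"
proof -
  define P Q R S where "P = A - B" and "Q = B - A" and "R = A \<inter> B" and "S = V - (A \<union> B)"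
  note defs = P_def Q_def R_def S_def
  have f: "finite P" "finite Q" "finite R" "finite S"
    unfolding defs using fin A B finite_subset by blast+
  have dj: "P \<inter> Q = {}" "P \<inter> R = {}" "P \<inter> S = {}" "Q \<inter> R = {}" "Q \<inter> S = {}" "R \<inter> S = {}"
    unfolding defs by auto
  have "A = P \<union> R" "V - A = Q \<union> S" "B = Q \<union> R" "V - B = P \<union> S" "V - (A \<inter> B) = P \<union> (Q \<union> S)" "A \<inter> B = R"
    "A \<union> B = P \<union> (Q \<union> R)" "V - (A \<union> B) = S" "A - B = P" "B - A = Q" "V - P = Q \<union> (R \<union> S)" "V - Q = P \<union> (R \<union> S)"
    unfolding defs using A B by auto
  note eqs = this
  have s: "cut w Q P = cut w P Q" "cut w R P = cut w P R" "cut w S P = cut w P S" "cut w R Q = cut w Q R"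
    "cut w S Q = cut w Q S" "cut w S R = cut w R S"
    using cut_sym[OF w] by blast+
  have dj': "R \<inter> P = {}" "Q \<inter> P = {}" "P \<inter> (Q \<union> S) = {}" "P \<inter> (Q \<union> R) = {}" "Q \<inter> (R \<union> S) = {}" "P \<inter> (R \<union> S) = {}"
    using dj by auto
  have cl: "cut w (X \<union> Y) Z = cut w X Z + cut w Y Z" "cut w Z (X \<union> Y) = cut w Z X + cut w Z Y" "sum c (X \<union> Y) = sum c X + sum c Y"
    if "finite X" "finite Y" "X \<inter> Y = {}" for X Y Z
    using that by (simp_all add: cut_Un_left cut_Un_right sum.union_disjoint)
  have b: "boundary V w c A = cut w P Q + cut w P S + cut w R Q + cut w R S + sum c P + sum c R"
    "boundary V w c B = cut w Q P + cut w Q S + cut w R P + cut w R S + sum c Q + sum c R"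
    "boundary V w c R = cut w R P + cut w R Q + cut w R S + sum c R"
    "boundary V w c (A \<union> B) = cut w P S + cut w Q S + cut w R S + sum c P + sum c Q + sum c R"
    "boundary V w c P = cut w P Q + cut w P R + cut w P S + sum c P"
    "boundary V w c Q = cut w Q P + cut w Q R + cut w Q S + sum c Q"
    unfolding boundary_def
    subgoal unfolding eqs(2) by (subst (1 2) eqs(1)) (simp add: cl f dj)
    subgoal unfolding eqs(4) by (subst (1 2) eqs(3)) (simp add: cl f dj)
    subgoal using eqs(5,6) by (simp add: cl f dj dj')
    subgoal unfolding eqs(8) unfolding eqs(7) by (simp add: cl f dj dj')
    subgoal unfolding eqs(11) by (simp add: cl f dj dj')
    subgoal unfolding eqs(12) by (simp add: cl f dj dj')
    done
  show "boundary V w c A + boundary V w c B = boundary V w c (A \<inter> B) + boundary V w c (A \<union> B) + 2 * cut w (A - B) (B - A)"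
    unfolding eqs(6,9,10) unfolding b by (simp add: s)
  show "boundary V w c A + boundary V w c B = boundary V w c (A - B) + boundary V w c (B - A)
      + 2 * cut w (A \<inter> B) (V - (A \<union> B)) + 2 * sum c (A \<inter> B)"
    unfolding eqs(6,8,9,10) unfolding b by (simp add: s)
qed

lemma boundary_submodular:
  assumes "finite V" "multiplicity_fun w" "A \<subseteq> V" "B \<subseteq> V"
  shows "boundary V w c (A \<inter> B) + boundary V w c (A \<union> B) \<le> boundary V w c A + boundary V w c B"
  using boundary_uncross_pieces(1)[OF assms, of c] cut_nonneg[OF assms(2), of "A - B" "B - A"] by linarith

text \<open>The edges between \<open>A \<inter> B\<close> and the outside of \<open>A \<union> B\<close> are counted twice on the
right and not at all in the two differences; the edges to \<open>x\<close> are among them.\<close>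

lemma boundary_posimodular:
  assumes "finite V" "multiplicity_fun w" "A \<subseteq> V" "B \<subseteq> V" "x \<in> V" "x \<notin> A" "x \<notin> B" "\<forall>v\<in>V. 0 \<le> c v"
  shows "boundary V w c (A - B) + boundary V w c (B - A) + 2 * sum (w x) (A \<inter> B) \<le> boundary V w c A + boundary V w c B"
proof -
  have "cut w (A \<inter> B) {x} \<le> cut w (A \<inter> B) (V - (A \<union> B))"
    using assms by (intro cut_mono) (auto intro: finite_subset)
  moreover have "cut w (A \<inter> B) {x} = sum (w x) (A \<inter> B)"
    unfolding cut_singleton_right using multiplicity_fun_sym[OF assms(2)] by (intro sum.cong) auto
  moreover have "0 \<le> sum c (A \<inter> B)" using assms(3,8) by (intro sum_nonneg) auto
  ultimately show ?thesis using boundary_uncross_pieces(2)[OF assms(1-4), of c] by linarith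
qed

lemma boundary_parity:
  assumes "finite V" "multiplicity_fun w" "A \<subseteq> V" "\<forall>v\<in>V. even (t v - (sum (w v) V + c v))"
  shows "even (boundary V w c A - sum t A)"
proof -
  have finA: "finite A" using assms finite_subset by blast
  have "cut w A V = cut w A A + cut w A (V - A)"
    using cut_Un_right[of A "V - A" w A] assms finA by (simp add: Un_absorb1)
  then have *: "boundary V w c A - sum t A = (\<Sum>v\<in>A. sum (w v) V + c v - t v) - cut w A A"
    unfolding boundary_def by (simp add: cut_def sum.distrib sum_subtractf)
  have "even (\<Sum>v\<in>A. sum (w v) V + c v - t v)"
    using assms(3,4) by (intro dvd_sum) (auto simp: subset_iff)
  then show ?thesis unfolding * using even_cut_self[OF finA assms(2)] by simp
qed

text \<open>Listing the edges at a vertex one by one, with repetition for parallel edges, turns statements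
about multiplicities into case distinctions over at most five list entries.\<close>

lemma edge_list:
  fixes m :: "'v \<Rightarrow> int"
  assumes "finite V" "\<forall>y\<in>V. 0 \<le> m y" "sum m V = int k"
  shows "\<exists>ys. length ys = k \<and> set ys \<subseteq> V \<and> (\<forall>y\<in>V. m y = int (count_list ys y))"
  using assms
proof (induction V arbitrary: k rule: finite_induct)
  case empty
  then show ?case by auto
next
  case (insert x V)
  have "0 \<le> sum m V" using insert.prems by (intro sum_nonneg) auto
  then obtain l where l: "sum m V = int l" using nonneg_int_cases by metis
  obtain n where n: "m x = int n" using insert.prems nonneg_int_cases by (metis insertI1)
  obtain ys where ys: "length ys = l" "set ys \<subseteq> V" "\<forall>y\<in>V. m y = int (count_list ys y)"
    using insert.IH[OF _ l] insert.prems by auto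
  have "count_list (replicate n x @ ys) y = (if y = x then n else count_list ys y)" if "y \<in> insert x V" for y
  proof -
    have "count_list (replicate n x) y = (if y = x then n else 0)" by (induction n) auto
    moreover have "count_list ys x = 0" using ys(2) insert.hyps by (auto simp: count_list_0_iff)
    ultimately show ?thesis by auto
  qed
  moreover have "n + l = k" using insert.prems(2) insert.hyps l n by simp
  ultimately show ?case using ys n insert.hyps
    by (intro exI[of _ "replicate n x @ ys"]) auto
qed

lemma sum_count_list:
  assumes "finite A"
  shows "(\<Sum>y\<in>A. int (count_list ys y)) = (\<Sum>y\<leftarrow>ys. of_bool (y \<in> A))"
proof (induction ys)
  case (Cons a ys)
  have "(\<Sum>y\<in>A. int (count_list (a # ys) y)) = (\<Sum>y\<in>A. int (count_list ys y)) + (\<Sum>y\<in>A. if y = a then 1 else 0)"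
    by (subst sum.distrib[symmetric]) (rule sum.cong, auto)
  then show ?case using Cons assms by simp
qed simp

lemma orientable_cong:
  assumes "\<And>u v. u \<in> V \<Longrightarrow> v \<in> V \<Longrightarrow> w u v = w' u v" "\<And>v. v \<in> V \<Longrightarrow> T v = T' v"
  shows "orientable V w T \<longleftrightarrow> orientable V w' T'"
  unfolding orientable_def net_orientation_def using assms by simp

lemma multiplicity_fun_add_edge: "multiplicity_fun w \<Longrightarrow> multiplicity_fun (\<lambda>u v. w u v + edge a b u v)"
  unfolding multiplicity_fun_def by (auto simp: edge_sym[of a b] edge_nonneg edge_diag intro: add_nonneg_nonneg)

lemma multiplicity_fun_remove_edge:
  assumes w: "multiplicity_fun w" and ab: "a \<noteq> b \<Longrightarrow> 1 \<le> w a b"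
  shows "multiplicity_fun (\<lambda>u v. w u v - edge a b u v)"
  unfolding multiplicity_fun_def
proof (intro conjI allI)
  fix u v
  show "w u v - edge a b u v = w v u - edge a b v u"
    using multiplicity_fun_sym[OF w, of u v] edge_sym[of a b u v] by simp
  show "0 \<le> w u v - edge a b u v"
    using multiplicity_fun_nonneg[OF w, of u v] multiplicity_fun_sym[OF w, of b a] ab
    by (auto simp: edge_def)
  show "w v v - edge a b v v = 0" using w by (simp add: edge_diag multiplicity_fun_diag)
qed

lemma multiplicity_fun_lift:
  assumes w: "multiplicity_fun w" and ne: "a \<noteq> x" "b \<noteq> x"
    and pos: "1 + of_bool (a = b) \<le> w x a" "1 \<le> w x b"
  shows "multiplicity_fun (\<lambda>u v. w u v - edge x a u v - edge x b u v + edge a b u v)"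
proof (rule multiplicity_fun_add_edge)
  have "multiplicity_fun (\<lambda>u v. w u v - edge x a u v)"
    by (rule multiplicity_fun_remove_edge[OF w]) (use pos(1) in \<open>auto simp: of_bool_def split: if_splits\<close>)
  then show "multiplicity_fun (\<lambda>u v. w u v - edge x a u v - edge x b u v)"
    by (rule multiplicity_fun_remove_edge) (use ne pos in \<open>auto simp: edge_def of_bool_def split: if_splits\<close>)
qed

text \<open>Lifting the pair \<open>xa\<close>, \<open>xb\<close> and orienting all other edges at \<open>x\<close> by \<open>g\<close> removes \<open>x\<close>.\<close>

lemma orientable_remove_lift:
  assumes fin: "finite V" and w: "multiplicity_fun w" and x: "x \<in> V"
    and ab: "a \<in> V - {x}" "b \<in> V - {x}"
    and g: "\<forall>y\<in>V - {x}. \<bar>g y\<bar> \<le> w x y - of_bool (y = a) - of_bool (y = b)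
      \<and> even (g y - (w x y - of_bool (y = a) - of_bool (y = b)))"
    and Tx: "3 dvd (T x - sum g (V - {x}))"
    and sol: "orientable (V - {x}) (\<lambda>u v. w u v + edge a b u v) (\<lambda>y. T y + g y)"
  shows "orientable V w T"
proof (rule orientable_lift[OF fin w x, of a b])
  let ?w = "\<lambda>u v. w u v - edge x a u v - edge x b u v + edge a b u v"
  have gB: "\<bar>g y\<bar> \<le> w x y - of_bool (y = a) - of_bool (y = b)" if "y \<in> V - {x}" for y
    using g that by blast
  have pos: "1 + of_bool (a = b) \<le> w x a" "1 \<le> w x b"
    using gB[OF ab(1)] gB[OF ab(2)] by (auto simp: of_bool_def split: if_splits)
  have wx: "?w x y = w x y - of_bool (y = a) - of_bool (y = b)" for y
    using ab by (auto simp: edge_def)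
  show w': "orientable V ?w T"
  proof (rule orientable_drop_vertex[OF fin x, of _ g])
    show "multiplicity_fun ?w" using multiplicity_fun_lift[OF w _ _ pos] ab by simp
    show "\<forall>y\<in>V - {x}. \<bar>g y\<bar> \<le> ?w x y \<and> even (g y - ?w x y)" using g unfolding wx .
    show "3 dvd (T x - sum g (V - {x}))" by fact
    show "orientable (V - {x}) ?w (\<lambda>y. T y + g y)"
      using sol by (subst orientable_cong[of _ _ "\<lambda>u v. w u v + edge a b u v"]) (auto simp: edge_def)
  qed
qed (use ab in auto)

section \<open>Admissible labellings: contraction and deletion\<close>

text \<open>The invariant of the proof by Lovasz, Thomassen, Wu and Zhang.  One extra vertex \<open>z\<close> outside
\<open>V\<close> is preoriented: it sends \<open>p v\<close> arcs to \<open>v\<close> and receives \<open>q v\<close> arcs from \<open>v\<close>.  The label \<open>t v\<close> is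
the net outflow required at \<open>v\<close> when these arcs are included, so the edges of the graph itself have
to realise \<open>t v + p v - q v\<close> modulo 3.  Since \<open>t v\<close> has the parity of the degree, it matters modulo
6.  Every set is left by at least four more edges than its label requires, while \<open>z\<close>, whose label is
minus the sum of all others, has at most four more.\<close>

definition admissible ::
    "'v set \<Rightarrow> ('v \<Rightarrow> 'v \<Rightarrow> int) \<Rightarrow> ('v \<Rightarrow> int) \<Rightarrow> ('v \<Rightarrow> int) \<Rightarrow> ('v \<Rightarrow> int) \<Rightarrow> bool" where
  "admissible V w t p q \<longleftrightarrow> finite V \<and> V \<noteq> {} \<and> multiplicity_fun w \<and>
    (\<forall>v\<in>V. 0 \<le> p v \<and> 0 \<le> q v) \<and>
    (\<forall>v\<in>V. even (t v - boundary V w (\<lambda>v. p v + q v) {v})) \<and>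
    3 dvd (\<Sum>v\<in>V. t v + p v - q v) \<and>
    (\<forall>A. A \<subseteq> V \<longrightarrow> A \<noteq> {} \<longrightarrow> A \<noteq> V \<longrightarrow> 4 + dist6 (sum t A) \<le> boundary V w (\<lambda>v. p v + q v) A) \<and>
    (\<Sum>v\<in>V. p v + q v) \<le> 4 + dist6 (sum t V)"

text \<open>Twice the number of edges; the preoriented arcs are counted once.  Deletion of an edge or of a
preoriented arc decreases this.\<close>

definition total :: "'v set \<Rightarrow> ('v \<Rightarrow> 'v \<Rightarrow> int) \<Rightarrow> ('v \<Rightarrow> int) \<Rightarrow> ('v \<Rightarrow> int) \<Rightarrow> int" where
  "total V w p q = cut w V V + (\<Sum>v\<in>V. p v + q v)"

text \<open>Boundaries and labels of sets of the contracted graph are those of the preimages, so all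
conditions on sets survive contraction.\<close>

lemma boundary_contract:
  fixes c t :: "'v \<Rightarrow> int"
  assumes fin: "finite V" and w: "multiplicity_fun w" and X: "X \<subseteq> V" "r \<in> X"
    and A: "A \<subseteq> insert r (V - X)"
  defines "E \<equiv> (if r \<in> A then A - {r} \<union> X else A)"
  shows "boundary (insert r (V - X)) (contract X r w) (\<lambda>v. if v = r then sum c X else c v) A = boundary V w c E"
    and "(\<Sum>v\<in>A. if v = r then sum t X else t v) = sum t E"
proof -
  let ?V = "insert r (V - X)" and ?w = "contract X r w"
  have finA: "finite A" "finite X" using fin A X finite_subset[of A "insert r V"] finite_subset[of X V] by auto
  have sumE: "(\<Sum>v\<in>A. if v = r then sum t X else t v) = sum t E" for t :: "'v \<Rightarrow> int"
  proof (cases "r \<in> A")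
    case True
    have "(\<Sum>v\<in>A. if v = r then sum t X else t v) = sum t X + (\<Sum>v\<in>A - {r}. if v = r then sum t X else t v)"
      using sum.remove[OF finA(1) True, of "\<lambda>v. if v = r then sum t X else t v"] by simp
    also have "(\<Sum>v\<in>A - {r}. if v = r then sum t X else t v) = sum t (A - {r})" by (rule sum.cong) auto
    also have "sum t X + sum t (A - {r}) = sum t (A - {r} \<union> X)"
    proof -
      have "(A - {r}) \<inter> X = {}" using A by auto
      then show ?thesis using sum.union_disjoint[of "A - {r}" X t] finA by (simp add: add.commute)
    qed
    finally show ?thesis using True by (simp add: E_def)
  next
    case False
    then show ?thesis unfolding E_def by (auto intro: sum.cong)
  qed
  show "(\<Sum>v\<in>A. if v = r then sum t X else t v) = sum t E" by (rule sumE)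
  have key: "cut ?w B (?V - B) = cut w B (V - B)" if B: "B \<subseteq> V - X" for B
  proof -
    have "sum (?w u) (?V - B) = sum (w u) (V - B)" if u: "u \<in> B" for u
    proof -
      have ur: "u \<noteq> r" using u B X by auto
      have "?V - B = insert r (V - X - B)" "V - B = X \<union> (V - X - B)" using B X by auto
      moreover have "sum (?w u) (V - X - B) = sum (w u) (V - X - B)"
        using ur X(2) by (intro sum.cong) (auto simp: contract_def)
      moreover have "?w u r = sum (w u) X" using ur by (simp add: contract_def)
      moreover have "r \<notin> V - X - B" using X by auto
      moreover have "sum (w u) (X \<union> (V - X - B)) = sum (w u) X + sum (w u) (V - X - B)"
        by (rule sum.union_disjoint) (use fin finA in auto)
      ultimately show ?thesis using fin by simp
    qed
    then show ?thesis unfolding cut_def by (rule sum.cong[OF refl])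
  qed
  have "cut ?w A (?V - A) = cut w E (V - E)"
  proof (cases "r \<in> A")
    case False
    then show ?thesis using key[of A] A unfolding E_def by auto
  next
    case True
    have B: "?V - A \<subseteq> V - X" using True by auto
    have 1: "?V - (?V - A) = A" "V - E = ?V - A" "V - (?V - A) = E"
      using True A X unfolding E_def by auto
    have "cut ?w A (?V - A) = cut ?w (?V - A) A"
      by (rule cut_sym[OF multiplicity_fun_contract[OF w]])
    also have "\<dots> = cut w (?V - A) E" using key[OF B] unfolding 1 .
    also have "\<dots> = cut w E (V - E)" unfolding 1(2) by (rule cut_sym[OF w])
    finally show ?thesis .
  qed
  then show "boundary ?V ?w (\<lambda>v. if v = r then sum c X else c v) A = boundary V w c E"
    unfolding boundary_def sumE by simp
qed

lemma boundary_restrict: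
  assumes "finite V" "X \<subseteq> V" "A \<subseteq> X"
  shows "boundary X w (\<lambda>x. c x + sum (w x) (V - X)) A = boundary V w c A"
proof -
  have "cut w A (V - A) = cut w A (X - A) + cut w A (V - X)"
  proof -
    have "V - A = (X - A) \<union> (V - X)" using assms by auto
    then show ?thesis using cut_Un_right[of "X - A" "V - X" w A] assms finite_subset by fastforce
  qed
  then show ?thesis unfolding boundary_def by (simp add: cut_def sum.distrib)
qed

locale admissible_step =
  fixes V :: "'v set" and w :: "'v \<Rightarrow> 'v \<Rightarrow> int" and t p q :: "'v \<Rightarrow> int"
  assumes adm: "admissible V w t p q"
    and IH: "\<And>(V' :: 'v set) w' t' p' q'. admissible V' w' t' p' q' \<Longrightarrow>
      card V' < card V \<or> card V' = card V \<and> total V' w' p' q' < total V w p q \<Longrightarrow>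
      orientable V' w' (\<lambda>v. t' v + p' v - q' v)"
begin

abbreviation "c \<equiv> \<lambda>v. p v + q v"
abbreviation "D \<equiv> boundary V w c"
abbreviation "goal \<equiv> orientable V w (\<lambda>v. t v + p v - q v)"

lemma basic: "finite V" "V \<noteq> {}" "multiplicity_fun w"
  and pq: "v \<in> V \<Longrightarrow> 0 \<le> p v" "v \<in> V \<Longrightarrow> 0 \<le> q v"
  and par: "v \<in> V \<Longrightarrow> even (t v - D {v})"
  and T3: "3 dvd (\<Sum>v\<in>V. t v + p v - q v)"
  and low: "A \<subseteq> V \<Longrightarrow> A \<noteq> {} \<Longrightarrow> A \<noteq> V \<Longrightarrow> 4 + dist6 (sum t A) \<le> D A"
  and up: "sum c V \<le> 4 + dist6 (sum t V)"
  using adm unfolding admissible_def by blast+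

lemmas fin = basic(1) and ne = basic(2) and mult = basic(3)

lemma D_parity: "A \<subseteq> V \<Longrightarrow> even (D A - sum t A)"
proof (rule boundary_parity[OF fin mult])
  show "\<forall>v\<in>V. even (t v - (sum (w v) V + c v))"
    using par boundary_singleton[OF fin mult] by simp
qed

lemma D_V: "D V = sum c V" unfolding boundary_def by simp

text \<open>A set \<open>X\<close> whose boundary is no larger than that permitted for the preoriented vertex can be
contracted.  Afterwards the rest of the graph is contracted to a new preoriented vertex: the arcs
leaving \<open>X\<close> are already oriented and are counted by \<open>p2\<close> and \<open>q2\<close>.\<close>

lemma contract_step:
  assumes X: "X \<subseteq> V" "2 \<le> card X" "X \<noteq> V" and small: "D X \<le> 4 + dist6 (sum t X)"
  shows goal
proof -
  obtain r where r: "r \<in> X" using X(2) by (metis card.empty ex_in_conv not_numeral_le_zero)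
  have finX: "finite X" using X fin finite_subset by blast
  have cardX: "card X < card V" using X fin psubset_card_mono by (metis psubsetI)
  let ?V = "insert r (V - X)" and ?w = "contract X r w"
  let ?l = "\<lambda>h v. if v = r then sum h X else h v"
  have cV: "card ?V < card V"
  proof -
    have "card ?V = Suc (card V - card X)" using fin finX X r by (simp add: card_Diff_subset)
    then show ?thesis using X cardX by linarith
  qed
  have cpq: "(\<lambda>v. ?l p v + ?l q v) = ?l c" by (auto simp: sum.distrib)
  have E: "boundary ?V ?w (\<lambda>v. ?l p v + ?l q v) A = D (if r \<in> A then A - {r} \<union> X else A)"
    "sum (?l t) A = sum t (if r \<in> A then A - {r} \<union> X else A)" if "A \<subseteq> ?V" for A
    unfolding cpq using boundary_contract[OF fin mult X(1) r that] by blast+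
  have VV: "(if r \<in> ?V then ?V - {r} \<union> X else ?V) = V" using X r by auto
  have outer: "orientable ?V ?w (\<lambda>v. ?l t v + ?l p v - ?l q v)"
  proof (rule IH)
    show "admissible ?V ?w (?l t) (?l p) (?l q)"
      unfolding admissible_def
    proof (intro conjI ballI allI impI)
      fix v assume v: "v \<in> ?V"
      show "0 \<le> ?l p v" "0 \<le> ?l q v" using v X pq by (auto intro!: sum_nonneg)
      have "even (sum t F - D F)" if "F \<subseteq> V" for F using D_parity[OF that] by simp
      from this[of "if r \<in> {v} then {v} - {r} \<union> X else {v}"]
      show "even (?l t v - boundary ?V ?w (\<lambda>v. ?l p v + ?l q v) {v})"
        using E[of "{v}"] v X by (auto split: if_splits)
    next
      have "(\<Sum>v\<in>?V. ?l t v + ?l p v - ?l q v) = (\<Sum>v\<in>?V. ?l (\<lambda>v. t v + p v - q v) v)"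
        by (intro sum.cong) (auto simp: sum.distrib sum_subtractf)
      then show "3 dvd (\<Sum>v\<in>?V. ?l t v + ?l p v - ?l q v)"
        using boundary_contract(2)[OF fin mult X(1) r, of ?V "\<lambda>v. t v + p v - q v"] T3 unfolding VV by simp
    next
      fix A assume A: "A \<subseteq> ?V" "A \<noteq> {}" "A \<noteq> ?V"
      show "4 + dist6 (sum (?l t) A) \<le> boundary ?V ?w (\<lambda>v. ?l p v + ?l q v) A"
        unfolding E[OF A(1)] using A X r by (intro low) (auto split: if_splits)
    next
      have "sum (\<lambda>v. ?l p v + ?l q v) ?V = sum c V"
        unfolding cpq using boundary_contract(2)[OF fin mult X(1) r, of ?V c] unfolding VV by simp
      then show "(\<Sum>v\<in>?V. ?l p v + ?l q v) \<le> 4 + dist6 (sum (?l t) ?V)"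
        unfolding E(2)[OF order.refl] VV using up by simp
    qed (use fin mult in \<open>auto intro: multiplicity_fun_contract\<close>)
  qed (use cV in simp)
  show goal
  proof (rule orientable_contract[OF fin mult X(1) r])
    have "(\<lambda>v. ?l t v + ?l p v - ?l q v) = (\<lambda>v. if v = r then \<Sum>v\<in>X. t v + p v - q v else t v + p v - q v)"
      by (auto simp: sum.distrib sum_subtractf)
    then show "orientable ?V ?w (\<lambda>v. if v = r then \<Sum>v\<in>X. t v + p v - q v else t v + p v - q v)"
      using outer by simp
  next
    fix g assume g: "\<forall>x\<in>X. \<forall>v\<in>V - X. \<bar>g x v\<bar> \<le> w x v \<and> even (g x v - w x v)"
      and g3: "3 dvd (\<Sum>x\<in>X. t x + p x - q x - (\<Sum>v\<in>V - X. g x v))"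
    \<comment> \<open>In-arcs and out-arcs of \<open>x\<close> from outside \<open>X\<close>, recovered from their sum \<open>w x v\<close> and
    difference \<open>g x v\<close>.\<close>
    define p2 where "p2 x = p x + (\<Sum>v\<in>V - X. (w x v - g x v) div 2)" for x
    define q2 where "q2 x = q x + (\<Sum>v\<in>V - X. (w x v + g x v) div 2)" for x
    have half: "(w x v - g x v) div 2 + (w x v + g x v) div 2 = w x v"
      "(w x v - g x v) div 2 - (w x v + g x v) div 2 = - g x v"
      "0 \<le> (w x v - g x v) div 2" "0 \<le> (w x v + g x v) div 2" if "x \<in> X" "v \<in> V - X" for x v
    proof -
      have "\<bar>g x v\<bar> \<le> w x v" "even (g x v - w x v)" using g that by blast+
      then show "(w x v - g x v) div 2 + (w x v + g x v) div 2 = w x v"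
        "(w x v - g x v) div 2 - (w x v + g x v) div 2 = - g x v"
        "0 \<le> (w x v - g x v) div 2" "0 \<le> (w x v + g x v) div 2" by presburger+
    qed
    have c2: "p2 x + q2 x = c x + sum (w x) (V - X)" "p2 x - q2 x = p x - q x - sum (g x) (V - X)" if "x \<in> X" for x
    proof -
      have "(\<Sum>v\<in>V - X. (w x v - g x v) div 2) + (\<Sum>v\<in>V - X. (w x v + g x v) div 2) = sum (w x) (V - X)"
        unfolding sum.distrib[symmetric] by (intro sum.cong refl half that)
      then show "p2 x + q2 x = c x + sum (w x) (V - X)" unfolding p2_def q2_def by simp
      have "(\<Sum>v\<in>V - X. (w x v - g x v) div 2) - (\<Sum>v\<in>V - X. (w x v + g x v) div 2) = - sum (g x) (V - X)"
        unfolding sum_subtractf[symmetric] sum_negf[symmetric] by (intro sum.cong refl half that)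
      then show "p2 x - q2 x = p x - q x - sum (g x) (V - X)" unfolding p2_def q2_def by simp
    qed
    have D2: "boundary X w (\<lambda>v. p2 v + q2 v) A = D A" if "A \<subseteq> X" for A
    proof -
      have "boundary X w (\<lambda>v. p2 v + q2 v) A = boundary X w (\<lambda>x. c x + sum (w x) (V - X)) A"
        unfolding boundary_def using that c2(1) by (auto intro!: sum.cong simp: subset_iff)
      then show ?thesis using boundary_restrict[OF fin X(1) that] by simp
    qed
    have Teq: "t x + p x - q x - sum (g x) (V - X) = t x + p2 x - q2 x" if "x \<in> X" for x
      using c2(2)[OF that] by simp
    have "orientable X w (\<lambda>v. t v + p2 v - q2 v)"
    proof (rule IH)
      show "admissible X w t p2 q2"
        unfolding admissible_def
      proof (intro conjI ballI allI impI)
        fix v assume v: "v \<in> X"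
        show "0 \<le> p2 v" "0 \<le> q2 v"
          unfolding p2_def q2_def using v X pq half by (auto intro!: add_nonneg_nonneg sum_nonneg)
        show "even (t v - boundary X w (\<lambda>v. p2 v + q2 v) {v})" using D2[of "{v}"] v X par by auto
      next
        show "3 dvd (\<Sum>v\<in>X. t v + p2 v - q2 v)" using g3 Teq by (simp cong: sum.cong)
      next
        fix A assume "A \<subseteq> X" "A \<noteq> {}" "A \<noteq> X"
        then show "4 + dist6 (sum t A) \<le> boundary X w (\<lambda>v. p2 v + q2 v) A"
          using D2 low X by (metis dual_order.trans subset_antisym)
      next
        have "(\<Sum>v\<in>X. p2 v + q2 v) = boundary X w (\<lambda>v. p2 v + q2 v) X" unfolding boundary_def by simp
        then show "(\<Sum>v\<in>X. p2 v + q2 v) \<le> 4 + dist6 (sum t X)" using D2 small by simp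
      qed (use finX r mult in auto)
    qed (use cardX in simp)
    then show "orientable X w (\<lambda>x. t x + p x - q x - (\<Sum>v\<in>V - X. g x v))"
      using orientable_cong[of X w w "\<lambda>v. t v + p2 v - q2 v" "\<lambda>x. t x + p x - q x - (\<Sum>v\<in>V - X. g x v)"] Teq
      by simp
  qed
qed

text \<open>Orient one edge from \<open>x\<close> to \<open>y\<close> and delete it.  Only the singletons \<open>{x}\<close> and \<open>{y}\<close> can be
violated: for larger sets the boundary drops by at most 1 and the distance grows by at most 1, which
the slack of 2 absorbs.\<close>

lemma delete_edge_step:
  assumes xy: "x \<in> V" "y \<in> V" "x \<noteq> y" "1 \<le> w x y"
    and okx: "5 + dist6 (t x - 1) \<le> D {x}" and oky: "5 + dist6 (t y + 1) \<le> D {y}"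
    and slack: "\<And>A. A \<subseteq> V \<Longrightarrow> 2 \<le> card A \<Longrightarrow> A \<noteq> V \<Longrightarrow> 6 + dist6 (sum t A) \<le> D A"
  shows goal
proof -
  let ?w = "\<lambda>u v. w u v - edge x y u v"
  define t' where "t' v = t v - of_bool (v = x) + of_bool (v = y)" for v
  have m': "multiplicity_fun ?w" using multiplicity_fun_remove_edge[OF mult] xy by blast
  have st': "sum t' A = sum t A - of_bool (x \<in> A) + of_bool (y \<in> A)" if "A \<subseteq> V" for A
    unfolding t'_def using finite_subset[OF that fin] by (simp add: sum.distrib sum_subtractf)
  have D': "boundary V ?w c A = D A - of_bool ((x \<in> A) \<noteq> (y \<in> A))" if "A \<subseteq> V" for A
  proof -
    have "cut w A (V - A) = cut ?w A (V - A) + cut (edge x y) A (V - A)"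
      using cut_add[of ?w "edge x y" A "V - A"] by simp
    then show ?thesis unfolding boundary_def
      using cut_edge[of A "V - A" x y] that finite_subset[OF that fin] fin xy by auto
  qed
  have "orientable V ?w (\<lambda>v. t' v + p v - q v)"
  proof (rule IH)
    show "admissible V ?w t' p q" unfolding admissible_def
    proof (intro conjI ballI allI impI)
      fix v assume v: "v \<in> V"
      show "0 \<le> p v" "0 \<le> q v" using v pq by auto
      show "even (t' v - boundary V ?w c {v})"
        using D'[of "{v}"] v par[OF v] xy(3) unfolding t'_def by auto
    next
      have "(\<Sum>v\<in>V. t' v + p v - q v) = sum t' V + sum p V - sum q V" by (simp add: sum.distrib sum_subtractf)
      also have "\<dots> = (\<Sum>v\<in>V. t v + p v - q v)" using st'[of V] xy by (simp add: sum.distrib sum_subtractf)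
      finally show "3 dvd (\<Sum>v\<in>V. t' v + p v - q v)" using T3 by simp
    next
      fix A assume A: "A \<subseteq> V" "A \<noteq> {}" "A \<noteq> V"
      have finA: "finite A" using A fin finite_subset by blast
      show "4 + dist6 (sum t' A) \<le> boundary V ?w c A"
      proof (cases "2 \<le> card A")
        case True
        then have s: "6 + dist6 (sum t A) \<le> D A" using slack A by blast
        show ?thesis unfolding D'[OF A(1)] st'[OF A(1)]
          using s dist6_step[of "sum t A"] by (auto simp: of_bool_def)
      next
        case False
        then have "card A = 1" using A finA card_gt_0_iff[of A] by linarith
        then obtain v where v: "A = {v}" using card_1_singletonE by blast
        show ?thesis unfolding D'[OF A(1)] st'[OF A(1)] unfolding v
          using okx oky low[OF A] xy A v by (auto simp: of_bool_def)
      qed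
    next
      show "sum c V \<le> 4 + dist6 (sum t' V)" using st'[of V] xy up by simp
    qed (use fin ne m' in auto)
    have "cut w V V = cut ?w V V + cut (edge x y) V V"
      using cut_add[of ?w "edge x y" V V] by simp
    moreover have "0 < cut (edge x y) V V"
      unfolding cut_def using xy fin edge_nonneg
      by (intro sum_pos2[of _ x] sum_pos2[of _ y] sum_nonneg) (auto simp: edge_def)
    ultimately have "total V ?w p q < total V w p q" unfolding total_def by simp
    then show "card V < card V \<or> card V = card V \<and> total V ?w p q < total V w p q" by simp
  qed
  then have "orientable V ?w ((\<lambda>v. t v + p v - q v)(x := t x + p x - q x - 1, y := t y + p y - q y + 1))"
    by (rule orientable_cong[THEN iffD1, rotated 2]) (use xy in \<open>auto simp: t'_def\<close>)
  then show goal using orientable_delete[OF fin xy(1-3), of w "\<lambda>v. t v + p v - q v"] by simp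
qed

text \<open>The same for an arc from the preoriented vertex to \<open>x\<close>.\<close>

lemma delete_in_arc_step:
  assumes x: "x \<in> V" "1 \<le> p x" and okx: "5 + dist6 (t x + 1) \<le> D {x}"
    and slack: "\<And>A. A \<subseteq> V \<Longrightarrow> 2 \<le> card A \<Longrightarrow> A \<noteq> V \<Longrightarrow> 6 + dist6 (sum t A) \<le> D A"
  shows goal
proof -
  define t' where "t' v = t v + of_bool (v = x)" for v
  define p' where "p' v = p v - of_bool (v = x)" for v
  have st': "sum t' A = sum t A + of_bool (x \<in> A)" "sum p' A = sum p A - of_bool (x \<in> A)" if "A \<subseteq> V" for A
    unfolding t'_def p'_def using finite_subset[OF that fin] by (simp_all add: sum.distrib sum_subtractf)
  have D': "boundary V w (\<lambda>v. p' v + q v) A = D A - of_bool (x \<in> A)" if "A \<subseteq> V" for A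
    unfolding boundary_def using st'(2)[OF that] by (simp add: sum.distrib)
  have "orientable V w (\<lambda>v. t' v + p' v - q v)"
  proof (rule IH)
    show "admissible V w t' p' q" unfolding admissible_def
    proof (intro conjI ballI allI impI)
      fix v assume v: "v \<in> V"
      show "0 \<le> p' v" "0 \<le> q v" using v pq[OF v] x by (auto simp: p'_def)
      show "even (t' v - boundary V w (\<lambda>v. p' v + q v) {v})"
        using D'[of "{v}"] v par[OF v] unfolding t'_def by auto
    next
      have "(\<Sum>v\<in>V. t' v + p' v - q v) = (\<Sum>v\<in>V. t v + p v - q v)"
        unfolding t'_def p'_def by (intro sum.cong) auto
      then show "3 dvd (\<Sum>v\<in>V. t' v + p' v - q v)" using T3 by simp
    next
      fix A assume A: "A \<subseteq> V" "A \<noteq> {}" "A \<noteq> V"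
      have finA: "finite A" using A fin finite_subset by blast
      show "4 + dist6 (sum t' A) \<le> boundary V w (\<lambda>v. p' v + q v) A"
      proof (cases "2 \<le> card A")
        case True
        then have s: "6 + dist6 (sum t A) \<le> D A" using slack A by blast
        show ?thesis unfolding D'[OF A(1)] st'(1)[OF A(1)]
          using s dist6_step[of "sum t A"] by (auto simp: of_bool_def)
      next
        case False
        then have "card A = 1" using A finA card_gt_0_iff[of A] by linarith
        then obtain v where v: "A = {v}" using card_1_singletonE by blast
        show ?thesis unfolding D'[OF A(1)] st'(1)[OF A(1)] unfolding v
          using okx low[OF A] x A v by (auto simp: of_bool_def)
      qed
    next
      have "(\<Sum>v\<in>V. p' v + q v) = sum c V - 1" using st'(2)[of V] x by (simp add: sum.distrib)
      then show "(\<Sum>v\<in>V. p' v + q v) \<le> 4 + dist6 (sum t' V)"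
        using st'(1)[of V] x up dist6_step[of "sum t V"] by simp
    qed (use fin ne mult in auto)
    show "card V < card V \<or> card V = card V \<and> total V w p' q < total V w p q"
      unfolding total_def using st'(2)[of V] x by (simp add: sum.distrib)
  qed
  then show goal
    by (rule orientable_cong[THEN iffD1, rotated 2]) (auto simp: t'_def p'_def)
qed

end

lemma orientable_uminus: "orientable V w T \<Longrightarrow> orientable V w (\<lambda>v. - T v)"
proof -
  assume "orientable V w T"
  then obtain f where f: "net_orientation V w f" "\<forall>v\<in>V. 3 dvd (T v - sum (f v) V)"
    unfolding orientable_def by blast
  have "net_orientation V w (\<lambda>u v. - f u v)"
    unfolding net_orientation_def
  proof (intro ballI)
    fix u v assume "u \<in> V" "v \<in> V"
    then have "f u v = - f v u \<and> \<bar>f u v\<bar> \<le> w u v \<and> even (f u v - w u v)"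
      using f(1) unfolding net_orientation_def by blast
    then show "- f u v = - (- f v u) \<and> \<bar>- f u v\<bar> \<le> w u v \<and> even (- f u v - w u v)" by auto
  qed
  moreover have "3 dvd (- T v - sum (\<lambda>u. - f v u) V)" if "v \<in> V" for v
  proof -
    have "- T v - sum (\<lambda>u. - f v u) V = - (T v - sum (f v) V)" by (simp add: sum_negf)
    then show ?thesis using f(2) that by (metis dvd_minus_iff)
  qed
  ultimately show ?thesis unfolding orientable_def by blast
qed

text \<open>Reversing all arcs exchanges \<open>p\<close> and \<open>q\<close>.\<close>

lemma admissible_uminus:
  assumes "admissible V w t p q"
  shows "admissible V w (\<lambda>v. - t v) q p"
proof -
  have s: "sum (\<lambda>v. - t v) A = - sum t A" for A by (rule sum_negf)
  have "(\<Sum>v\<in>V. - t v + q v - p v) = - (\<Sum>v\<in>V. t v + p v - q v)"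
    by (simp add: sum_negf[symmetric] algebra_simps)
  moreover have "even (- t v - b) = even (t v - b)" for v b by auto
  ultimately show ?thesis
    using assms unfolding admissible_def s dist6_uminus by (simp add: add.commute)
qed

lemma (in admissible_step) admissible_step_uminus: "admissible_step V w (\<lambda>v. - t v) q p"
proof
  show "admissible V w (\<lambda>v. - t v) q p" by (rule admissible_uminus[OF adm])
next
  fix V' :: "'v set" and w' t' p' q'
  assume "admissible V' w' t' p' q'" "card V' < card V \<or> card V' = card V \<and> total V' w' p' q' < total V w q p"
  then show "orientable V' w' (\<lambda>v. t' v + p' v - q' v)"
    by (intro IH) (auto simp: total_def add.commute)
qed

section \<open>Removing a vertex\<close>

lemma int_count_list: "int (count_list ys y) = (\<Sum>z\<leftarrow>ys. of_bool (y = z))"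
  by (induction ys) auto

context admissible_step
begin

lemma neighbour_list:
  fixes m :: "'v \<Rightarrow> int"
  assumes "\<forall>y\<in>V. 0 \<le> m y" "sum m V = int k"
  obtains ys where "length ys = k" "\<And>y. y \<in> V \<Longrightarrow> m y = (\<Sum>z\<leftarrow>ys. of_bool (y = z))"
    "\<And>A. A \<subseteq> V \<Longrightarrow> sum m A = (\<Sum>z\<leftarrow>ys. of_bool (z \<in> A))" "\<And>z. z \<in> set ys \<Longrightarrow> z \<in> V \<and> 1 \<le> m z"
proof -
  obtain ys where ys: "length ys = k" "set ys \<subseteq> V" "\<forall>y\<in>V. m y = int (count_list ys y)"
    using edge_list[OF fin assms] by blast
  show thesis
  proof (rule that[of ys])
    show "m y = (\<Sum>z\<leftarrow>ys. of_bool (y = z))" if "y \<in> V" for y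
      using ys(3) that int_count_list[of ys y] by simp
    show "sum m A = (\<Sum>z\<leftarrow>ys. of_bool (z \<in> A))" if A: "A \<subseteq> V" for A
    proof -
      have "sum m A = (\<Sum>y\<in>A. int (count_list ys y))" using ys(3) A by (intro sum.cong) auto
      then show ?thesis using sum_count_list[of A ys] finite_subset[OF A fin] by simp
    qed
    show "z \<in> V \<and> 1 \<le> m z" if "z \<in> set ys" for z
    proof -
      have "z \<in> V" using ys(2) that by blast
      moreover have "count_list ys z \<noteq> 0" using that by (simp add: count_list_0_iff)
      ultimately show ?thesis using ys(3) by simp
    qed
  qed fact
qed

lemma w_nonneg: "0 \<le> w u v" using mult by (rule multiplicity_fun_nonneg)
lemma w_sym: "w u v = w v u" using mult by (rule multiplicity_fun_sym)
lemma w_diag: "w v v = 0" using mult by (rule multiplicity_fun_diag)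

lemma sum_wx: "x \<in> V \<Longrightarrow> sum (w x) (V - {x}) = sum (w x) V"
  using sum.remove[OF fin, of x "w x"] by (simp add: w_diag)

lemma D_singleton: "x \<in> V \<Longrightarrow> D {x} = sum (w x) V + c x"
  by (rule boundary_singleton[OF fin mult])

lemma D_insert: "A \<subseteq> V \<Longrightarrow> x \<in> V \<Longrightarrow> x \<notin> A \<Longrightarrow> D (insert x A) = D A + D {x} - 2 * sum (w x) A"
  by (rule boundary_insert[OF fin mult])

lemma cut_remove:
  assumes "x \<in> V" "A \<subseteq> V - {x}"
  shows "cut w A (V - {x} - A) = cut w A (V - A) - sum (w x) A"
proof -
  have "V - A = {x} \<union> (V - {x} - A)" using assms by auto
  then have "cut w A (V - A) = cut w A {x} + cut w A (V - {x} - A)"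
    using cut_Un_right[of "{x}" "V - {x} - A" w A] fin by simp
  moreover have "cut w A {x} = sum (w x) A" unfolding cut_singleton_right using w_sym by (intro sum.cong) auto
  ultimately show ?thesis by simp
qed

text \<open>The frame for all removals of a vertex \<open>x\<close>: its edges are oriented by \<open>g\<close> or lifted, \<open>l\<close>
measures the contribution of the edges created by lifting, and \<open>t'\<close>, \<open>p'\<close>, \<open>q'\<close> are the new data on
the remaining vertices.\<close>

lemma remove_step:
  assumes x: "x \<in> V" and cardV: "2 \<le> card V"
    and w': "multiplicity_fun w'"
    and cutw': "\<And>A. A \<subseteq> V - {x} \<Longrightarrow> cut w' A (V - {x} - A) = cut w A (V - A) - sum (w x) A + l A"
    and sound: "orientable (V - {x}) w' (\<lambda>y. t y + p y - q y + g y) \<Longrightarrow> goal"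
    and Tx: "3 dvd (t x + p x - q x - sum g (V - {x}))"
    and new: "\<And>y. y \<in> V - {x} \<Longrightarrow> 0 \<le> p' y \<and> 0 \<le> q' y \<and> t' y + p' y - q' y = t y + p y - q y + g y"
    and ev: "\<And>y. y \<in> V - {x} \<Longrightarrow> even (t' y - (D {y} - w x y + l {y} + (p' y + q' y) - c y))"
    and lo: "\<And>A. A \<subseteq> V - {x} \<Longrightarrow> A \<noteq> {} \<Longrightarrow> A \<noteq> V - {x} \<Longrightarrow>
      4 + dist6 (sum t' A) \<le> D A - sum (w x) A + l A + (\<Sum>y\<in>A. p' y + q' y) - sum c A"
    and up': "(\<Sum>y\<in>V - {x}. p' y + q' y) \<le> 4 + dist6 (sum t' (V - {x}))"
  shows goal
proof -
  have bd': "boundary (V - {x}) w' (\<lambda>y. p' y + q' y) A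
      = D A - sum (w x) A + l A + (\<Sum>y\<in>A. p' y + q' y) - sum c A" if "A \<subseteq> V - {x}" for A
    unfolding boundary_def cutw'[OF that] by simp
  have cx: "card (V - {x}) = card V - 1" using x fin by simp
  then have "0 < card (V - {x})" using cardV by linarith
  then have ne': "V - {x} \<noteq> {}" by (metis card.empty less_irrefl)
  have "orientable (V - {x}) w' (\<lambda>y. t' y + p' y - q' y)"
  proof (rule IH)
    show "admissible (V - {x}) w' t' p' q'" unfolding admissible_def
    proof (intro conjI ballI allI impI)
      fix v assume v: "v \<in> V - {x}"
      show "0 \<le> p' v" "0 \<le> q' v" using new[OF v] by auto
      show "even (t' v - boundary (V - {x}) w' (\<lambda>y. p' y + q' y) {v})"
        using ev[OF v] bd'[of "{v}"] v by simp
    next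
      define T where "T v = t v + p v - q v" for v
      have "(\<Sum>v\<in>V - {x}. t' v + p' v - q' v) = (\<Sum>v\<in>V - {x}. T v + g v)"
        unfolding T_def by (rule sum.cong[OF refl]) (rule new[THEN conjunct2, THEN conjunct2])
      also have "\<dots> = sum T (V - {x}) + sum g (V - {x})" by (rule sum.distrib)
      also have "sum T (V - {x}) = sum T V - T x" using sum.remove[OF fin x, of T] by simp
      finally have "(\<Sum>v\<in>V - {x}. t' v + p' v - q' v) = sum T V - (T x - sum g (V - {x}))" by simp
      moreover have "3 dvd sum T V" "3 dvd (T x - sum g (V - {x}))" using T3 Tx unfolding T_def .
      ultimately show "3 dvd (\<Sum>v\<in>V - {x}. t' v + p' v - q' v)" by (simp only: dvd_diff)
    next
      fix A assume "A \<subseteq> V - {x}" "A \<noteq> {}" "A \<noteq> V - {x}"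
      then show "4 + dist6 (sum t' A) \<le> boundary (V - {x}) w' (\<lambda>y. p' y + q' y) A"
        using lo bd' by simp
    qed (use fin ne' w' up' in auto)
    show "card (V - {x}) < card V \<or> card (V - {x}) = card V \<and> total (V - {x}) w' p' q' < total V w p q"
      using cx cardV by linarith
  qed
  then have "orientable (V - {x}) w' (\<lambda>y. t y + p y - q y + g y)"
    by (rule orientable_cong[THEN iffD1, rotated 2]) (rule refl, rule new[THEN conjunct2, THEN conjunct2])
  then show goal by (rule sound)
qed

text \<open>All edges at \<open>x\<close> are oriented towards \<open>x\<close>, and \<open>x\<close> is merged with the preoriented vertex.  Of
the resulting arcs out of \<open>y\<close>, \<open>del y\<close> are not kept as preoriented arcs but deleted and charged to
the label of \<open>y\<close>, which keeps the degree of the preoriented vertex within its bound.\<close>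

lemma sink_step:
  assumes x: "x \<in> V" and cardV: "2 \<le> card V"
    and del: "\<And>y. y \<in> V - {x} \<Longrightarrow> 0 \<le> del y \<and> del y \<le> w x y"
    and Tx: "3 dvd (t x + p x - q x + sum (w x) V)"
    and lo: "\<And>A. A \<subseteq> V - {x} \<Longrightarrow> A \<noteq> {} \<Longrightarrow> A \<noteq> V - {x} \<Longrightarrow>
      4 + dist6 (sum t A - sum del A) \<le> D A - sum del A"
    and up': "sum c V - c x + sum (w x) V - sum del (V - {x}) \<le> 4 + dist6 (sum t V - t x - sum del (V - {x}))"
  shows goal
proof (rule remove_step[OF x cardV mult, of "\<lambda>_. 0" "\<lambda>y. - w x y" p "\<lambda>y. q y + w x y - del y" "\<lambda>y. t y - del y"])
  fix A assume A: "A \<subseteq> V - {x}"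
  show "cut w A (V - {x} - A) = cut w A (V - A) - sum (w x) A + 0" using cut_remove[OF x A] by simp
  assume "A \<noteq> {}" "A \<noteq> V - {x}"
  then show "4 + dist6 (sum (\<lambda>y. t y - del y) A)
      \<le> D A - sum (w x) A + 0 + (\<Sum>y\<in>A. p y + (q y + w x y - del y)) - sum c A"
    using lo[OF A] by (simp add: sum.distrib sum_subtractf)
next
  assume "orientable (V - {x}) w (\<lambda>y. t y + p y - q y + - w x y)"
  then show goal
    using orientable_drop_vertex[OF fin x mult, of "\<lambda>y. - w x y" "\<lambda>v. t v + p v - q v"] Tx
    by (simp add: w_nonneg sum_wx[OF x] sum_negf)
next
  have "sum c (V - {x}) = sum c V - c x" "sum t (V - {x}) = sum t V - t x"
    using sum.remove[OF fin x, of c] sum.remove[OF fin x, of t] by auto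
  then show "(\<Sum>y\<in>V - {x}. p y + (q y + w x y - del y)) \<le> 4 + dist6 (sum (\<lambda>y. t y - del y) (V - {x}))"
    using up' by (simp add: sum.distrib sum_subtractf sum_wx[OF x])
qed (use del pq par Tx in \<open>force simp: sum_wx[OF x] sum_negf\<close>)+

text \<open>As before, after the pair \<open>xa\<close>, \<open>xb\<close> has been lifted.\<close>

lemma sink_lift_step:
  assumes x: "x \<in> V" and cardV: "2 \<le> card V" and ab: "a \<in> V - {x}" "b \<in> V - {x}"
    and del: "\<And>y. y \<in> V - {x} \<Longrightarrow> 0 \<le> del y \<and> of_bool (y = a) + of_bool (y = b) + del y \<le> w x y"
    and Tx: "3 dvd (t x + p x - q x + sum (w x) V - 2)"
    and lo: "\<And>A. A \<subseteq> V - {x} \<Longrightarrow> A \<noteq> {} \<Longrightarrow> A \<noteq> V - {x} \<Longrightarrow>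
      4 + dist6 (sum t A - sum del A) \<le> D A - sum del A - 2 * of_bool (a \<in> A \<and> b \<in> A)"
    and up': "sum c V - c x + sum (w x) V - 2 - sum del (V - {x}) \<le> 4 + dist6 (sum t V - t x - sum del (V - {x}))"
  shows goal
proof -
  define s :: "'v \<Rightarrow> int" where "s y = of_bool (y = a) + of_bool (y = b)" for y
  have ss: "sum s A = of_bool (a \<in> A) + of_bool (b \<in> A)" if "A \<subseteq> V - {x}" for A
    unfolding s_def using finite_subset[OF that] fin by (simp add: sum.distrib)
  have sV: "sum s (V - {x}) = 2" using ss[of "V - {x}"] ab by simp
  show goal
  proof (rule remove_step[OF x cardV multiplicity_fun_add_edge[OF mult, of a b],
        of "\<lambda>A. of_bool ((a \<in> A) \<noteq> (b \<in> A))" "\<lambda>y. - (w x y - s y)" p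
          "\<lambda>y. q y + (w x y - s y) - del y" "\<lambda>y. t y - del y"])
    fix A assume A: "A \<subseteq> V - {x}"
    have finA: "finite A" using A fin finite_subset by blast
    have "cut (edge a b) A (V - {x} - A) = of_bool ((a \<in> A) \<noteq> (b \<in> A))"
      by (rule cut_edge) (use finA fin ab A in auto)
    then show "cut (\<lambda>u v. w u v + edge a b u v) A (V - {x} - A)
        = cut w A (V - A) - sum (w x) A + of_bool ((a \<in> A) \<noteq> (b \<in> A))"
      unfolding cut_add using cut_remove[OF x A] by simp
    assume "A \<noteq> {}" "A \<noteq> V - {x}"
    then show "4 + dist6 (sum (\<lambda>y. t y - del y) A) \<le> D A - sum (w x) A + of_bool ((a \<in> A) \<noteq> (b \<in> A))
        + (\<Sum>y\<in>A. p y + (q y + (w x y - s y) - del y)) - sum c A"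
      using lo[OF A] ss[OF A] by (simp add: sum.distrib sum_subtractf of_bool_def split: if_splits)
  next
    have g: "\<forall>y\<in>V - {x}. \<bar>- (w x y - s y)\<bar> \<le> w x y - of_bool (y = a) - of_bool (y = b)
        \<and> even (- (w x y - s y) - (w x y - of_bool (y = a) - of_bool (y = b)))"
      using del unfolding s_def by fastforce
    assume "orientable (V - {x}) (\<lambda>u v. w u v + edge a b u v) (\<lambda>y. t y + p y - q y + - (w x y - s y))"
    then show goal
      using orientable_remove_lift[OF fin mult x ab g, of "\<lambda>v. t v + p v - q v"] Tx
      by (simp add: sum_wx[OF x] sum_negf sum_subtractf sV algebra_simps)
  next
    have "sum c (V - {x}) = sum c V - c x" "sum t (V - {x}) = sum t V - t x"
      using sum.remove[OF fin x, of c] sum.remove[OF fin x, of t] by auto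
    then show "(\<Sum>y\<in>V - {x}. p y + (q y + (w x y - s y) - del y)) \<le> 4 + dist6 (sum (\<lambda>y. t y - del y) (V - {x}))"
      using up' by (simp add: sum.distrib sum_subtractf sum_wx[OF x] sV)
  next
    show "3 dvd (t x + p x - q x - (\<Sum>y\<in>V - {x}. - (w x y - s y)))"
      using Tx by (simp add: sum_wx[OF x] sum_negf sum_subtractf sV algebra_simps)
  next
    fix y assume y: "y \<in> V - {x}"
    show "0 \<le> p y \<and> 0 \<le> q y + (w x y - s y) - del y \<and>
        t y - del y + p y - (q y + (w x y - s y) - del y) = t y + p y - q y + - (w x y - s y)"
      using del[OF y] pq[of y] y unfolding s_def by auto
    have "t y - del y - (D {y} - w x y + of_bool ((a \<in> {y}) \<noteq> (b \<in> {y})) + (p y + (q y + (w x y - s y) - del y)) - c y)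
      = t y - D {y} + (s y - of_bool ((a \<in> {y}) \<noteq> (b \<in> {y})))" by simp
    moreover have "even (s y - of_bool ((a \<in> {y}) \<noteq> (b \<in> {y})))" unfolding s_def by auto
    ultimately show "even (t y - del y - (D {y} - w x y + of_bool ((a \<in> {y}) \<noteq> (b \<in> {y}))
        + (p y + (q y + (w x y - s y) - del y)) - c y))"
      using par[of y] y by simp
  qed
qed

end

section \<open>Irreducible labellings in which every label is 1 or 2\<close>

lemma dist6_cong: "a mod 6 = b mod 6 \<Longrightarrow> dist6 a = dist6 b"
  unfolding dist6_def by simp

lemma residue_cases: "(k::int) mod 6 \<in> {0, 1, 2, 3, 4, 5}"
proof -
  have "0 \<le> k mod 6" "k mod 6 < 6" by auto
  then show ?thesis by auto
qed

text \<open>The possible pairs of boundary size \<open>d\<close> and label \<open>s\<close> of a set of vertices, where all vertices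
are tight with label 1 or 2 and all larger sets have slack 2.\<close>

definition tight_or_slack :: "int \<Rightarrow> int \<Rightarrow> bool" where
  "tight_or_slack d s \<longleftrightarrow> d = 5 \<and> s mod 6 = 1 \<or> d = 6 \<and> s mod 6 = 2 \<or> 6 + dist6 s \<le> d"

text \<open>Here \<open>e\<close> and \<open>s\<close> are boundary and label of a set that becomes violated when two of the arcs
into the new sink are deleted, and \<open>k\<close> is the number of edges between the set and the sink.  Adding
the sink to the set gives the second inequality.\<close>

lemma sink_arith:
  assumes s: "6 + dist6 s \<le> e" "6 + dist6 (s + 1) \<le> e + 5 - 2 * k" "e - 2 < 4 + dist6 (s - 2)" "even (e - s)"
    and k: "2 \<le> k"
  shows "e = 6 \<and> s mod 6 = 0 \<and> k = 2 \<or> e = 7 \<and> s mod 6 = 5 \<and> (k = 2 \<or> k = 3)"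
proof -
  obtain r where r: "r = s mod 6" "r \<in> {0,1,2,3,4,5}" using residue_cases by blast
  have n: "dist6 s = dist6 r" "dist6 (s + 1) = dist6 (r + 1)" "dist6 (s - 2) = dist6 (r - 2)"
    unfolding r(1) by (rule dist6_cong; simp add: mod_simps)+
  have "even (e - r)" using s(4) unfolding r(1) by presburger
  then show ?thesis
    using s(1-3) k r(2) unfolding n r(1)[symmetric]
    by (elim insertE emptyE; simp add: dist6_def; presburger)
qed

text \<open>Uncrossing two violated sets whose union contains all four neighbours of the sink: \<open>(d1, a)\<close>
belongs to the intersection and \<open>(d2, u)\<close> to the union.\<close>

lemma sink_union4_arith:
  assumes d1: "tight_or_slack d1 a"
    and d2: "9 + dist6 (u + 1) \<le> d2 \<or> d2 = 7 \<and> u mod 6 = 1 \<or> d2 = 8 \<and> u mod 6 = 0"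
    and le: "d1 + d2 \<le> e1 + e2" and eq: "a + u = s1 + s2"
    and e: "e1 = 6 \<and> s1 mod 6 = 0 \<or> e1 = 7 \<and> s1 mod 6 = 5"
    "e2 = 6 \<and> s2 mod 6 = 0 \<or> e2 = 7 \<and> s2 mod 6 = 5"
  shows False
proof -
  obtain r where r: "r = a mod 6" "r \<in> {0,1,2,3,4,5}" using residue_cases by blast
  have na: "dist6 a = dist6 r" by (rule dist6_cong) (simp add: r)
  have u: "u = s1 + s2 - a" using eq by simp
  have nu: "dist6 (u + 1) = dist6 (s1 mod 6 + s2 mod 6 - r + 1)" unfolding u r(1) by (rule dist6_cong) (intro mod_add_cong mod_diff_cong; simp)
  have um: "u mod 6 = (s1 mod 6 + s2 mod 6 - r) mod 6" unfolding u r(1) by (intro mod_diff_cong mod_add_cong; simp)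
  have d1': "tight_or_slack d1 r" using d1 unfolding tight_or_slack_def na r(1) by simp
  obtain \<sigma>1 \<sigma>2 where s: "\<sigma>1 = s1 mod 6" "\<sigma>2 = s2 mod 6" by blast
  show False
    using e d1' d2 le r(2) unfolding tight_or_slack_def nu um s[symmetric]
    by (elim disjE[of "e1 = 6 \<and> _"] disjE[of "e2 = 6 \<and> _"] conjE insertE emptyE;
        hypsubst; simp add: dist6_def; linarith)
qed

text \<open>Uncrossing two violated sets whose union contains three of the four neighbours; \<open>d3\<close> and \<open>d4\<close>
belong to the two differences and enter through posimodularity.\<close>

lemma sink_union3_arith:
  assumes d1: "tight_or_slack d1 a" and d2: "7 + dist6 (u + 1) \<le> d2"
    and d3: "tight_or_slack d3 (s1 - a)" and d4: "tight_or_slack d4 (s2 - a)"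
    and le: "d1 + d2 \<le> e1 + e2" "d3 + d4 + 2 \<le> e1 + e2" and eq: "a + u = s1 + s2"
    and e: "e1 = 6 \<and> s1 mod 6 = 0 \<or> e1 = 7 \<and> s1 mod 6 = 5"
    "e2 = 6 \<and> s2 mod 6 = 0 \<or> e2 = 7 \<and> s2 mod 6 = 5"
  shows "d2 = 7 \<and> u mod 6 = 5"
proof -
  obtain r where r: "r = a mod 6" "r \<in> {0,1,2,3,4,5}" using residue_cases by blast
  have na: "dist6 a = dist6 r" by (rule dist6_cong) (simp add: r)
  have u: "u = s1 + s2 - a" using eq by simp
  have nu: "dist6 (u + 1) = dist6 (s1 mod 6 + s2 mod 6 - r + 1)" unfolding u r(1) by (rule dist6_cong) (intro mod_add_cong mod_diff_cong; simp)
  have um: "u mod 6 = (s1 mod 6 + s2 mod 6 - r) mod 6" unfolding u r(1) by (intro mod_diff_cong mod_add_cong; simp)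
  have m: "(s1 - a) mod 6 = (s1 mod 6 - r) mod 6" "(s2 - a) mod 6 = (s2 mod 6 - r) mod 6"
    unfolding r(1) by (simp_all add: mod_simps)
  have n: "dist6 (s1 - a) = dist6 (s1 mod 6 - r)" "dist6 (s2 - a) = dist6 (s2 mod 6 - r)"
    unfolding r(1) by (rule dist6_cong; simp add: mod_simps)+
  have d1': "tight_or_slack d1 r" using d1 unfolding tight_or_slack_def na r(1) by simp
  have d3': "tight_or_slack d3 (s1 mod 6 - r)" using d3 unfolding tight_or_slack_def m n .
  have d4': "tight_or_slack d4 (s2 mod 6 - r)" using d4 unfolding tight_or_slack_def m n .
  obtain \<sigma>1 \<sigma>2 where s: "\<sigma>1 = s1 mod 6" "\<sigma>2 = s2 mod 6" by blast
  show ?thesis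
    using e r(2) d1' d2 d3' d4' le unfolding tight_or_slack_def nu um s[symmetric]
    by (elim disjE[of "e1 = 6 \<and> _"] disjE[of "e2 = 6 \<and> _"] conjE insertE emptyE;
        hypsubst; simp add: dist6_def; linarith)
qed

text \<open>The analogue for one lifted pair inside the set and one deleted arc; the sink now has boundary
6 and label 2.\<close>

lemma lift_sink_arith:
  assumes s: "6 + dist6 s \<le> e" "6 + dist6 (s + 2) \<le> e + 6 - 2 * k" "e - 3 < 4 + dist6 (s - 1)" "even (e - s)"
    and k: "3 \<le> k"
  shows "e = 7 \<and> s mod 6 = 5 \<and> k = 3 \<or> e = 8 \<and> s mod 6 = 4 \<and> (k = 3 \<or> k = 4)"
proof -
  obtain r where r: "r = s mod 6" "r \<in> {0,1,2,3,4,5}" using residue_cases by blast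
  have n: "dist6 s = dist6 r" "dist6 (s + 2) = dist6 (r + 2)" "dist6 (s - 1) = dist6 (r - 1)"
    unfolding r(1) by (rule dist6_cong; simp add: mod_simps)+
  have "even (e - r)" using s(4) unfolding r(1) by presburger
  then show ?thesis
    using s(1-3) k r(2) unfolding n r(1)[symmetric]
    by (elim insertE emptyE; simp add: dist6_def; presburger)
qed

text \<open>For a lifted pair, uncrossing gives a contradiction except when the union of the two sets is
everything but the sink; \<open>sp\<close> stands for this exception.\<close>

lemma lift_sink_union5_arith:
  assumes d1: "6 + dist6 a \<le> d1"
    and d2: "10 + dist6 (u + 2) \<le> d2 \<or> d2 = 8 \<and> u mod 6 = 0 \<and> sp \<or> d2 = 9 \<and> u mod 6 = 5"
    and le: "d1 + d2 \<le> 8 + e2" and eq: "a + u = s1 + s2"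
    and e: "s1 mod 6 = 4" "e2 = 7 \<and> s2 mod 6 = 5 \<or> e2 = 8 \<and> s2 mod 6 = 4"
  shows "e2 = 8 \<and> s2 mod 6 = 4 \<and> a mod 6 = 2 \<and> d2 = 8 \<and> sp"
proof -
  obtain r where r: "r = a mod 6" "r \<in> {0,1,2,3,4,5}" using residue_cases by blast
  have na: "dist6 a = dist6 r" by (rule dist6_cong) (simp add: r)
  have u: "u = s1 + s2 - a" using eq by simp
  have nu: "dist6 (u + 2) = dist6 (s1 mod 6 + s2 mod 6 - r + 2)" unfolding u r(1) by (rule dist6_cong) (intro mod_add_cong mod_diff_cong; simp)
  have um: "u mod 6 = (s1 mod 6 + s2 mod 6 - r) mod 6" unfolding u r(1) by (intro mod_diff_cong mod_add_cong; simp)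
  obtain \<sigma>1 \<sigma>2 where s: "\<sigma>1 = s1 mod 6" "\<sigma>2 = s2 mod 6" by blast
  show ?thesis
    using e d1 d2 le r(2) unfolding na nu um s[symmetric] r(1)[symmetric]
    by (elim disjE[of "e2 = 7 \<and> _"] conjE insertE emptyE; hypsubst; simp add: dist6_def; linarith)
qed

lemma lift_sink_union4_arith:
  assumes d1: "6 + dist6 a \<le> d1" and d2: "8 + dist6 (u + 2) \<le> d2"
    and d3: "tight_or_slack d3 (s1 - a)" and d4: "tight_or_slack d4 (s2 - a)"
    and le: "d1 + d2 \<le> e1 + e2" "d3 + d4 + 4 \<le> e1 + e2" and eq: "a + u = s1 + s2"
    and e: "e1 = 7 \<and> s1 mod 6 = 5 \<or> e1 = 8 \<and> s1 mod 6 = 4"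
    "e2 = 7 \<and> s2 mod 6 = 5 \<or> e2 = 8 \<and> s2 mod 6 = 4"
  shows "d2 = 8 \<and> u mod 6 = 4"
proof -
  obtain r where r: "r = a mod 6" "r \<in> {0,1,2,3,4,5}" using residue_cases by blast
  have na: "dist6 a = dist6 r" by (rule dist6_cong) (simp add: r)
  have u: "u = s1 + s2 - a" using eq by simp
  have nu: "dist6 (u + 2) = dist6 (s1 mod 6 + s2 mod 6 - r + 2)" unfolding u r(1) by (rule dist6_cong) (intro mod_add_cong mod_diff_cong; simp)
  have um: "u mod 6 = (s1 mod 6 + s2 mod 6 - r) mod 6" unfolding u r(1) by (intro mod_diff_cong mod_add_cong; simp)
  have m: "(s1 - a) mod 6 = (s1 mod 6 - r) mod 6" "(s2 - a) mod 6 = (s2 mod 6 - r) mod 6"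
    unfolding r(1) by (simp_all add: mod_simps)
  have n: "dist6 (s1 - a) = dist6 (s1 mod 6 - r)" "dist6 (s2 - a) = dist6 (s2 mod 6 - r)"
    unfolding r(1) by (rule dist6_cong; simp add: mod_simps)+
  have d1': "6 + dist6 r \<le> d1" using d1 unfolding tight_or_slack_def na r(1) by simp
  have d3': "tight_or_slack d3 (s1 mod 6 - r)" using d3 unfolding tight_or_slack_def m n .
  have d4': "tight_or_slack d4 (s2 mod 6 - r)" using d4 unfolding tight_or_slack_def m n .
  obtain \<sigma>1 \<sigma>2 where s: "\<sigma>1 = s1 mod 6" "\<sigma>2 = s2 mod 6" by blast
  show ?thesis
    using e r(2) d1' d2 d3' d4' le unfolding tight_or_slack_def nu um s[symmetric]
    by (elim disjE[of "e1 = 7 \<and> _"] disjE[of "e2 = 7 \<and> _"] conjE insertE emptyE;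
        hypsubst; simp add: dist6_def; linarith)
qed

text \<open>The labellings left over when neither contraction nor deletion applies, normalised so that the
preoriented vertex only emits arcs.\<close>

locale positive_world = admissible_step +
  assumes n3: "3 \<le> card V"
    and slack: "\<And>A. A \<subseteq> V \<Longrightarrow> 2 \<le> card A \<Longrightarrow> A \<noteq> V \<Longrightarrow> 6 + dist6 (sum t A) \<le> D A"
    and tight: "\<And>v. v \<in> V \<Longrightarrow> D {v} = 4 + dist6 (t v)"
    and positive: "\<And>v. v \<in> V \<Longrightarrow> t v mod 6 = 1 \<or> t v mod 6 = 2"
    and q0: "\<And>v. v \<in> V \<Longrightarrow> q v = 0"
    and p_pos: "0 < sum p V"
begin

abbreviation "d0 \<equiv> sum p V"

lemma dist6_t: "v \<in> V \<Longrightarrow> t v mod 6 = 1 \<Longrightarrow> dist6 (t v) = 1" "v \<in> V \<Longrightarrow> t v mod 6 = 2 \<Longrightarrow> dist6 (t v) = 2"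
  unfolding dist6_def by auto

lemma D_vertex: "v \<in> V \<Longrightarrow> D {v} = 5 \<and> t v mod 6 = 1 \<or> D {v} = 6 \<and> t v mod 6 = 2"
  using tight[of v] positive[of v] dist6_t[of v] by auto

lemma dist6_t_minus: "v \<in> V \<Longrightarrow> dist6 (t v - 1) = dist6 (t v) - 1"
proof -
  assume "v \<in> V"
  then consider "t v mod 6 = 1" | "t v mod 6 = 2" using positive by blast
  then show ?thesis
  proof cases
    case 1
    then have "(t v - 1) mod 6 = 0" by presburger
    then show ?thesis using 1 by (simp add: dist6_def)
  next
    case 2
    then have "(t v - 1) mod 6 = 1" by presburger
    then show ?thesis using 2 by (simp add: dist6_def)
  qed
qed

lemma D_cases:
  assumes "A \<subseteq> V" "A \<noteq> {}" "A \<noteq> V"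
  shows "(\<exists>v\<in>V. A = {v}) \<and> D A = 4 + dist6 (sum t A) \<and> (sum t A mod 6 = 1 \<or> sum t A mod 6 = 2) \<or> 2 \<le> card A \<and> 6 + dist6 (sum t A) \<le> D A"
proof (cases "2 \<le> card A")
  case True
  then show ?thesis using slack assms by blast
next
  case False
  then have "card A = 1" using assms fin finite_subset card_gt_0_iff[of A] by fastforce
  then obtain v where "A = {v}" using card_1_singletonE by blast
  then show ?thesis using tight positive assms by auto
qed

lemma D_tight_or_slack:
  assumes "A \<subseteq> V" "A \<noteq> {}" "A \<noteq> V"
  shows "tight_or_slack (D A) (sum t A)"
  using D_cases[OF assms] unfolding tight_or_slack_def by (auto simp: dist6_def)

lemma c_eq: "A \<subseteq> V \<Longrightarrow> sum c A = sum p A"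
  using q0 by (intro sum.cong) auto

text \<open>The label of the preoriented vertex is its degree, because all its arcs leave it.\<close>

lemma t_total: "(sum t V + d0) mod 6 = 0"
proof -
  have "even (sum c V - sum t V)" using D_parity[of V] unfolding D_V by simp
  then have e: "even (d0 - sum t V)" using c_eq[of V] by simp
  have "(\<Sum>v\<in>V. t v + p v - q v) = (\<Sum>v\<in>V. t v + p v)"
    by (rule sum.cong[OF refl]) (simp add: q0)
  also have "\<dots> = sum t V + d0" by (rule sum.distrib)
  finally have "3 dvd (sum t V + d0)" using T3 by (simp only:)
  moreover have "3 dvd (a + b) \<Longrightarrow> even (b - a) \<Longrightarrow> (a + b) mod 6 = 0" for a b :: int by presburger
  ultimately show ?thesis using e by blast
qed

lemma d0_le: "d0 \<le> 5"
proof (rule ccontr)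
  have le: "d0 \<le> 4 + dist6 (sum t V)" using up c_eq[of V] by simp
  assume "\<not> d0 \<le> 5"
  then have "d0 = 6 \<or> d0 = 7" using le dist6_le[of "sum t V"] by linarith
  moreover have "d0 = 6 \<Longrightarrow> sum t V mod 6 = 0" "d0 = 7 \<Longrightarrow> sum t V mod 6 = 5"
  proof -
    have "(a + b) mod 6 = 0 \<Longrightarrow> b = 6 \<Longrightarrow> a mod 6 = 0" "(a + b) mod 6 = 0 \<Longrightarrow> b = 7 \<Longrightarrow> a mod 6 = 5"
      for a b :: int by presburger+
    note * = this[OF t_total]
    show "d0 = 6 \<Longrightarrow> sum t V mod 6 = 0" by (rule *(1))
    show "d0 = 7 \<Longrightarrow> sum t V mod 6 = 5" by (rule *(2))
  qed
  ultimately show False using le by (auto simp: dist6_def)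
qed

lemma D_rest: "x \<in> V \<Longrightarrow> D (V - {x}) = d0 - D {x} + 2 * sum (w x) V"
  using D_insert[of "V - {x}" x] c_eq[of V] by (simp add: D_V insert_absorb sum_wx)

lemma t_rest: "x \<in> V \<Longrightarrow> sum t (V - {x}) = sum t V - t x"
  using sum.remove[OF fin, of x t] by simp

lemma card_rest: "x \<in> V \<Longrightarrow> 2 \<le> card (V - {x})"
  using n3 fin by simp

text \<open>The set \<open>A\<close> together with \<open>x\<close> has at least two vertices and is not \<open>V\<close>, so it has slack.\<close>

lemma D_insert_slack:
  assumes "x \<in> V" "A \<subseteq> V - {x}" "A \<noteq> {}" "A \<noteq> V - {x}"
  shows "6 + dist6 (sum t A + t x) \<le> D A + D {x} - 2 * sum (w x) A"
proof -
  have finA: "finite A" using assms fin finite_subset by blast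
  have xA: "x \<notin> A" "A \<subseteq> V" using assms by blast+
  then have "card (insert x A) = Suc (card A)" using finA by simp
  moreover have "card A \<noteq> 0" using finA assms by auto
  ultimately have "2 \<le> card (insert x A)" by linarith
  moreover have "insert x A \<noteq> V" using assms xA by blast
  ultimately have "6 + dist6 (sum t (insert x A)) \<le> D (insert x A)" using assms by (intro slack) auto
  moreover have "sum t (insert x A) = sum t A + t x" using xA(1) finA by simp
  ultimately show ?thesis using D_insert[OF xA(2) assms(1) xA(1)] by simp
qed

lemma p_le: "x \<in> V \<Longrightarrow> p x \<le> d0" "x \<in> V \<Longrightarrow> 0 \<le> p x"
  using sum.remove[OF fin, of x p] sum_nonneg[of "V - {x}" p] pq by auto

text \<open>The complement of \<open>x\<close> has slack, while \<open>d0\<close> is at most 5.\<close>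

lemma p_le_2:
  assumes x: "x \<in> V"
  shows "p x \<le> 2"
proof -
  have "6 + dist6 (sum t (V - {x})) \<le> D (V - {x})" using card_rest[OF x] x by (intro slack) auto
  moreover have "D {x} = sum (w x) V + p x" using D_singleton[OF x] q0[OF x] by simp
  ultimately have "6 + dist6 (sum t (V - {x})) \<le> d0 + D {x} - 2 * p x" using D_rest[OF x] by simp
  moreover have "dist6 (sum t (V - {x})) \<ge> 0" by (rule dist6_nonneg)
  ultimately show ?thesis using D_vertex[OF x] d0_le by linarith
qed

lemma deg: "x \<in> V \<Longrightarrow> sum (w x) V = D {x} - p x"
  using D_singleton[of x] q0[of x] by simp

text \<open>A pair with more edges would be a set of two vertices without slack.\<close>

lemma w_bound:
  assumes "x \<in> V" "y \<in> V" "x \<noteq> y"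
  shows "t x mod 6 = 1 \<Longrightarrow> w x y \<le> 1" and "w x y \<le> 2"
proof -
  have "{y} \<subseteq> V - {x}" using assms by blast
  moreover have "{y} \<noteq> V - {x}"
  proof
    assume "{y} = V - {x}"
    then have "card (V - {x}) = card {y}" by simp
    then show False using card_rest[OF assms(1)] by simp
  qed
  ultimately have "6 + dist6 (sum t {y} + t x) \<le> D {y} + D {x} - 2 * sum (w x) {y}"
    by (intro D_insert_slack[OF assms(1)]) simp_all
  then have "6 + dist6 (t y + t x) \<le> D {y} + D {x} - 2 * w x y" by simp
  note * = this D_vertex[OF assms(1)] D_vertex[OF assms(2)]
  have n: "dist6 (t y + t x) = dist6 (t y mod 6 + t x mod 6)" by (rule dist6_cong) (intro mod_add_cong mod_diff_cong; simp)
  show "w x y \<le> 1" if "t x mod 6 = 1"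
    using * that unfolding n by (elim disjE conjE; simp add: dist6_def)
  show "w x y \<le> 2" using * unfolding n by (elim disjE conjE; simp add: dist6_def)
qed

end

section \<open>Sinks: the cases settled by uncrossing violated sets\<close>

lemma distinct_if_count_list_le_1: "(\<And>z. count_list ys z \<le> 1) \<Longrightarrow> distinct ys"
proof (induction ys)
  case (Cons a ys)
  have "a \<notin> set ys" using Cons.prems[of a] by (simp add: count_list_0_iff)
  moreover have "count_list ys z \<le> 1" for z using Cons.prems[of z] by (auto split: if_splits)
  ultimately show ?case using Cons.IH by simp
qed simp

context positive_world
begin

lemma total_mod: "d0 = n \<Longrightarrow> t x mod 6 = i \<Longrightarrow> (sum t V - t x - j) mod 6 = (- n - i - j) mod 6"
proof -
  assume d0: "d0 = n" and t: "t x mod 6 = i"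
  have "(s + m) mod 6 = 0 \<Longrightarrow> k mod 6 = i \<Longrightarrow> (s - k - j) mod 6 = (- m - i - j) mod 6" for s m k :: int
    by (metis (no_types, lifting) add_diff_cancel_right' diff_0 mod_diff_left_eq mod_diff_right_eq)
  from this[OF t_total t] show ?thesis using d0 by simp
qed

lemma sum_rest_p: "x \<in> V \<Longrightarrow> sum c V - c x = d0 - p x"
  using c_eq[of V] q0[of x] by simp

text \<open>With at most three or four preoriented arcs the new preoriented vertex stays within its bound,
so no arc has to be deleted and every set keeps its boundary and label.\<close>

lemma plain_sink_5:
  assumes x: "x \<in> V" "t x mod 6 = 1" and m: "p x = 1 \<and> d0 \<le> 3 \<or> p x = 2 \<and> d0 \<le> 4"
  shows goal
proof (rule sink_step[OF x(1), of "\<lambda>_. 0"])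
  have D5: "D {x} = 5" using D_vertex[OF x(1)] x(2) by auto
  have dx: "sum (w x) V = 5 - p x" using deg[OF x(1)] D5 by simp
  show "2 \<le> card V" using n3 by simp
  show "3 dvd (t x + p x - q x + sum (w x) V)" using x dx q0 by simp presburger
  show "4 + dist6 (sum t A - sum (\<lambda>_. 0) A) \<le> D A - sum (\<lambda>_. 0) A" if "A \<subseteq> V - {x}" "A \<noteq> {}" for A
    using low[of A] that x by auto
  have "1 \<le> d0" "p x \<le> d0" using p_pos p_le x by auto
  then have "p x = 1 \<and> d0 = 1 \<or> p x = 1 \<and> d0 = 2 \<or> p x = 1 \<and> d0 = 3 \<or>
      p x = 2 \<and> d0 = 2 \<or> p x = 2 \<and> d0 = 3 \<or> p x = 2 \<and> d0 = 4" using m by linarith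
  then show "sum c V - c x + sum (w x) V - sum (\<lambda>_. 0) (V - {x})
      \<le> 4 + dist6 (sum t V - t x - sum (\<lambda>_. 0) (V - {x}))"
    unfolding sum_rest_p[OF x(1)] dx
    using total_mod[OF _ x(2), where j = 0] by (elim disjE conjE; simp add: dist6_def)
qed (use w_nonneg in auto)

text \<open>Deleting one arc out of a vertex with label 1 or 2 lowers the distance along with the
boundary, and larger sets have slack.\<close>

lemma del_one_ok:
  assumes "A \<subseteq> V" "A \<noteq> {}" "A \<noteq> V"
  shows "4 + dist6 (sum t A - of_bool b) \<le> D A - of_bool b"
  using D_cases[OF assms] dist6_step[of "sum t A"] dist6_t_minus by (cases b) auto

text \<open>Keeping all three arcs would leave the preoriented vertex with degree 6 and label 0; with one
arc deleted it has degree 5 and label 1 modulo 6, which is within its bound.\<close>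

lemma one_del_sink_5:
  assumes x: "x \<in> V" "t x mod 6 = 1" and m: "p x = 2" "d0 = 5"
  shows goal
proof -
  have D5: "D {x} = 5" using D_vertex[OF x(1)] x(2) by auto
  have dx: "sum (w x) V = 3" using deg[OF x(1)] D5 m by simp
  have "\<exists>y\<in>V. w x y \<noteq> 0" by (rule ccontr) (use dx in simp)
  then obtain y where y: "y \<in> V - {x}" "1 \<le> w x y"
    using w_nonneg[of x] w_diag[of x] by (metis DiffI int_one_le_iff_zero_less order_le_less singletonD)
  show goal
  proof (rule sink_step[OF x(1), of "\<lambda>z. of_bool (z = y)"])
    have sd: "sum (\<lambda>z. of_bool (z = y)) A = of_bool (y \<in> A)" if "A \<subseteq> V - {x}" for A
      using finite_subset[OF that] fin by (simp add: of_bool_def)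
    show "2 \<le> card V" using n3 by simp
    show "3 dvd (t x + p x - q x + sum (w x) V)" using x dx q0 m by simp presburger
    show "4 + dist6 (sum t A - sum (\<lambda>z. of_bool (z = y)) A) \<le> D A - sum (\<lambda>z. of_bool (z = y)) A"
      if "A \<subseteq> V - {x}" "A \<noteq> {}" for A
    proof -
      have "A \<subseteq> V" "A \<noteq> V" using that x by blast+
      then show ?thesis unfolding sd[OF that(1)] using del_one_ok that(2) by blast
    qed
    show "sum c V - c x + sum (w x) V - sum (\<lambda>z. of_bool (z = y)) (V - {x})
        \<le> 4 + dist6 (sum t V - t x - sum (\<lambda>z. of_bool (z = y)) (V - {x}))"
      unfolding sum_rest_p[OF x(1)] dx sd[OF order.refl]
      using total_mod[OF m(2) x(2), where j = 1] y m by (simp add: dist6_def)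
    show "0 \<le> (of_bool (z = y) :: int) \<and> of_bool (z = y) \<le> w x z" for z
      using y(2) w_nonneg[of x z] by auto
  qed
qed

text \<open>Six incoming arcs give net outflow 0 modulo 6; four of them, after one pair has been lifted,
give the label 2.\<close>

lemma lift_sink_6:
  assumes x: "x \<in> V" "t x mod 6 = 2" and m: "p x = 1 \<and> d0 \<le> 3 \<or> p x = 2"
  shows goal
proof -
  have D6: "D {x} = 6" using D_vertex[OF x(1)] x(2) by auto
  have dx: "sum (w x) V = 6 - p x" using deg[OF x(1)] D6 by simp
  have "\<exists>y\<in>V. w x y \<noteq> 0" by (rule ccontr) (use dx m in simp)
  then obtain a where a: "a \<in> V - {x}" "1 \<le> w x a"
    using w_nonneg[of x] w_diag[of x] by (metis DiffI int_one_le_iff_zero_less order_le_less singletonD)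
  have "\<exists>y\<in>V - {a}. w x y \<noteq> 0"
  proof (rule ccontr)
    assume "\<not> ?thesis"
    then have "sum (w x) (V - {a}) = 0" by simp
    then have "sum (w x) V = w x a" using sum.remove[OF fin, of a "w x"] a by simp
    then show False using w_bound(2)[of x a] x a dx m by auto
  qed
  then obtain b where b: "b \<in> V - {x}" "1 \<le> w x b" "b \<noteq> a"
    using w_nonneg[of x] w_diag[of x] by (metis DiffE DiffI int_one_le_iff_zero_less order_le_less singletonD singletonI)
  show goal
  proof (rule sink_lift_step[OF x(1) _ a(1) b(1), of "\<lambda>_. 0"])
    show "2 \<le> card V" using n3 by simp
    show "3 dvd (t x + p x - q x + sum (w x) V - 2)" using x dx q0 by simp presburger
    show "4 + dist6 (sum t A - sum (\<lambda>_. 0) A) \<le> D A - sum (\<lambda>_. 0) A - 2 * of_bool (a \<in> A \<and> b \<in> A)"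
      if A: "A \<subseteq> V - {x}" "A \<noteq> {}" for A
    proof (cases "a \<in> A \<and> b \<in> A")
      case True
      have "card {a, b} \<le> card A" using True A fin by (intro card_mono) (auto intro: finite_subset)
      then have "2 \<le> card A" using b(3) by simp
      then show ?thesis using slack[of A] A x True by auto
    next
      case False
      then show ?thesis using low[of A] A x by auto
    qed
    have "1 \<le> d0" "p x \<le> d0" "d0 \<le> 5" using p_pos p_le x d0_le by auto
    then have "p x = 1 \<and> d0 = 1 \<or> p x = 1 \<and> d0 = 2 \<or> p x = 1 \<and> d0 = 3 \<or>
        p x = 2 \<and> d0 = 2 \<or> p x = 2 \<and> d0 = 3 \<or> p x = 2 \<and> d0 = 4 \<or> p x = 2 \<and> d0 = 5" using m by linarith
    then show "sum c V - c x + sum (w x) V - 2 - sum (\<lambda>_. 0) (V - {x})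
        \<le> 4 + dist6 (sum t V - t x - sum (\<lambda>_. 0) (V - {x}))"
      unfolding sum_rest_p[OF x(1)] dx
      using total_mod[OF _ x(2), where j = 0] by (elim disjE conjE; simp add: dist6_def)
    show "0 \<le> (0::int) \<and> of_bool (z = a) + of_bool (z = b) + 0 \<le> w x z" for z
      using a(2) b w_nonneg[of x z] by auto
  qed
qed

lemma sum_Int_Un: "A \<subseteq> V \<Longrightarrow> B \<subseteq> V \<Longrightarrow> sum f (A \<inter> B) + sum f (A \<union> B) = sum f A + (sum f B :: int)"
  using sum.union_inter[of A B f] fin finite_subset by fastforce

lemma sum_Diff_Int: "A \<subseteq> V \<Longrightarrow> sum f (A - B) = sum f A - (sum f (A \<inter> B) :: int)"
  using sum.Int_Diff[of A f B] fin finite_subset by fastforce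

text \<open>Now two of the four arcs into the sink must be deleted, and for each choice of two neighbours
there may be a violated set containing both.  Uncrossing shows that a violated set never contains
three of the neighbours, and that violated sets for the choices \<open>{y1, y2}\<close> and \<open>{y1, y3}\<close> would
produce one that does.\<close>

lemma two_del_sink_5:
  assumes x: "x \<in> V" "t x mod 6 = 1" and m: "p x = 1" and d: "d0 = 4 \<or> d0 = 5"
  shows goal
proof (rule ccontr)
  assume ng: "\<not> goal"
  let ?k = "\<lambda>A. sum (w x) A" and ?s = "\<lambda>A. sum t A"
  have D5: "D {x} = 5" using D_vertex[OF x(1)] x(2) by auto
  have dx: "sum (w x) V = 4" using deg[OF x(1)] D5 m by simp
  have "\<forall>y\<in>V. 0 \<le> w x y" using w_nonneg by blast
  moreover have "sum (w x) V = int 4" using dx by simp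
  ultimately obtain ys where ys: "length ys = 4" "\<And>y. y \<in> V \<Longrightarrow> w x y = (\<Sum>z\<leftarrow>ys. of_bool (y = z))"
    "\<And>A. A \<subseteq> V \<Longrightarrow> ?k A = (\<Sum>z\<leftarrow>ys. of_bool (z \<in> A))" "\<And>z. z \<in> set ys \<Longrightarrow> z \<in> V \<and> 1 \<le> w x z"
    using neighbour_list by metis
  have w1: "w x z \<le> 1" if "z \<in> V" for z
    using w_bound(1)[OF x(1) that _ x(2)] w_diag[of x] by (cases "z = x") auto
  have yV: "z \<in> V - {x}" "w x z = 1" if "z \<in> set ys" for z
    using ys(4)[OF that] w_diag[of x] w1[of z] by auto
  have "distinct ys"
  proof -
    have "count_list ys z \<le> 1" for z
      using yV[of z] ys(2)[of z] int_count_list[of ys z] count_list_0_iff[of ys z] by (cases "z \<in> set ys") auto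
    then show ?thesis by (rule distinct_if_count_list_le_1)
  qed
  \<comment> \<open>The conclusions of \<open>sink_arith\<close>: these sets are the only ones that deletion of two arcs can
  violate.\<close>
  define bad where "bad A \<longleftrightarrow> A \<subseteq> V - {x} \<and> A \<noteq> V - {x} \<and>
    (D A = 6 \<and> ?s A mod 6 = 0 \<and> ?k A = 2 \<or> D A = 7 \<and> ?s A mod 6 = 5 \<and> (?k A = 2 \<or> ?k A = 3))" for A
  have ex: "\<exists>A. bad A \<and> y \<in> A \<and> z \<in> A" if yz: "y \<in> set ys" "z \<in> set ys" "y \<noteq> z" for y z
  proof -
    let ?del = "\<lambda>u. of_bool (u = y) + of_bool (u = z) :: int"
    have sd: "sum ?del A = of_bool (y \<in> A) + of_bool (z \<in> A)" if "A \<subseteq> V - {x}" for A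
      using finite_subset[OF that] fin by (simp add: sum.distrib of_bool_def)
    have "\<exists>A. A \<subseteq> V - {x} \<and> A \<noteq> {} \<and> A \<noteq> V - {x} \<and> \<not> 4 + dist6 (?s A - sum ?del A) \<le> D A - sum ?del A"
    proof (rule ccontr)
      assume none: "\<not> ?thesis"
      have goal
      proof (rule sink_step[OF x(1), of ?del])
        show "2 \<le> card V" using n3 by simp
        show "3 dvd (t x + p x - q x + sum (w x) V)" using x dx q0 m by simp presburger
        show "sum c V - c x + sum (w x) V - sum ?del (V - {x}) \<le> 4 + dist6 (sum t V - t x - sum ?del (V - {x}))"
          unfolding sum_rest_p[OF x(1)] dx sd[OF order.refl]
          using total_mod[OF _ x(2), where j = 2] d yV[OF yz(1)] yV[OF yz(2)] m
          by (elim disjE; simp add: dist6_def)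
        show "0 \<le> ?del u \<and> ?del u \<le> w x u" for u
          using yV[OF yz(1)] yV[OF yz(2)] w_nonneg[of x u] yz(3) by auto
      qed (use none in blast)
      then show False using ng by blast
    qed
    then obtain A where A: "A \<subseteq> V - {x}" "A \<noteq> {}" "A \<noteq> V - {x}"
      and viol: "D A - (of_bool (y \<in> A) + of_bool (z \<in> A)) < 4 + dist6 (?s A - (of_bool (y \<in> A) + of_bool (z \<in> A)))"
      using sd by (metis (no_types, lifting) not_le)
    have AV: "A \<subseteq> V" "A \<noteq> V" using A x by auto
    have in2: "y \<in> A" "z \<in> A"
    proof -
      have "\<not> (y \<in> A \<and> z \<in> A) \<Longrightarrow> \<exists>b. of_bool (y \<in> A) + of_bool (z \<in> A) = (of_bool b :: int)"
        by (cases "y \<in> A"; cases "z \<in> A") auto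
      then have "y \<in> A \<and> z \<in> A" using viol del_one_ok[OF AV(1) A(2) AV(2)] by (metis not_less)
      then show "y \<in> A" "z \<in> A" by auto
    qed
    have finA: "finite A" using AV fin finite_subset by blast
    have "card {y, z} \<le> card A" using in2 finA by (intro card_mono) auto
    then have "2 \<le> card A" using yz(3) by simp
    then have f1: "6 + dist6 (?s A) \<le> D A" using slack AV by blast
    have "6 + dist6 (?s A + t x) \<le> D A + 5 - 2 * ?k A" using D_insert_slack[OF x(1) A] D5 by simp
    moreover have "dist6 (?s A + t x) = dist6 (?s A + 1)" using x(2) by (intro dist6_cong mod_add_cong) auto
    ultimately have f2: "6 + dist6 (?s A + 1) \<le> D A + 5 - 2 * ?k A" by simp
    have "?k {y, z} \<le> ?k A" using in2 finA w_nonneg by (intro sum_mono2) auto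
    then have f3: "2 \<le> ?k A" using yz(3) yV(2)[OF yz(1)] yV(2)[OF yz(2)] by simp
    have "D A - 2 < 4 + dist6 (?s A - 2)" using viol in2 by simp
    then have "bad A" unfolding bad_def using sink_arith[OF f1 f2 _ D_parity[OF AV(1)] f3] A by blast
    then show ?thesis using in2 by blast
  qed
  have badD: "A \<subseteq> V" "A \<noteq> V" "A \<noteq> {}" "D A = 6 \<and> ?s A mod 6 = 0 \<or> D A = 7 \<and> ?s A mod 6 = 5"
    "tight_or_slack (D B) (?s B)" if "bad A" "B \<subseteq> A" "B \<noteq> {}" for A B
  proof -
    show "A \<subseteq> V" "A \<noteq> V" "D A = 6 \<and> ?s A mod 6 = 0 \<or> D A = 7 \<and> ?s A mod 6 = 5"
      using that(1) x unfolding bad_def by auto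
    show "A \<noteq> {}" using that by auto
    show "tight_or_slack (D B) (?s B)" using that(1) x unfolding bad_def by (intro D_tight_or_slack) (use that in auto)
  qed
  have union4: False if b: "bad A" "bad B" and AB: "A \<inter> B \<noteq> {}" and k4: "?k (A \<union> B) = 4" for A B
  proof -
    note A = badD[OF b(1) _ AB] and B = badD[OF b(2) _ AB]
    have V: "A \<subseteq> V" "B \<subseteq> V" "A \<union> B \<subseteq> V - {x}" using b unfolding bad_def by auto
    have d1: "tight_or_slack (D (A \<inter> B)) (?s (A \<inter> B))" by (rule A(5)) auto
    have d2: "9 + dist6 (?s (A \<union> B) + 1) \<le> D (A \<union> B) \<or> D (A \<union> B) = 7 \<and> ?s (A \<union> B) mod 6 = 1
        \<or> D (A \<union> B) = 8 \<and> ?s (A \<union> B) mod 6 = 0"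
    proof (cases "A \<union> B = V - {x}")
      case True
      have "D (A \<union> B) = d0 + 3" unfolding True D_rest[OF x(1)] D5 dx by simp
      moreover have "?s (A \<union> B) mod 6 = (- d0 - 1) mod 6"
        unfolding True t_rest[OF x(1)] using total_mod[OF refl x(2), where j = 0] by simp
      ultimately show ?thesis using d by auto
    next
      case False
      have "6 + dist6 (?s (A \<union> B) + t x) \<le> D (A \<union> B) + 5 - 2 * 4"
        using D_insert_slack[OF x(1) V(3) _ False] D5 k4 AB by auto
      moreover have "dist6 (?s (A \<union> B) + t x) = dist6 (?s (A \<union> B) + 1)"
        using x(2) by (intro dist6_cong mod_add_cong) auto
      ultimately show ?thesis by simp
    qed
    show False
      by (rule sink_union4_arith[OF d1 d2 boundary_submodular[OF fin mult V(1,2)] sum_Int_Un[OF V(1,2)] A(4) B(4)]) auto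
  qed
  obtain y1 y2 y3 y4 where yl: "ys = [y1, y2, y3, y4]" using ys(1) by (auto simp: numeral_eq_Suc length_Suc_conv)
  have kf: "?k A = of_bool (y1 \<in> A) + of_bool (y2 \<in> A) + of_bool (y3 \<in> A) + of_bool (y4 \<in> A)" if "A \<subseteq> V" for A
    using ys(3)[OF that] unfolding yl by simp
  have no3: "?k A = 2" if b: "bad A" for A
  proof (rule ccontr)
    assume "?k A \<noteq> 2"
    then have k3: "?k A = 3" and AV: "A \<subseteq> V" using b unfolding bad_def by auto
    have "\<exists>i\<in>set ys. \<exists>j\<in>set ys. i \<in> A \<and> j \<notin> A \<and> (\<forall>l\<in>set ys. l \<noteq> j \<longrightarrow> l \<in> A)"
      using k3 \<open>distinct ys\<close> unfolding kf[OF AV] yl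
      by (cases "y1 \<in> A"; cases "y2 \<in> A"; cases "y3 \<in> A"; cases "y4 \<in> A"; simp; blast)
    then obtain i j where ij: "i \<in> set ys" "j \<in> set ys" "i \<in> A" "j \<notin> A" "\<forall>l\<in>set ys. l \<noteq> j \<longrightarrow> l \<in> A" by blast
    then obtain B where B: "bad B" "i \<in> B" "j \<in> B" using ex[of i j] by auto
    have "A \<union> B \<subseteq> V" using b B unfolding bad_def by auto
    moreover have "l \<in> A \<union> B" if "l \<in> set ys" for l using ij B that by auto
    ultimately have "?k (A \<union> B) = 4" using kf[of "A \<union> B"] unfolding yl by simp
    then show False using union4[OF b B(1)] ij B by blast
  qed
  obtain A where A: "bad A" "y1 \<in> A" "y2 \<in> A" using ex[of y1 y2] \<open>distinct ys\<close> unfolding yl by auto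
  obtain B where B: "bad B" "y1 \<in> B" "y3 \<in> B" using ex[of y1 y3] \<open>distinct ys\<close> unfolding yl by auto
  have V: "A \<subseteq> V" "B \<subseteq> V" "A \<union> B \<subseteq> V - {x}" "A \<union> B \<subseteq> V" "x \<notin> A" "x \<notin> B" using A B unfolding bad_def by auto
  have nA: "y3 \<notin> A" "y4 \<notin> A" and nB: "y2 \<notin> B" "y4 \<notin> B"
    using no3[OF A(1)] kf[OF V(1)] A no3[OF B(1)] kf[OF V(2)] B by (auto simp: of_bool_def split: if_splits)
  have ne: "A \<inter> B \<noteq> {}" "A - B \<noteq> {}" "B - A \<noteq> {}" using A B nA nB by auto
  have y4: "y4 \<in> V - {x}" using yV unfolding yl by auto
  have k3: "?k (A \<union> B) = 3" using kf[OF V(4)] A B nA nB by simp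
  have d2: "7 + dist6 (?s (A \<union> B) + 1) \<le> D (A \<union> B)"
  proof -
    have "A \<union> B \<noteq> V - {x}" using nA nB y4 by auto
    then have "6 + dist6 (?s (A \<union> B) + t x) \<le> D (A \<union> B) + 5 - 2 * 3"
      using D_insert_slack[OF x(1) V(3)] D5 k3 ne by auto
    moreover have "dist6 (?s (A \<union> B) + t x) = dist6 (?s (A \<union> B) + 1)"
      using x(2) by (intro dist6_cong mod_add_cong) auto
    ultimately show ?thesis by simp
  qed
  have k1: "?k (A \<inter> B) = 1"
  proof -
    have "A \<inter> B \<subseteq> V" using V by auto
    from kf[OF this] show ?thesis using A B nA nB by simp
  qed
  have posi: "D (A - B) + D (B - A) + 2 \<le> D A + D B"
    using boundary_posimodular[OF fin mult V(1,2) x(1) V(5,6), of c] k1 pq by auto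
  have d3: "tight_or_slack (D (A - B)) (?s A - ?s (A \<inter> B))" "tight_or_slack (D (B - A)) (?s B - ?s (A \<inter> B))"
    using badD(5)[OF A(1) _ ne(2)] badD(5)[OF B(1) _ ne(3)] sum_Diff_Int[OF V(1), of t B] sum_Diff_Int[OF V(2), of t A]
    by (auto simp: Int_commute)
  have "D (A \<union> B) = 7 \<and> ?s (A \<union> B) mod 6 = 5"
    by (rule sink_union3_arith[OF badD(5)[OF A(1) _ ne(1)] d2 d3 boundary_submodular[OF fin mult V(1,2)] posi
          sum_Int_Un[OF V(1,2)] badD(4)[OF A(1) _ ne(1)] badD(4)[OF B(1) _ ne(1)]]) auto
  moreover have "A \<union> B \<noteq> V - {x}" using nA nB y4 by auto
  ultimately have "bad (A \<union> B)" unfolding bad_def using V(3) k3 by simp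
  then show False using no3 k3 by fastforce
qed

end

context positive_world
begin

text \<open>The pair \<open>a\<close>, \<open>b\<close> is lifted and one of the other three arcs is deleted.  A violated set
contains \<open>a\<close>, \<open>b\<close> and the end of the deleted arc.  As in the previous case, a violated set is shown
to contain only one of the remaining three ends, and the union of two such sets for different ends
contradicts this.\<close>

lemma lift_del_sink_6:
  assumes x: "x \<in> V" "t x mod 6 = 2" and p1: "\<And>v. v \<in> V \<Longrightarrow> p v \<le> 1" and px: "p x = 1"
    and d: "d0 = 4 \<or> d0 = 5"
  shows goal
proof (rule ccontr)
  assume ng: "\<not> goal"
  let ?k = "\<lambda>A. sum (w x) A" and ?s = "\<lambda>A. sum t A"
  have D6: "D {x} = 6" using D_vertex[OF x(1)] x(2) by auto
  have dx: "sum (w x) V = 5" using deg[OF x(1)] D6 px by simp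
  have "\<exists>y\<in>V. w x y \<noteq> 0" by (rule ccontr) (use dx in simp)
  then obtain a where a: "a \<in> V - {x}" "1 \<le> w x a"
    using w_nonneg[of x] w_diag[of x] by (metis DiffI int_one_le_iff_zero_less order_le_less singletonD)
  have "\<exists>y\<in>V - {a}. w x y \<noteq> 0"
  proof (rule ccontr)
    assume "\<not> ?thesis"
    then have "sum (w x) (V - {a}) = 0" by simp
    then have "sum (w x) V = w x a" using sum.remove[OF fin, of a "w x"] a by simp
    then show False using w_bound(2)[of x a] x a dx by auto
  qed
  then obtain b where b: "b \<in> V - {x}" "1 \<le> w x b" "b \<noteq> a"
    using w_nonneg[of x] w_diag[of x] by (metis DiffE DiffI int_one_le_iff_zero_less order_le_less singletonD singletonI)
  define r where "r y = w x y - of_bool (y = a) - of_bool (y = b)" for y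
  have rsum: "sum r A = ?k A - of_bool (a \<in> A) - of_bool (b \<in> A)" if "A \<subseteq> V" for A
    unfolding r_def using finite_subset[OF that fin] by (simp add: sum_subtractf of_bool_def)
  have r0: "\<forall>y\<in>V. 0 \<le> r y" unfolding r_def using a b w_nonneg[of x] by auto
  have "sum r V = int 3" using rsum[of V] dx a b by simp
  then obtain cs where cs: "length cs = 3" "\<And>y. y \<in> V \<Longrightarrow> r y = (\<Sum>z\<leftarrow>cs. of_bool (y = z))"
    "\<And>A. A \<subseteq> V \<Longrightarrow> sum r A = (\<Sum>z\<leftarrow>cs. of_bool (z \<in> A))" "\<And>z. z \<in> set cs \<Longrightarrow> z \<in> V \<and> 1 \<le> r z"
    using neighbour_list[OF r0] by metis
  have rx: "r x = 0" unfolding r_def using a b w_diag by auto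
  have cV: "z \<in> V - {x}" "1 \<le> r z" if "z \<in> set cs" for z using cs(4)[OF that] rx by auto
  obtain c3 c4 c5 where cl: "cs = [c3, c4, c5]" using cs(1) by (auto simp: numeral_eq_Suc length_Suc_conv)
  have kf: "?k A = of_bool (a \<in> A) + of_bool (b \<in> A) + of_bool (c3 \<in> A) + of_bool (c4 \<in> A) + of_bool (c5 \<in> A)"
    if "A \<subseteq> V" for A
    using cs(3)[OF that] rsum[OF that] unfolding cl by simp
  \<comment> \<open>The conclusions of \<open>lift_sink_arith\<close>.\<close>
  define bad where "bad A \<longleftrightarrow> A \<subseteq> V - {x} \<and> A \<noteq> V - {x} \<and> a \<in> A \<and> b \<in> A \<and>
    (D A = 7 \<and> ?s A mod 6 = 5 \<and> ?k A = 3 \<or> D A = 8 \<and> ?s A mod 6 = 4 \<and> (?k A = 3 \<or> ?k A = 4))" for A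
  have ex: "\<exists>A. bad A \<and> z \<in> A" if z: "z \<in> set cs" for z
  proof -
    let ?del = "\<lambda>u. of_bool (u = z) :: int"
    have sd: "sum ?del A = of_bool (z \<in> A)" if "A \<subseteq> V - {x}" for A
      using finite_subset[OF that] fin by (simp add: of_bool_def)
    have "\<exists>A. A \<subseteq> V - {x} \<and> A \<noteq> {} \<and> A \<noteq> V - {x} \<and>
        \<not> 4 + dist6 (?s A - sum ?del A) \<le> D A - sum ?del A - 2 * of_bool (a \<in> A \<and> b \<in> A)"
    proof (rule ccontr)
      assume none: "\<not> ?thesis"
      have goal
      proof (rule sink_lift_step[OF x(1) _ a(1) b(1), of ?del])
        show "2 \<le> card V" using n3 by simp
        show "3 dvd (t x + p x - q x + sum (w x) V - 2)" using x dx q0 px by simp presburger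
        show "sum c V - c x + sum (w x) V - 2 - sum ?del (V - {x}) \<le> 4 + dist6 (sum t V - t x - sum ?del (V - {x}))"
          unfolding sum_rest_p[OF x(1)] dx sd[OF order.refl]
          using total_mod[OF _ x(2), where j = 1] d cV[OF z] px
          by (elim disjE; simp add: dist6_def)
        show "0 \<le> ?del u \<and> of_bool (u = a) + of_bool (u = b) + ?del u \<le> w x u" if "u \<in> V - {x}" for u
          using cV(2)[OF z] r0 that unfolding r_def by fastforce
      qed (use none in blast)
      then show False using ng by blast
    qed
    then obtain A where A: "A \<subseteq> V - {x}" "A \<noteq> {}" "A \<noteq> V - {x}"
      and viol: "D A - of_bool (z \<in> A) - 2 * of_bool (a \<in> A \<and> b \<in> A) < 4 + dist6 (?s A - of_bool (z \<in> A))"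
      using sd by (metis (no_types, lifting) not_le)
    have AV: "A \<subseteq> V" "A \<noteq> V" using A x by auto
    have "a \<in> A \<and> b \<in> A"
    proof (rule ccontr)
      assume "\<not> (a \<in> A \<and> b \<in> A)"
      then have "of_bool (a \<in> A \<and> b \<in> A) = (0::int)" by simp
      then show False using viol del_one_ok[OF AV(1) A(2) AV(2), of "z \<in> A"] by linarith
    qed
    then have ab: "a \<in> A" "b \<in> A" by blast+
    have finA: "finite A" using AV fin finite_subset by blast
    have "card {a, b} \<le> card A" using ab finA by (intro card_mono) auto
    then have "2 \<le> card A" using b(3) by simp
    then have f1: "6 + dist6 (?s A) \<le> D A" using slack AV by blast
    then have zA: "z \<in> A" using viol ab by (cases "z \<in> A") auto
    have "6 + dist6 (?s A + t x) \<le> D A + 6 - 2 * ?k A" using D_insert_slack[OF x(1) A] D6 by simp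
    moreover have "dist6 (?s A + t x) = dist6 (?s A + 2)" using x(2) by (intro dist6_cong mod_add_cong) auto
    ultimately have f2: "6 + dist6 (?s A + 2) \<le> D A + 6 - 2 * ?k A" by simp
    have f3: "3 \<le> ?k A" using kf[OF AV(1)] ab zA z unfolding cl by auto
    have "D A - 3 < 4 + dist6 (?s A - 1)" using viol ab zA by simp
    then have "bad A" unfolding bad_def using lift_sink_arith[OF f1 f2 _ D_parity[OF AV(1)] f3] A ab by blast
    then show ?thesis using zA by blast
  qed
  have badV: "A \<subseteq> V" "A \<subseteq> V - {x}" "x \<notin> A" "a \<in> A" "b \<in> A" "A \<noteq> V - {x}" if "bad A" for A
    using that unfolding bad_def by blast+
  have two: "6 + dist6 (?s (A \<inter> B)) \<le> D (A \<inter> B)" if "bad A" "bad B" for A B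
  proof -
    have "card {a, b} \<le> card (A \<inter> B)"
      using badV[OF that(1)] badV[OF that(2)] fin by (intro card_mono) (auto intro: finite_subset)
    then have "2 \<le> card (A \<inter> B)" using b(3) by simp
    moreover have "A \<inter> B \<noteq> V" "A \<inter> B \<subseteq> V" using badV(1,3)[OF that(1)] x(1) by blast+
    ultimately show ?thesis using slack by blast
  qed
  have ins: "6 + dist6 (?s U + 2) \<le> D U + 6 - 2 * ?k U" if "U \<subseteq> V - {x}" "U \<noteq> {}" "U \<noteq> V - {x}" for U
  proof -
    have "6 + dist6 (?s U + t x) \<le> D U + 6 - 2 * ?k U" using D_insert_slack[OF x(1) that] D6 by simp
    moreover have "dist6 (?s U + t x) = dist6 (?s U + 2)" using x(2) by (intro dist6_cong mod_add_cong) auto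
    ultimately show ?thesis by simp
  qed
  have posi: "D (A - B) + D (B - A) + 4 \<le> D A + D B" if "bad A" "bad B" for A B
  proof -
    have "A \<inter> B \<subseteq> V" "a \<in> A \<inter> B" "b \<in> A \<inter> B" using badV[OF that(1)] badV[OF that(2)] by auto
    then have "2 \<le> ?k (A \<inter> B)" using kf[of "A \<inter> B"] by simp
    moreover have "D (A - B) + D (B - A) + 2 * ?k (A \<inter> B) \<le> D A + D B"
      by (rule boundary_posimodular[OF fin mult badV(1)[OF that(1)] badV(1)[OF that(2)] x(1)
            badV(3)[OF that(1)] badV(3)[OF that(2)]]) (use pq in auto)
    ultimately show ?thesis by simp
  qed
  have union5: False if A: "bad A" "?k A = 4" and B: "bad B" and k5: "?k (A \<union> B) = 5" for A B
  proof -
    note VA = badV[OF A(1)] and VB = badV[OF B]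
    have DA: "D A = 8" "?s A mod 6 = 4" using A unfolding bad_def by auto
    have DB: "D B = 7 \<and> ?s B mod 6 = 5 \<or> D B = 8 \<and> ?s B mod 6 = 4" using B unfolding bad_def by auto
    have U: "A \<union> B \<subseteq> V - {x}" "A \<union> B \<noteq> {}" using VA(2,4) VB(2) by blast+
    let ?sp = "A \<union> B = V - {x} \<and> d0 = 4"
    have d2: "10 + dist6 (?s (A \<union> B) + 2) \<le> D (A \<union> B) \<or> D (A \<union> B) = 8 \<and> ?s (A \<union> B) mod 6 = 0 \<and> ?sp
        \<or> D (A \<union> B) = 9 \<and> ?s (A \<union> B) mod 6 = 5"
    proof (cases "A \<union> B = V - {x}")
      case True
      have "D (A \<union> B) = d0 + 4" unfolding True D_rest[OF x(1)] D6 dx by simp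
      moreover have "?s (A \<union> B) mod 6 = (- d0 - 2) mod 6"
        unfolding True t_rest[OF x(1)] using total_mod[OF refl x(2), where j = 0] by simp
      ultimately have "d0 = 4 \<Longrightarrow> D (A \<union> B) = 8 \<and> ?s (A \<union> B) mod 6 = 0"
        "d0 = 5 \<Longrightarrow> D (A \<union> B) = 9 \<and> ?s (A \<union> B) mod 6 = 5" by simp_all
      then show ?thesis using d True by blast
    next
      case False
      then show ?thesis using ins[OF U False] k5 by simp
    qed
    have c: "D B = 8 \<and> ?s B mod 6 = 4 \<and> ?s (A \<inter> B) mod 6 = 2 \<and> D (A \<union> B) = 8 \<and> ?sp"
      by (rule lift_sink_union5_arith[OF two[OF A(1) B] d2 _ sum_Int_Un[OF VA(1) VB(1)] DA(2) DB])
        (use boundary_submodular[OF fin mult VA(1) VB(1), of c] DA(1) in linarith)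
    \<comment> \<open>In the exceptional case both differences are single vertices with two edges to \<open>x\<close>, too
    many for the five edges at \<open>x\<close>.\<close>
    then have W: "A \<union> B = V - {x}" "D (A \<union> B) = 8" by blast+
    have ne: "A - B \<noteq> {}" "B - A \<noteq> {}"
    proof -
      have "A - B = {} \<Longrightarrow> A \<union> B = B" "B - A = {} \<Longrightarrow> A \<union> B = A" by blast+
      then show "A - B \<noteq> {}" "B - A \<noteq> {}" using W(1) VA(6) VB(6) by argo+
    qed
    have s2: "?s (A - B) mod 6 = 2" "?s (B - A) mod 6 = 2"
    proof -
      have md: "(i - j) mod 6 = 2" if "i mod 6 = 4" "j mod 6 = 2" for i j :: int using that by presburger
      have BA: "B \<inter> A = A \<inter> B" by blast
      show "?s (A - B) mod 6 = 2"
        unfolding sum_Diff_Int[OF VA(1)] by (rule md[OF DA(2)]) (use c in blast)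
      show "?s (B - A) mod 6 = 2"
        unfolding sum_Diff_Int[OF VB(1)] BA by (rule md) (use c in blast)+
    qed
    have sub: "A - B \<subseteq> V" "A - B \<noteq> V" "B - A \<subseteq> V" "B - A \<noteq> V" using VA(1,3) VB(1,3) x(1) by blast+
    have p: "D (A - B) + D (B - A) \<le> 12" using posi[OF A(1) B] DA(1) c by simp
    have n2: "dist6 (?s (A - B)) = 2" "dist6 (?s (B - A)) = 2" using s2 by (simp_all add: dist6_def)
    note dc = D_cases[OF sub(1) ne(1) sub(2)] D_cases[OF sub(3) ne(2) sub(4)]
    have six: "6 \<le> D (A - B)" "6 \<le> D (B - A)"
      using dc(1) n2(1) by (elim disjE conjE; linarith) (use dc(2) n2(2) in \<open>elim disjE conjE; linarith\<close>)
    have e6: "D (A - B) = 6" "D (B - A) = 6" using p six by linarith+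
    have "\<not> 6 + dist6 (?s (A - B)) \<le> D (A - B)" "\<not> 6 + dist6 (?s (B - A)) \<le> D (B - A)"
      using e6 n2 by linarith+
    then obtain u v where uv: "A - B = {v}" "B - A = {u}" "u \<in> V" "v \<in> V" using dc by blast
    have uv6: "D {v} = 6" "D {u} = 6" using e6 unfolding uv by simp_all
    have big: "2 \<le> w x z" if z: "z \<in> V" "D {z} = 6" "C \<subseteq> V - {x}" "z \<notin> C" "insert z C = V - {x}" "D C = 8" for z C
    proof -
      have CV: "C \<subseteq> V" using z(3) by blast
      have zx: "z \<noteq> x" "x \<notin> C" using z(3,5) by blast+
      have finC: "finite C" using CV fin finite_subset by blast
      have "8 = D (insert z C)" unfolding z(5) using W by (simp only:)
      also have "\<dots> = 8 + 6 - 2 * sum (w z) C" using D_insert[OF CV z(1) z(4)] z(2,6) by linarith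
      finally have "sum (w z) C = 3" by simp
      moreover have "sum (w z) V = w z x + sum (w z) C"
      proof -
        have "V = insert x (insert z C)" using z(5) x(1) by blast
        then have "sum (w z) V = sum (w z) (insert x (insert z C))" by (rule arg_cong)
        then show ?thesis using finC zx z(4) by (simp add: w_diag)
      qed
      ultimately show ?thesis using deg[OF z(1)] z(2) p1[OF z(1)] w_sym[of x z] by linarith
    qed
    have "2 \<le> w x v"
    proof (rule big[OF uv(4) uv6(1) VB(2)])
      show "v \<notin> B" using uv(1) by blast
      have "insert v B = A \<union> B" using uv(1) by blast
      then show "insert v B = V - {x}" using W(1) by (rule trans)
      show "D B = 8" using c by blast
    qed
    moreover have "2 \<le> w x u"
    proof (rule big[OF uv(3) uv6(2) VA(2)])
      show "u \<notin> A" using uv(2) by blast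
      have "insert u A = A \<union> B" using uv(2) by blast
      then show "insert u A = V - {x}" using W(1) by (rule trans)
      show "D A = 8" by fact
    qed
    moreover have "?k (A \<inter> B) + ?k (A \<union> B) = ?k A + ?k B" "?k (A - B) = ?k A - ?k (A \<inter> B)"
      "?k (B - A) = ?k B - ?k (A \<inter> B)"
      using sum_Int_Un[OF VA(1) VB(1)] sum_Diff_Int[OF VA(1), of "w x" B] sum_Diff_Int[OF VB(1), of "w x" A]
      by (simp_all add: Int_commute)
    moreover have "2 \<le> ?k (A \<inter> B)"
    proof -
      have "A \<inter> B \<subseteq> V" "a \<in> A \<inter> B" "b \<in> A \<inter> B" using VA(1,4,5) VB(4,5) by blast+
      then show ?thesis using kf[of "A \<inter> B"] by simp
    qed
    moreover have "?k (A - B) = w x v" "?k (B - A) = w x u" unfolding uv by simp_all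
    ultimately show False using k5 by linarith
  qed
  have k3: "?k A = 3" if A: "bad A" for A
  proof (rule ccontr)
    assume "?k A \<noteq> 3"
    then have k4: "?k A = 4" using A unfolding bad_def by auto
    have "\<exists>j\<in>set cs. j \<notin> A \<and> of_bool (c3 \<in> insert j A) + of_bool (c4 \<in> insert j A) + of_bool (c5 \<in> insert j A) = (3::int)"
      using k4 badV[OF A] unfolding kf[OF badV(1)[OF A]] cl
      by (cases "c3 \<in> A"; cases "c4 \<in> A"; cases "c5 \<in> A"; simp)
    then obtain j where j: "j \<in> set cs" "j \<notin> A"
      "of_bool (c3 \<in> insert j A) + of_bool (c4 \<in> insert j A) + of_bool (c5 \<in> insert j A) = (3::int)" by blast
    obtain B where B: "bad B" "j \<in> B" using ex[OF j(1)] by blast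
    have U: "A \<union> B \<subseteq> V" using badV[OF A] badV[OF B(1)] by auto
    have "c3 \<in> insert j A" "c4 \<in> insert j A" "c5 \<in> insert j A" using j(3) by (auto simp: of_bool_def split: if_splits)
    then have "?k (A \<union> B) = 5" unfolding kf[OF U] using badV[OF A] B by auto
    then show False using union5[OF A k4 B(1)] by blast
  qed
  obtain A where A: "bad A" "c3 \<in> A" using ex[of c3] unfolding cl by auto
  obtain B where B: "bad B" "c4 \<in> B" using ex[of c4] unfolding cl by auto
  obtain C where C: "bad C" "c5 \<in> C" using ex[of c5] unfolding cl by auto
  note VA = badV[OF A(1)] and VB = badV[OF B(1)]
  have nA: "c4 \<notin> A" "c5 \<notin> A" and nB: "c3 \<notin> B" "c5 \<notin> B"
    using k3[OF A(1)] kf[OF VA(1)] VA A(2) k3[OF B(1)] kf[OF VB(1)] VB B(2)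
    by (auto simp: of_bool_def split: if_splits)
  have U: "A \<union> B \<subseteq> V - {x}" "A \<union> B \<noteq> {}" "A \<union> B \<noteq> V - {x}" "A \<union> B \<subseteq> V"
  proof -
    show "A \<union> B \<subseteq> V - {x}" "A \<union> B \<noteq> {}" "A \<union> B \<subseteq> V" using VA(1,2,4) VB(1,2) by blast+
    have "c5 \<in> V - {x}" by (rule cV(1)) (simp add: cl)
    then show "A \<union> B \<noteq> V - {x}" using nA(2) nB(2) by blast
  qed
  have kU: "?k (A \<union> B) = 4" unfolding kf[OF U(4)] using VA VB nA nB A B by simp
  have ne: "A - B \<noteq> {}" "B - A \<noteq> {}" using A B nA nB by auto
  have sub: "A - B \<subseteq> V" "A - B \<noteq> V" "B - A \<subseteq> V" "B - A \<noteq> V" using VA(1,3) VB(1,3) x(1) by blast+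
  have d3: "tight_or_slack (D (A - B)) (?s A - ?s (A \<inter> B))" "tight_or_slack (D (B - A)) (?s B - ?s (A \<inter> B))"
    using D_tight_or_slack[OF sub(1) ne(1) sub(2)] D_tight_or_slack[OF sub(3) ne(2) sub(4)]
      sum_Diff_Int[OF VA(1), of t B] sum_Diff_Int[OF VB(1), of t A] by (auto simp: Int_commute)
  have eA: "D A = 7 \<and> ?s A mod 6 = 5 \<or> D A = 8 \<and> ?s A mod 6 = 4" and eB: "D B = 7 \<and> ?s B mod 6 = 5 \<or> D B = 8 \<and> ?s B mod 6 = 4"
    using A B unfolding bad_def by auto
  have dU: "8 + dist6 (?s (A \<union> B) + 2) \<le> D (A \<union> B)" using ins[OF U(1-3)] kU by simp
  have "D (A \<union> B) = 8 \<and> ?s (A \<union> B) mod 6 = 4"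
    by (rule lift_sink_union4_arith[OF two[OF A(1) B(1)] dU d3 boundary_submodular[OF fin mult VA(1) VB(1)]
          posi[OF A(1) B(1)] sum_Int_Un[OF VA(1) VB(1)] eA eB])
  then have "bad (A \<union> B)" unfolding bad_def using U kU VA by auto
  then show False using k3[of "A \<union> B"] kU by simp
qed

text \<open>Any vertex that receives a preoriented arc can become the sink; one with two such arcs is
preferred, because it leaves fewer arcs to be added.\<close>

lemma positive_world_orientable: goal
proof (cases "\<exists>x\<in>V. p x = 2")
  case True
  then obtain x where x: "x \<in> V" "p x = 2" by blast
  then show ?thesis
    using positive[of x] lift_sink_6[of x] plain_sink_5[of x] one_del_sink_5[of x] d0_le by linarith
next
  case False
  have p1: "p v \<le> 1" if "v \<in> V" for v
    using p_le_2[OF that] False that by (metis le_less zless_imp_add1_zle one_add_one add_le_cancel_right)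
  have "\<exists>x\<in>V. p x \<noteq> 0" by (rule ccontr) (use p_pos in simp)
  then obtain x where x: "x \<in> V" "p x = 1" using p1 p_le(2) by (metis antisym_conv int_one_le_iff_zero_less order_le_less)
  consider "d0 \<le> 3" | "d0 = 4 \<or> d0 = 5" using d0_le by linarith
  then show ?thesis
    using positive[OF x(1)] x lift_sink_6[of x] plain_sink_5[of x] two_del_sink_5[of x]
      lift_del_sink_6[OF x(1) _ p1 x(2)] by cases blast+
qed

end

section \<open>Six edges in every cut suffice\<close>

lemma Z3_connected_singleton:
  assumes "multiplicity_fun w"
  shows "Z3_connected {v} w"
  unfolding Z3_connected_def orientable_def net_orientation_def
  using assms by (auto intro!: exI[of _ "\<lambda>_ _. 0"] simp: multiplicity_fun_diag)

context admissible_step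
begin

text \<open>Without preoriented arcs, a tight vertex \<open>x\<close> takes over the role of the preoriented vertex
once its edges are oriented according to its label; tightness is exactly the degree bound required
of it.\<close>

lemma preorient_step:
  assumes x: "x \<in> V" and n: "2 \<le> card V" and z: "sum c V = 0" and tight: "D {x} = 4 + dist6 (t x)"
  shows goal
proof -
  have c0: "c v = 0" if "v \<in> V" for v
    using z sum_nonneg_eq_0_iff[OF fin, of c] pq that by (metis add_nonneg_nonneg)
  then have p0: "p v = 0" "q v = 0" if "v \<in> V" for v using pq[OF that] that by (metis add_nonneg_eq_0_iff)+
  have dx: "sum (w x) V = 4 + dist6 (t x)" using D_singleton[OF x] c0[OF x] tight by simp
  obtain j where j: "dist6 (t x) = \<bar>t x - 6 * j\<bar>" using dist6_attained by blast
  define s where "s = t x - 6 * j"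
  have "even (s - sum (w x) (V - {x}))" using dist6_parity[of "t x"] dx unfolding s_def sum_wx[OF x] by simp
  moreover have "\<bar>s\<bar> \<le> sum (w x) (V - {x})" using dx j unfolding s_def sum_wx[OF x] by simp
  ultimately obtain g where g: "\<forall>y\<in>V - {x}. \<bar>g y\<bar> \<le> w x y \<and> even (g y - w x y)" "sum g (V - {x}) = s"
    using split_sum[of "V - {x}" "w x" s] fin w_nonneg by auto
  have half: "(w x y + g y) div 2 + (w x y - g y) div 2 = w x y" "(w x y + g y) div 2 - (w x y - g y) div 2 = g y"
    "0 \<le> (w x y + g y) div 2" "0 \<le> (w x y - g y) div 2" if "y \<in> V - {x}" for y
  proof -
    have "\<bar>g y\<bar> \<le> w x y" "even (g y - w x y)" using g that by blast+
    then show "(w x y + g y) div 2 + (w x y - g y) div 2 = w x y" "(w x y + g y) div 2 - (w x y - g y) div 2 = g y"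
      "0 \<le> (w x y + g y) div 2" "0 \<le> (w x y - g y) div 2" by presburger+
  qed
  let ?p = "\<lambda>y. p y + (w x y + g y) div 2" and ?q = "\<lambda>y. q y + (w x y - g y) div 2"
  have cs: "(\<Sum>y\<in>A. ?p y + ?q y) = sum c A + sum (w x) A" if "A \<subseteq> V - {x}" for A
    unfolding sum.distrib[symmetric] by (rule sum.cong[OF refl]) (use half(1) that in force)
  have T6: "sum t V mod 6 = 0"
  proof -
    have "even (sum c V - sum t V)" using D_parity[of V] unfolding D_V by simp
    then have e: "even (sum t V)" using z by simp
    have "(\<Sum>v\<in>V. t v + p v - q v) = sum t V" by (rule sum.cong[OF refl]) (simp add: p0)
    then have "3 dvd sum t V" using T3 by (simp only:)
    moreover have "3 dvd a \<Longrightarrow> even a \<Longrightarrow> a mod 6 = 0" for a :: int by presburger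
    ultimately show ?thesis using e by blast
  qed
  have nr: "dist6 (sum t (V - {x})) = dist6 (t x)"
  proof -
    have "sum t (V - {x}) = sum t V - t x" using sum.remove[OF fin x, of t] by simp
    moreover have "(a - b) mod 6 = (- b) mod 6" if "a mod 6 = 0" for a b :: int
      using mod_diff_left_eq[of a 6 b] that by simp
    ultimately have "sum t (V - {x}) mod 6 = (- t x) mod 6" using T6 by simp
    then show ?thesis using dist6_cong[of _ "- t x"] dist6_uminus by metis
  qed
  show goal
  proof (rule remove_step[OF x n mult, of "\<lambda>_. 0" g ?p ?q t])
    fix A assume A: "A \<subseteq> V - {x}"
    show "cut w A (V - {x} - A) = cut w A (V - A) - sum (w x) A + 0" using cut_remove[OF x A] by simp
    assume "A \<noteq> {}" "A \<noteq> V - {x}"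
    have "A \<subseteq> V" "A \<noteq> V" using A x by blast+
    then show "4 + dist6 (sum t A) \<le> D A - sum (w x) A + 0 + (\<Sum>y\<in>A. ?p y + ?q y) - sum c A"
      unfolding cs[OF A] using low \<open>A \<noteq> {}\<close> by simp
  next
    show "(\<Sum>y\<in>V - {x}. ?p y + ?q y) \<le> 4 + dist6 (sum t (V - {x}))"
      unfolding cs[OF order.refl] sum_wx[OF x] dx nr using z sum.remove[OF fin x, of c] c0[OF x] by simp
    assume "orientable (V - {x}) w (\<lambda>y. t y + p y - q y + g y)"
    then show goal
      using orientable_drop_vertex[OF fin x mult g(1), of "\<lambda>v. t v + p v - q v"] p0[OF x]
      unfolding g(2) s_def by simp
  next
    show "3 dvd (t x + p x - q x - sum g (V - {x}))" unfolding g(2) s_def using p0[OF x] by simp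
  next
    fix y assume y: "y \<in> V - {x}"
    show "0 \<le> ?p y \<and> 0 \<le> ?q y \<and> t y + ?p y - ?q y = t y + p y - q y + g y"
      using half[OF y] pq[of y] y by auto
    have "t y - (D {y} - w x y + 0 + (?p y + ?q y) - c y) = t y - D {y}" using half(1)[OF y] by simp
    moreover have "even (t y - D {y})" using par y by blast
    ultimately show "even (t y - (D {y} - w x y + 0 + (?p y + ?q y) - c y))" by (simp only:)
  qed
qed

context
  fixes x
  assumes n3: "3 \<le> card V"
    and slack: "\<And>A. A \<subseteq> V \<Longrightarrow> 2 \<le> card A \<Longrightarrow> A \<noteq> V \<Longrightarrow> 6 + dist6 (sum t A) \<le> D A"
    and x: "x \<in> V" and D4: "D {x} = 4" and t6: "t x mod 6 = 0"
begin

lemma zero_nrm: "dist6 (a + t x) = dist6 a" "dist6 (a - t x) = dist6 a"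
  using t6 by (auto intro!: dist6_cong) presburger+

lemma zero_insert_slack:
  assumes A: "A \<subseteq> V - {x}" "A \<noteq> {}" "A \<noteq> V - {x}"
  shows "6 + dist6 (sum t A) \<le> D A + 4 - 2 * sum (w x) A"
proof -
  have finA: "finite A" using A fin finite_subset by blast
  have xA: "x \<notin> A" "A \<subseteq> V" using A by blast+
  then have "card (insert x A) = Suc (card A)" using finA by simp
  moreover have "card A \<noteq> 0" using finA A by auto
  ultimately have "2 \<le> card (insert x A)" by linarith
  moreover have "insert x A \<noteq> V" using A xA by blast
  moreover have "insert x A \<subseteq> V" using xA x by blast
  ultimately have "6 + dist6 (sum t (insert x A)) \<le> D (insert x A)" using slack by blast
  moreover have "sum t (insert x A) = sum t A + t x" using xA(1) finA by simp
  ultimately show ?thesis using D_insert[OF xA(2) x xA(1)] zero_nrm(1)[of "sum t A"] D4 by simp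
qed

text \<open>Two preoriented arcs at \<open>x\<close> would leave at most two edges from \<open>x\<close> to the rest, so the rest
would have a boundary too small for its slack.\<close>

lemma zero_arcs: "c x \<le> 1"
proof -
  have "card (V - {x}) = card V - 1" using fin x by simp
  then have "6 + dist6 (sum t (V - {x})) \<le> D (V - {x})" using n3 x by (intro slack) auto
  moreover have "sum t (V - {x}) = sum t V - t x" using sum.remove[OF fin x, of t] by simp
  moreover have "sum c V = D (V - {x}) + 4 - 2 * (4 - c x)"
    using D_insert[of "V - {x}" x] x D_singleton[OF x] D4 by (simp add: D_V insert_absorb sum_wx)
  ultimately show ?thesis using up zero_nrm(2)[of "sum t V"] by simp
qed

lemma rest_bound: "sum c (V - {x}) + c x \<le> 4 + dist6 (sum t (V - {x}))"
  using up zero_nrm(2)[of "sum t V"] sum.remove[OF fin x, of t] sum.remove[OF fin x, of c] by (simp add: algebra_simps)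

text \<open>A vertex of degree 4 with label 0 is removed by lifting its edges in two pairs.  A set that
loses edges in this way contains two or more neighbours of \<open>x\<close>, and \<open>zero_insert_slack\<close> compensates
for the loss.\<close>

lemma zero_step_0:
  assumes c0: "p x = 0" "q x = 0"
  shows goal
proof -
  have "sum (w x) V = int 4" using D_singleton[OF x] D4 c0 by simp
  moreover have "\<forall>y\<in>V. 0 \<le> w x y" using w_nonneg by blast
  ultimately obtain ys where ys: "length ys = 4" "\<And>y. y \<in> V \<Longrightarrow> w x y = (\<Sum>z\<leftarrow>ys. of_bool (y = z))"
    "\<And>A. A \<subseteq> V \<Longrightarrow> sum (w x) A = (\<Sum>z\<leftarrow>ys. of_bool (z \<in> A))" "\<And>z. z \<in> set ys \<Longrightarrow> z \<in> V \<and> 1 \<le> w x z"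
    using neighbour_list by metis
  obtain a b d e where yl: "ys = [a, b, d, e]" using ys(1) by (auto simp: numeral_eq_Suc length_Suc_conv)
  have yV: "z \<in> V - {x}" if "z \<in> set ys" for z using ys(4)[OF that] w_diag[of x] by auto
  have abde: "a \<in> V - {x}" "b \<in> V - {x}" "d \<in> V - {x}" "e \<in> V - {x}" using yV unfolding yl by simp_all
  have wy: "w x y = of_bool (y = a) + of_bool (y = b) + of_bool (y = d) + of_bool (y = e)" if "y \<in> V" for y
    using ys(2)[OF that] unfolding yl by simp
  have kf: "sum (w x) A = of_bool (a \<in> A) + of_bool (b \<in> A) + of_bool (d \<in> A) + of_bool (e \<in> A)"
    if "A \<subseteq> V" for A
    using ys(3)[OF that] unfolding yl by simp
  let ?w1 = "\<lambda>u v. w u v - edge x a u v - edge x b u v + edge a b u v"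
  let ?w = "\<lambda>u v. w u v + edge a b u v + edge d e u v"
  have m1: "multiplicity_fun ?w1"
    by (rule multiplicity_fun_lift[OF mult]) (use abde wy in auto)
  have w1x: "?w1 x y = of_bool (y = d) + of_bool (y = e)" if "y \<in> V" for y
    using wy[OF that] abde by (auto simp: edge_def)
  let ?l = "\<lambda>A. of_bool ((a \<in> A) \<noteq> (b \<in> A)) + of_bool ((d \<in> A) \<noteq> (e \<in> A)) :: int"
  show goal
  proof (rule remove_step[where w' = ?w and l = ?l and g = "\<lambda>_. 0" and p' = p and q' = q and t' = t, OF x])
    show "multiplicity_fun ?w" by (rule multiplicity_fun_add_edge[OF multiplicity_fun_add_edge[OF mult]])
    show "2 \<le> card V" using n3 by simp
    fix A assume A: "A \<subseteq> V - {x}"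
    have finA: "finite A" using A fin finite_subset by blast
    have AV: "A \<subseteq> V" using A by blast
    have "cut (edge a b) A (V - {x} - A) = of_bool ((a \<in> A) \<noteq> (b \<in> A))"
      "cut (edge d e) A (V - {x} - A) = of_bool ((d \<in> A) \<noteq> (e \<in> A))"
      by (rule cut_edge; use finA fin abde A in auto)+
    then show "cut ?w A (V - {x} - A) = cut w A (V - A) - sum (w x) A + ?l A"
      unfolding cut_add using cut_remove[OF x A] by simp
    assume A': "A \<noteq> {}" "A \<noteq> V - {x}"
    have "A \<noteq> V" using A x by blast
    then have "4 + dist6 (sum t A) \<le> D A" using low AV A' by blast
    then show "4 + dist6 (sum t A) \<le> D A - sum (w x) A + ?l A + (\<Sum>y\<in>A. p y + q y) - sum c A"
      using zero_insert_slack[OF A A'] unfolding kf[OF AV]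
      by (cases "a \<in> A"; cases "b \<in> A"; cases "d \<in> A"; cases "e \<in> A"; simp)
  next
    show "3 dvd (t x + p x - q x - (\<Sum>y\<in>V - {x}. 0))" using c0 t6 by simp presburger
    show "(\<Sum>y\<in>V - {x}. p y + q y) \<le> 4 + dist6 (sum t (V - {x}))" using rest_bound c0 by simp
  next
    assume o: "orientable (V - {x}) ?w (\<lambda>y. t y + p y - q y + 0)"
    show goal
    proof (rule orientable_lift[OF fin mult x, of a b])
      show "orientable V ?w1 (\<lambda>v. t v + p v - q v)"
      proof (rule orientable_remove_lift[OF fin m1 x abde(3,4), of "\<lambda>_. 0"])
        show "\<forall>y\<in>V - {x}. \<bar>0\<bar> \<le> ?w1 x y - of_bool (y = d) - of_bool (y = e)
            \<and> even (0 - (?w1 x y - of_bool (y = d) - of_bool (y = e)))" using w1x by simp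
        show "3 dvd (t x + p x - q x - (\<Sum>y\<in>V - {x}. 0))" using c0 t6 by simp presburger
        show "orientable (V - {x}) (\<lambda>u v. ?w1 u v + edge d e u v) (\<lambda>y. t y + p y - q y + 0)"
          using o by (subst orientable_cong[of _ _ ?w]) (auto simp: edge_def)
      qed
    qed (use abde in auto)
  next
    fix y assume y: "y \<in> V - {x}"
    show "0 \<le> p y \<and> 0 \<le> q y \<and> t y + p y - q y = t y + p y - q y + 0" using pq y by simp
    have "even (w x y - ?l {y})" using wy[of y] y by auto
    moreover have "even (t y - D {y})" using par y by simp
    moreover have "t y - (D {y} - w x y + ?l {y} + (p y + q y) - c y) = (t y - D {y}) + (w x y - ?l {y})" by simp
    ultimately show "even (t y - (D {y} - w x y + ?l {y} + (p y + q y) - c y))" by (metis dvd_add)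
  qed
qed

text \<open>The fourth edge is a preoriented arc, which is passed on to the third neighbour while the
other two edges are lifted.\<close>

lemma zero_step_1:
  assumes c1: "p x = 1" "q x = 0"
  shows goal
proof -
  have "sum (w x) V = int 3" using D_singleton[OF x] D4 c1 by simp
  moreover have "\<forall>y\<in>V. 0 \<le> w x y" using w_nonneg by blast
  ultimately obtain ys where ys: "length ys = 3" "\<And>y. y \<in> V \<Longrightarrow> w x y = (\<Sum>z\<leftarrow>ys. of_bool (y = z))"
    "\<And>A. A \<subseteq> V \<Longrightarrow> sum (w x) A = (\<Sum>z\<leftarrow>ys. of_bool (z \<in> A))" "\<And>z. z \<in> set ys \<Longrightarrow> z \<in> V \<and> 1 \<le> w x z"
    using neighbour_list by metis
  obtain a b d where yl: "ys = [a, b, d]" using ys(1) by (auto simp: numeral_eq_Suc length_Suc_conv)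
  have yV: "z \<in> V - {x}" if "z \<in> set ys" for z using ys(4)[OF that] w_diag[of x] by auto
  have abd: "a \<in> V - {x}" "b \<in> V - {x}" "d \<in> V - {x}" using yV unfolding yl by simp_all
  have wy: "w x y = of_bool (y = a) + of_bool (y = b) + of_bool (y = d)" if "y \<in> V" for y
    using ys(2)[OF that] unfolding yl by simp
  have kf: "sum (w x) A = of_bool (a \<in> A) + of_bool (b \<in> A) + of_bool (d \<in> A)" if "A \<subseteq> V" for A
    using ys(3)[OF that] unfolding yl by simp
  let ?g = "\<lambda>y. of_bool (y = d) :: int" and ?l = "\<lambda>A. of_bool ((a \<in> A) \<noteq> (b \<in> A)) :: int"
  let ?p = "\<lambda>y. p y + ?g y"
  have sg: "sum ?g A = of_bool (d \<in> A)" if "A \<subseteq> V - {x}" for A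
    using finite_subset[OF that] fin by (simp add: of_bool_def)
  have sp: "(\<Sum>y\<in>A. ?p y + q y) = sum c A + of_bool (d \<in> A)" if "A \<subseteq> V - {x}" for A
    using sg[OF that] by (simp add: sum.distrib)
  show goal
  proof (rule remove_step[OF x _ multiplicity_fun_add_edge[OF mult], of a b ?l ?g ?p q t])
    show "2 \<le> card V" using n3 by simp
    fix A assume A: "A \<subseteq> V - {x}"
    have finA: "finite A" using A fin finite_subset by blast
    have AV: "A \<subseteq> V" using A by blast
    have "cut (edge a b) A (V - {x} - A) = of_bool ((a \<in> A) \<noteq> (b \<in> A))"
      by (rule cut_edge; use finA fin abd A in auto)
    then show "cut (\<lambda>u v. w u v + edge a b u v) A (V - {x} - A) = cut w A (V - A) - sum (w x) A + ?l A"
      unfolding cut_add using cut_remove[OF x A] by simp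
    assume A': "A \<noteq> {}" "A \<noteq> V - {x}"
    have "A \<noteq> V" using A x by blast
    then have "4 + dist6 (sum t A) \<le> D A" using low AV A' by blast
    then show "4 + dist6 (sum t A) \<le> D A - sum (w x) A + ?l A + (\<Sum>y\<in>A. ?p y + q y) - sum c A"
      using zero_insert_slack[OF A A'] unfolding sp[OF A] kf[OF AV]
      by (cases "a \<in> A"; cases "b \<in> A"; cases "d \<in> A"; simp)
  next
    show T: "3 dvd (t x + p x - q x - sum ?g (V - {x}))" using sg[OF order.refl] abd c1 t6 by simp presburger
    show "(\<Sum>y\<in>V - {x}. ?p y + q y) \<le> 4 + dist6 (sum t (V - {x}))"
      unfolding sp[OF order.refl] using rest_bound c1 abd by simp
    assume o: "orientable (V - {x}) (\<lambda>u v. w u v + edge a b u v) (\<lambda>y. t y + p y - q y + ?g y)"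
    show goal
      by (rule orientable_remove_lift[OF fin mult x abd(1,2), of ?g]) (use wy T o in auto)
  next
    fix y assume y: "y \<in> V - {x}"
    show "0 \<le> ?p y \<and> 0 \<le> q y \<and> t y + ?p y - q y = t y + p y - q y + ?g y" using pq y by simp
    have "even (w x y - ?l {y} - ?g y)" using wy[of y] y by auto
    moreover have "even (t y - D {y})" using par y by simp
    moreover have "t y - (D {y} - w x y + ?l {y} + (?p y + q y) - c y) = (t y - D {y}) + (w x y - ?l {y} - ?g y)" by simp
    ultimately show "even (t y - (D {y} - w x y + ?l {y} + (?p y + q y) - c y))" by (metis dvd_add)
  qed
qed

end

lemma two_vertices: 
  assumes "card V = 2"
  shows goal
proof -
  obtain x y where V: "V = {x, y}" "x \<noteq> y" using assms by (auto simp: card_2_iff)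
  have Dx: "D {x} = w x y + c x" "D {y} = w x y + c y"
    using D_singleton[of x] D_singleton[of y] V w_diag w_sym[of y x] by simp_all
  have "4 + dist6 (t x) \<le> D {x}" "4 + dist6 (t y) \<le> D {y}" using low[of "{x}"] low[of "{y}"] V by auto
  moreover have "c x + c y \<le> 4 + dist6 (t x + t y)" using up V by simp
  ultimately have w2: "2 \<le> w x y" using dist6_add[of "t x" "t y"] Dx by linarith
  have Vx: "V - {x} = {y}" using V by auto
  have "Z3_connected V w"
    by (rule Z3_connected_drop_vertex[OF fin _ mult, of x]) (use V w2 Vx Z3_connected_singleton[OF mult] in auto)
  then show goal using T3 unfolding Z3_connected_def by blast
qed

lemma one_vertex:
  assumes "card V = 1"
  shows goal
proof -
  obtain v where V: "V = {v}" using assms by (rule card_1_singletonE)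
  then show goal using T3 Z3_connected_singleton[OF mult, of v] unfolding Z3_connected_def by blast
qed

text \<open>In a labelling to which no reduction applies, every vertex permits the deletion of outgoing
arcs only (\<open>dn\<close>) or of incoming arcs only (\<open>up\<close>), and no edge joins the two kinds.  The degree bound
of the preoriented vertex then rules out that both kinds occur.\<close>

lemma admissible_step_orientable: goal
proof (rule ccontr)
  assume ng: "\<not> goal"
  have "card V \<noteq> 0" using fin ne by simp
  then have n3: "3 \<le> card V" using one_vertex two_vertices ng by (metis One_nat_def Suc_1 Suc_leI less_one linorder_neqE_nat not_less_eq numeral_3_eq_3 le_less_Suc_eq not_le)
  have slack: "6 + dist6 (sum t A) \<le> D A" if A: "A \<subseteq> V" "2 \<le> card A" "A \<noteq> V" for A
  proof -
    have "\<not> D A \<le> 4 + dist6 (sum t A)" using contract_step A ng by blast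
    moreover have "even (d - a) \<Longrightarrow> even (n - a) \<Longrightarrow> \<not> d \<le> 4 + n \<Longrightarrow> 6 + n \<le> d" for a d n :: int by presburger
    ultimately show ?thesis using D_parity[OF A(1)] dist6_parity[of "sum t A"] by blast
  qed
  have low1: "4 + dist6 (t v) \<le> D {v}" if "v \<in> V" for v
    using low[of "{v}"] that n3 by fastforce
  have no_zero: "\<not> (D {x} = 4 \<and> t x mod 6 = 0)" if x: "x \<in> V" for x
  proof
    assume a: "D {x} = 4 \<and> t x mod 6 = 0"
    have "c x \<le> 1" using zero_arcs[OF n3 slack x] a by blast
    then consider "p x = 0" "q x = 0" | "p x = 1" "q x = 0" | "p x = 0" "q x = 1" using pq[OF x] by linarith
    then show False
    proof cases
      case 1
      then show False using zero_step_0[OF n3 slack x] a ng by blast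
    next
      case 2
      then show False using zero_step_1[OF n3 slack x] a ng by blast
    next
      case 3
      interpret neg: admissible_step V w "\<lambda>v. - t v" q p by (rule admissible_step_uminus)
      have eq: "(\<lambda>v. q v + p v) = c" by (simp add: add.commute)
      have "orientable V w (\<lambda>v. - t v + q v - p v)"
        by (rule neg.zero_step_1[OF n3 _ x, unfolded eq])
          (use slack 3 a in \<open>auto simp: sum_negf dist6_uminus\<close>)
      then have "orientable V w (\<lambda>v. - (- t v + q v - p v))" by (rule orientable_uminus)
      moreover have "(\<lambda>v. - (- t v + q v - p v)) = (\<lambda>v. t v + p v - q v)" by auto
      ultimately show False using ng by simp
    qed
  qed
  define up where "up v \<longleftrightarrow> 5 + dist6 (t v + 1) \<le> D {v}" for v
  define dn where "dn v \<longleftrightarrow> 5 + dist6 (t v - 1) \<le> D {v}" for v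
  have kind: "up v \<and> dn v \<or> \<not> up v \<and> dn v \<and> D {v} = 4 + dist6 (t v) \<and> (t v mod 6 = 1 \<or> t v mod 6 = 2)
      \<or> up v \<and> \<not> dn v \<and> D {v} = 4 + dist6 (t v) \<and> (t v mod 6 = 4 \<or> t v mod 6 = 5)" if v: "v \<in> V" for v
  proof -
    have "even (D {v} - t v)" using D_parity[of "{v}"] v by simp
    moreover have "even (d - a) \<Longrightarrow> even (n - a) \<Longrightarrow> 4 + n \<le> d \<Longrightarrow> 6 + n \<le> d \<or> d = 4 + n" for a d n :: int by presburger
    ultimately have "6 + dist6 (t v) \<le> D {v} \<or> D {v} = 4 + dist6 (t v)" using low1[OF v] dist6_parity[of "t v"] by blast
    then show ?thesis
    proof
      assume "6 + dist6 (t v) \<le> D {v}"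
      then show ?thesis unfolding up_def dn_def using dist6_step[of "t v"] by linarith
    next
      assume eq: "D {v} = 4 + dist6 (t v)"
      obtain r where r: "r = t v mod 6" "r \<in> {0,1,2,3,4,5}" using residue_cases by blast
      have n: "dist6 (t v) = dist6 r" "dist6 (t v + 1) = dist6 (r + 1)" "dist6 (t v - 1) = dist6 (r - 1)"
        unfolding r(1) by (rule dist6_cong; simp add: mod_simps)+
      have "r \<noteq> 0" using no_zero[OF v] eq r n by (auto simp: dist6_def)
      then show ?thesis unfolding up_def dn_def eq n r(1)[symmetric] using r(2)
        by (elim insertE emptyE; simp add: dist6_def)
    qed
  qed
  have edge: "\<not> (dn x \<and> up y)" if "x \<in> V" "y \<in> V" "x \<noteq> y" "1 \<le> w x y" for x y
    using delete_edge_step[OF that _ _ slack] ng unfolding up_def dn_def by blast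
  have parc: "\<not> up x" if "x \<in> V" "1 \<le> p x" for x
    using delete_in_arc_step[OF that _ slack] ng unfolding up_def by blast
  have qarc: "\<not> dn x" if x: "x \<in> V" "1 \<le> q x" for x
  proof
    assume d: "dn x"
    interpret neg: admissible_step V w "\<lambda>v. - t v" q p by (rule admissible_step_uminus)
    have eq: "(\<lambda>v. q v + p v) = c" by (simp add: add.commute)
    have "dist6 (- t x + 1) = dist6 (t x - 1)" using dist6_uminus[of "t x - 1"] by simp
    then have "orientable V w (\<lambda>v. - t v + q v - p v)"
      by (intro neg.delete_in_arc_step[OF x, unfolded eq])
        (use slack d in \<open>auto simp: sum_negf dist6_uminus dn_def\<close>)
    then have "orientable V w (\<lambda>v. - (- t v + q v - p v))" by (rule orientable_uminus)
    moreover have "(\<lambda>v. - (- t v + q v - p v)) = (\<lambda>v. t v + p v - q v)" by auto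
    ultimately show False using ng by simp
  qed
  have one: "up v \<noteq> dn v" if v: "v \<in> V" for v
  proof
    assume "up v = dn v"
    then have ud: "up v" "dn v" using kind[OF v] by auto
    have "p v = 0" "q v = 0" using parc[OF v] qarc[OF v] ud pq[OF v] by linarith+
    moreover have "w v y = 0" if y: "y \<in> V" for y
    proof (rule ccontr)
      assume "w v y \<noteq> 0"
      then have w1: "1 \<le> w v y" "1 \<le> w y v" "v \<noteq> y" using w_nonneg[of v y] w_sym[of v y] w_diag[of v] by auto
      have "up y \<or> dn y" using kind[OF y] by auto
      then show False using edge[OF v y w1(3,1)] edge[OF y v _ w1(2)] w1(3) ud by auto
    qed
    ultimately have "D {v} = 0" using D_singleton[OF v] by simp
    then show False using low1[OF v] dist6_nonneg[of "t v"] by simp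
  qed
  define P where "P = {v\<in>V. dn v}"
  define M where "M = {v\<in>V. up v}"
  have PM: "P \<union> M = V" "P \<inter> M = {}" "P \<subseteq> V" "M \<subseteq> V" unfolding P_def M_def using one by blast+
  have tightV: "D {v} = 4 + dist6 (t v)" if "v \<in> V" for v using kind[OF that] one[OF that] by blast
  have cut0: "cut w P M = 0"
  proof -
    have "w u v = 0" if "u \<in> P" "v \<in> M" for u v
    proof (rule ccontr)
      assume "w u v \<noteq> 0"
      then have "1 \<le> w u v" "u \<noteq> v" using w_nonneg[of u v] w_diag[of u] by auto
      then show False using edge[of u v] that unfolding P_def M_def by blast
    qed
    then show ?thesis unfolding cut_def by simp
  qed
  show False
  proof (cases "P = {} \<or> M = {}")
    case False
    have "P \<noteq> V" "M \<noteq> V" "P \<noteq> {}" "M \<noteq> {}" using PM False by blast+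
    then have "4 + dist6 (sum t P) \<le> D P" "4 + dist6 (sum t M) \<le> D M" using PM(3,4) low by blast+
    moreover have "D P + D M = sum c V"
      using boundary_Un[OF fin mult PM(3,4,2), of c] cut0 unfolding PM(1) D_V by simp
    ultimately show False using up dist6_nonneg[of "sum t P"] dist6_nonneg[of "sum t M"] dist6_le[of "sum t V"]
      using \<open>sum c V \<le> 4 + dist6 (sum t V)\<close> by linarith
  next
    case PM0: True
    show False
    proof (cases "sum c V = 0")
      case True
      obtain x where x: "x \<in> V" using ne by blast
      then show False using preorient_step[OF x _ True tightV[OF x]] n3 ng by simp
    next
      case False
      have c0: "0 \<le> sum c V" using pq by (intro sum_nonneg) auto
      consider "M = {}" | "P = {}" using PM0 by blast
      then show False
      proof cases
        case 1
        then have dn: "dn v" "\<not> up v" if "v \<in> V" for v using that PM one[OF that] unfolding M_def P_def by auto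
        have q0: "q v = 0" if "v \<in> V" for v using qarc[OF that] dn[OF that] pq[OF that] by linarith
        have "sum c V = sum p V" using q0 by (intro sum.cong) auto
        then interpret positive_world V w t p q
          using n3 slack tightV kind dn q0 False c0 by unfold_locales auto
        show False using positive_world_orientable ng by blast
      next
        case 2
        then have dn: "up v" "\<not> dn v" if "v \<in> V" for v using that PM one[OF that] unfolding M_def P_def by auto
        have p0: "p v = 0" if "v \<in> V" for v using parc[OF that] dn[OF that] pq[OF that] by linarith
        have s: "sum c V = sum q V" using p0 by (intro sum.cong) auto
        interpret neg: admissible_step V w "\<lambda>v. - t v" q p by (rule admissible_step_uminus)
        have eq: "(\<lambda>v. q v + p v) = c" by (simp add: add.commute)
        have md: "t v mod 6 = 4 \<or> t v mod 6 = 5 \<Longrightarrow> (- t v) mod 6 = 1 \<or> (- t v) mod 6 = 2" for v by presburger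
        interpret neg: positive_world V w "\<lambda>v. - t v" q p
        proof (unfold_locales, unfold eq)
          fix v assume v: "v \<in> V"
          show "D {v} = 4 + dist6 (- t v)" using tightV[OF v] by (simp add: dist6_uminus)
          show "(- t v) mod 6 = 1 \<or> (- t v) mod 6 = 2" using kind[OF v] dn[OF v] md by blast
          show "p v = 0" by (rule p0[OF v])
        next
          fix A assume "A \<subseteq> V" "2 \<le> card A" "A \<noteq> V"
          then show "6 + dist6 (\<Sum>v\<in>A. - t v) \<le> D A" using slack by (simp add: sum_negf dist6_uminus)
        qed (use n3 s False c0 in auto)
        have "orientable V w (\<lambda>v. - (- t v + q v - p v))"
          by (rule orientable_uminus) (rule neg.positive_world_orientable)
        moreover have "(\<lambda>v. - (- t v + q v - p v)) = (\<lambda>v. t v + p v - q v)" by auto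
        ultimately show False using ng by simp
      qed
    qed
  qed
qed

end

text \<open>The theorem of Lovasz, Thomassen, Wu and Zhang in the form in which the induction runs.\<close>

theorem admissible_orientable:
  fixes V :: "'v set"
  assumes "admissible V w t p q"
  shows "orientable V w (\<lambda>v. t v + p v - q v)"
  using assms
proof (induction "(card V, nat (total V w p q))" arbitrary: V w t p q rule: wf_induct_rule[OF wf_lex_prod[OF wf_less wf_less]])
  case 1
  interpret admissible_step V w t p q
  proof
    show "admissible V w t p q" by fact
    fix V' :: "'v set" and w' t' p' q'
    assume a: "admissible V' w' t' p' q'"
      and c: "card V' < card V \<or> card V' = card V \<and> total V' w' p' q' < total V w p q"
    have "0 \<le> total V' w' p' q'"
      using a unfolding total_def admissible_def by (auto intro!: add_nonneg_nonneg sum_nonneg cut_nonneg)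
    then have "((card V', nat (total V' w' p' q')), (card V, nat (total V w p q))) \<in> {(x, y). x < y} <*lex*> {(x, y). x < y}"
      using c by auto
    then show "orientable V' w' (\<lambda>v. t' v + p' v - q' v)" using 1(1) a by blast
  qed
  show ?case by (rule admissible_step_orientable)
qed

section \<open>Many edges across every partition suffice\<close>

text \<open>Every edge between different parts is counted twice, once for each of its two orderings.\<close>

definition crossing_sum :: "('v \<Rightarrow> 'v \<Rightarrow> int) \<Rightarrow> 'v set \<Rightarrow> 'v set set \<Rightarrow> int" where
  "crossing_sum w V R = (\<Sum>(u, v) | u \<in> V \<and> v \<in> V \<and> \<not> (\<exists>A\<in>R. u \<in> A \<and> v \<in> A). w u v)"

text \<open>Since \<open>crossing_sum\<close> counts edges twice, this demands \<open>4 * (card R - 1)\<close> edges across \<open>R\<close>, as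
in a graph with four edge-disjoint spanning trees.\<close>

definition dense :: "'v set \<Rightarrow> ('v \<Rightarrow> 'v \<Rightarrow> int) \<Rightarrow> bool" where
  "dense V w \<longleftrightarrow> (\<forall>R. partition_on V R \<longrightarrow> 8 * (int (card R) - 1) \<le> crossing_sum w V R)"

lemma cut_pairs: "cut w A B = (\<Sum>(u, v)\<in>A \<times> B. w u v)"
  unfolding cut_def by (simp add: sum.cartesian_product)

lemma partition_finite:
  assumes "finite V" "partition_on V R"
  shows "finite R" "A \<in> R \<Longrightarrow> finite A" "A \<in> R \<Longrightarrow> A \<subseteq> V" "A \<in> R \<Longrightarrow> A \<noteq> {}"
  using assms finite_elements[OF assms] by (auto simp: partition_on_def intro: finite_subset)

lemma partition_sum:
  assumes "finite V" "partition_on V R"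
  shows "(\<Sum>A\<in>R. sum f A) = (sum f V :: int)"
proof -
  have "sum f (\<Union>R) = (\<Sum>A\<in>R. sum f A)"
    using partition_finite[OF assms] assms(2) by (intro sum.Union_disjoint[unfolded o_def]) (auto simp: partition_on_def disjoint_def)
  then show ?thesis using assms(2) by (simp add: partition_on_def)
qed

lemma partition_card_sum:
  assumes "finite V" "partition_on V R"
  shows "(\<Sum>A\<in>R. int (card A)) = int (card V)"
  using partition_sum[OF assms, of "\<lambda>_. 1"] by simp

lemma crossing_sum_eq:
  assumes fin: "finite V" and R: "partition_on V R"
  shows "crossing_sum w V R = cut w V V - (\<Sum>A\<in>R. cut w A A)"
proof -
  let ?C = "{(u, v). u \<in> V \<and> v \<in> V \<and> \<not> (\<exists>A\<in>R. u \<in> A \<and> v \<in> A)}" and ?I = "\<Union>A\<in>R. A \<times> A"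
  have sub: "?I \<subseteq> V \<times> V" using partition_finite(3)[OF fin R] by blast
  have VV: "V \<times> V = ?C \<union> ?I" using sub by auto
  have finVV: "finite (V \<times> V)" using fin by simp
  have "(\<Sum>(u, v)\<in>V \<times> V. w u v) = (\<Sum>(u, v)\<in>?C. w u v) + (\<Sum>(u, v)\<in>?I. w u v)"
    unfolding VV by (rule sum.union_disjoint) (use finVV VV sub in \<open>auto intro: finite_subset\<close>)
  moreover have "(\<Sum>(u, v)\<in>?I. w u v) = (\<Sum>A\<in>R. \<Sum>(u, v)\<in>A \<times> A. w u v)"
  proof (rule sum.UNION_disjoint)
    show "finite R" "\<forall>A\<in>R. finite (A \<times> A)" using partition_finite[OF fin R] by auto
    show "\<forall>A\<in>R. \<forall>B\<in>R. A \<noteq> B \<longrightarrow> (A \<times> A) \<inter> (B \<times> B) = {}"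
      using R unfolding partition_on_def disjoint_def by blast
  qed
  ultimately show ?thesis unfolding crossing_sum_def cut_pairs by simp
qed

lemma crossing_sum_cuts:
  assumes fin: "finite V" and R: "partition_on V R"
  shows "crossing_sum w V R = (\<Sum>A\<in>R. cut w A (V - A))"
proof -
  have "cut w V V = (\<Sum>A\<in>R. cut w A V)" unfolding cut_def by (rule partition_sum[OF fin R, symmetric])
  also have "\<dots> = (\<Sum>A\<in>R. cut w A A + cut w A (V - A))"
  proof (rule sum.cong[OF refl])
    fix A assume "A \<in> R"
    then have "A \<subseteq> V" "finite A" using partition_finite[OF fin R] by blast+
    then show "cut w A V = cut w A A + cut w A (V - A)"
      using cut_Un_right[of A "V - A" w A] fin by (simp add: Un_absorb1)
  qed
  finally show ?thesis using crossing_sum_eq[OF fin R, of w] by (simp add: sum.distrib)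
qed

lemma crossing_sum_nonneg: "multiplicity_fun w \<Longrightarrow> 0 \<le> crossing_sum w V R"
  unfolding crossing_sum_def by (rule sum_nonneg) (simp add: case_prod_beta multiplicity_fun_nonneg)

lemma partition_singletons: "partition_on V ((\<lambda>v. {v}) ` V)"
  unfolding partition_on_def disjoint_def by auto

lemma dense_contract:
  assumes fin: "finite V" and w: "multiplicity_fun w" and X: "X \<subseteq> V" "r \<in> X" and V: "dense V w"
  shows "dense (insert r (V - X)) (contract X r w)"
  unfolding dense_def
proof (intro allI impI)
  let ?V = "insert r (V - X)" and ?w = "contract X r w"
  fix R assume R: "partition_on ?V R"
  define E where "E A = (if r \<in> A then A - {r} \<union> X else A)" for A
  have fin': "finite ?V" using fin by simp
  have RV: "A \<subseteq> ?V" "A \<noteq> {}" if "A \<in> R" for A using partition_finite[OF fin' R] that by blast+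
  have mem: "v \<in> E A \<longleftrightarrow> (if v \<in> X then r \<in> A else v \<in> A)" if "A \<in> R" for v A
    using RV[OF that] X unfolding E_def by auto
  have inj: "A = B" if "A \<in> R" "B \<in> R" "E A = E B" for A B
  proof -
    have "v \<in> A \<longleftrightarrow> v \<in> B" for v
      using mem[OF that(1), of v] mem[OF that(2), of v] mem[OF that(1), of r] mem[OF that(2), of r]
        that(3) X RV[OF that(1)] RV[OF that(2)] by (cases "v \<in> X") auto
    then show ?thesis by blast
  qed
  have injE: "inj_on E R" using inj by (rule inj_onI)
  have EV: "partition_on V (E ` R)"
  proof (rule partition_onI)
    show "{} \<notin> E ` R"
    proof
      assume "{} \<in> E ` R"
      then obtain A where A: "A \<in> R" "E A = {}" by auto
      then obtain v where "v \<in> A" using RV by blast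
      then show False using A(2) X unfolding E_def by (auto split: if_splits)
    qed
    show "\<Union> (E ` R) = V"
    proof (intro equalityI subsetI)
      fix v assume "v \<in> \<Union> (E ` R)"
      then obtain A where A: "A \<in> R" "v \<in> E A" by blast
      then show "v \<in> V" using mem[of A v] RV[of A] X by (auto split: if_splits)
    next
      fix v assume v: "v \<in> V"
      define v' where "v' = (if v \<in> X then r else v)"
      have "v' \<in> ?V" using v unfolding v'_def by auto
      then obtain A where "A \<in> R" "v' \<in> A" using R unfolding partition_on_def by blast
      then show "v \<in> \<Union> (E ` R)" using mem[of A v] unfolding v'_def by (auto split: if_splits)
    qed
    show "disjnt A B" if "A \<in> E ` R" "B \<in> E ` R" "A \<noteq> B" for A B
    proof -
      from that obtain A' B' where AB: "A' \<in> R" "B' \<in> R" "A = E A'" "B = E B'" by blast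
      then have "A' \<inter> B' = {}" using R that(3) unfolding partition_on_def disjoint_def by metis
      then show ?thesis unfolding disjnt_def AB(3,4) using mem[OF AB(1)] mem[OF AB(2)] by (auto split: if_splits)
    qed
  qed
  have "crossing_sum ?w ?V R = (\<Sum>A\<in>R. cut w (E A) (V - E A))"
    unfolding crossing_sum_cuts[OF fin' R]
  proof (rule sum.cong[OF refl])
    fix A assume "A \<in> R"
    then show "cut ?w A (?V - A) = cut w (E A) (V - E A)"
      using boundary_contract(1)[OF fin w X RV(1), of A "\<lambda>_. 0"] unfolding boundary_def E_def by (simp cong: if_cong)
  qed
  also have "\<dots> = (\<Sum>A\<in>E ` R. cut w A (V - A))"
    by (simp add: sum.reindex[OF injE])
  also have "\<dots> = crossing_sum w V (E ` R)" by (rule crossing_sum_cuts[OF fin EV, symmetric])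
  finally have "crossing_sum ?w ?V R = crossing_sum w V (E ` R)" .
  moreover have "card (E ` R) = card R" by (rule card_image[OF injE])
  ultimately show "8 * (int (card R) - 1) \<le> crossing_sum ?w ?V R"
    using V EV unfolding dense_def by fastforce
qed

text \<open>The edges that do not cross a partition lie inside its parts; if the parts have few edges, the
remaining ones cross.\<close>

lemma dense_if_parts_sparse:
  assumes fin: "finite V" and w: "multiplicity_fun w"
    and total: "8 * int (card V) - 8 \<le> cut w V V"
    and parts: "\<And>A. A \<subseteq> V \<Longrightarrow> A \<noteq> V \<Longrightarrow> 2 \<le> card A \<Longrightarrow> cut w A A \<le> 8 * int (card A) - 8"
  shows "dense V w"
  unfolding dense_def
proof (intro allI impI)
  fix R assume R: "partition_on V R"
  show "8 * (int (card R) - 1) \<le> crossing_sum w V R"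
  proof (cases "V \<in> R")
    case True
    have "R = {V}"
    proof -
      have "A = V" if "A \<in> R" for A
        using R True that partition_finite(3,4)[OF fin R that] unfolding partition_on_def disjoint_def by blast
      then show ?thesis using True by blast
    qed
    then show ?thesis using crossing_sum_nonneg[OF w] by simp
  next
    case False
    have "cut w A A \<le> 8 * int (card A) - 8" if A: "A \<in> R" for A
    proof (cases "2 \<le> card A")
      case True
      then show ?thesis using parts partition_finite(3)[OF fin R A] A \<open>V \<notin> R\<close> by metis
    next
      case False
      have "card A \<noteq> 0" using partition_finite[OF fin R] A by auto
      then have "card A = 1" using False by linarith
      then obtain v where "A = {v}" by (rule card_1_singletonE)
      then show ?thesis using w by (simp add: cut_def multiplicity_fun_diag)
    qed
    then have "(\<Sum>A\<in>R. cut w A A) \<le> (\<Sum>A\<in>R. 8 * int (card A) - 8)" by (rule sum_mono)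
    also have "\<dots> = 8 * int (card V) - 8 * int (card R)"
      using partition_card_sum[OF fin R] by (simp add: sum_subtractf sum_distrib_left[symmetric])
    finally show ?thesis using total crossing_sum_eq[OF fin R, of w] by simp
  qed
qed

lemma cut_self_insert:
  assumes "finite A" "x \<notin> A" "multiplicity_fun w"
  shows "cut w (insert x A) (insert x A) = cut w A A + 2 * sum (w x) A"
proof -
  have "cut w (insert x A) (insert x A) = cut w {x} {x} + cut w {x} A + cut w A {x} + cut w A A"
    using assms cut_Un_left[of "{x}" A w] cut_Un_right[of "{x}" A w] by simp
  moreover have "cut w A {x} = cut w {x} A" by (rule cut_sym[OF assms(3)])
  ultimately show ?thesis using assms(3) by (simp add: cut_singleton_left multiplicity_fun_diag)
qed

lemma cut_edge_self:
  assumes "finite A" "a \<noteq> b"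
  shows "cut (edge a b) A A = 2 * of_bool (a \<in> A \<and> b \<in> A)"
proof -
  have "(\<Sum>v\<in>A. edge a b u v) = (if u = a \<and> b \<in> A then 1 else 0) + (if u = b \<and> a \<in> A then 1 else 0)" for u
  proof -
    have "edge a b u v = (if v = b then (if u = a then 1 else 0) else 0) + (if v = a then (if u = b then 1 else 0) else 0)" for v
      using assms(2) by (auto simp: edge_def)
    then show ?thesis using assms by (simp add: sum.distrib)
  qed
  then show ?thesis unfolding cut_def using assms(1)
    by (cases "b \<in> A"; cases "a \<in> A") (simp_all add: sum.distrib)
qed

text \<open>Without preoriented arcs, the condition on a set asks for at most 6 edges unless its label is
3 modulo 6; in that case the boundary is odd, so that 6 edges imply the required 7.\<close>

lemma Z3_connected_if_cuts_ge_6: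
  assumes fin: "finite V" and ne: "V \<noteq> {}" and w: "multiplicity_fun w"
    and six: "\<And>A. A \<subseteq> V \<Longrightarrow> A \<noteq> {} \<Longrightarrow> A \<noteq> V \<Longrightarrow> 6 \<le> cut w A (V - A)"
  shows "Z3_connected V w"
  unfolding Z3_connected_def
proof (intro allI impI)
  fix T :: "'a \<Rightarrow> int" assume T: "3 dvd sum T V"
  \<comment> \<open>Adjusting by 3 gives the label the parity of the degree.\<close>
  define t where "t v = (if even (T v - sum (w v) V) then T v else T v + 3)" for v
  have tpar: "even (t v - (sum (w v) V + 0))" for v unfolding t_def by simp
  have t3: "3 dvd (t v - T v)" for v unfolding t_def by simp
  have bd0: "boundary V w (\<lambda>_. 0 + 0) A = cut w A (V - A)" for A unfolding boundary_def by simp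
  have "admissible V w t (\<lambda>_. 0) (\<lambda>_. 0)"
    unfolding admissible_def bd0
  proof (intro conjI ballI allI impI)
    fix v assume v: "v \<in> V"
    have "even (boundary V w (\<lambda>_. 0) {v} - sum t {v})"
      by (rule boundary_parity[OF fin w]) (use v tpar in auto)
    then show "even (t v - cut w {v} (V - {v}))" unfolding boundary_def by simp
  next
    have "3 dvd (\<Sum>v\<in>V. t v - T v)" by (rule dvd_sum) (rule t3)
    then have "3 dvd (sum t V - sum T V)" by (simp add: sum_subtractf)
    then have "3 dvd (sum t V - sum T V + sum T V)" using T by (rule dvd_add)
    then show "3 dvd (\<Sum>v\<in>V. t v + 0 - 0)" by simp
  next
    fix A assume A: "A \<subseteq> V" "A \<noteq> {}" "A \<noteq> V"
    have "even (boundary V w (\<lambda>_. 0) A - sum t A)"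
      by (rule boundary_parity[OF fin w A(1)]) (use tpar in auto)
    then have e: "even (cut w A (V - A) - sum t A)" unfolding boundary_def by simp
    have "even (d - a) \<Longrightarrow> even (n - a) \<Longrightarrow> 6 \<le> d \<Longrightarrow> n \<le> 3 \<Longrightarrow> 4 + n \<le> d" for d a n :: int by presburger
    then show "4 + dist6 (sum t A) \<le> cut w A (V - A)"
      using e dist6_parity[of "sum t A"] six[OF A] dist6_le[of "sum t A"] by blast
  next
    show "(\<Sum>v\<in>V. 0 + 0) \<le> 4 + dist6 (sum t V)" using dist6_nonneg[of "sum t V"] by simp
  qed (use fin ne w in auto)
  then have "orientable V w t" using admissible_orientable by fastforce
  then obtain f where f: "net_orientation V w f" "\<forall>v\<in>V. 3 dvd (t v - sum (f v) V)" unfolding orientable_def by blast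
  have "3 dvd (T v - sum (f v) V)" if "v \<in> V" for v
  proof -
    have "3 dvd (t v - sum (f v) V - (t v - T v))" by (rule dvd_diff) (use f(2) that t3 in blast)+
    then show ?thesis by simp
  qed
  then show "orientable V w T" using f(1) unfolding orientable_def by blast
qed

text \<open>A minimal counterexample contains no dense proper subset with at least two vertices, since
that could be contracted; hence proper subsets are sparse.  If there were more than \<open>4 * (n - 1)\<close>
edges, one could be deleted.  Sparsity of the complement of a vertex gives degree at least 5, and a
vertex of degree 5 can be removed by lifting a pair of its edges, for which sparsity leaves room.\<close>

theorem Z3_connected_if_dense:
  fixes V :: "'v set"
  assumes "finite V" "V \<noteq> {}" "multiplicity_fun w" "dense V w"
  shows "Z3_connected V w"
  using assms
proof (induction "(card V, nat (cut w V V))" arbitrary: V w rule: wf_induct_rule[OF wf_lex_prod[OF wf_less wf_less]])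
  case 1
  note fin = \<open>finite V\<close> and ne = \<open>V \<noteq> {}\<close> and w = \<open>multiplicity_fun w\<close> and dense = \<open>dense V w\<close>
  have IH1: "Z3_connected V' w'" if "card V' < card V" "finite V'" "V' \<noteq> {}" "multiplicity_fun w'" "dense V' w'"
    for V' :: "'v set" and w'
    using 1(1) that by simp
  have IH2: "Z3_connected V w'" if "cut w' V V < cut w V V" "multiplicity_fun w'" "dense V w'" for w'
  proof -
    have "nat (cut w' V V) < nat (cut w V V)" using that(1) cut_nonneg[OF that(2), of V V] by linarith
    then show ?thesis using 1(1) that fin ne by simp
  qed
  show ?case
  proof (rule ccontr)
    assume ng: "\<not> ?case"
    let ?n = "int (card V)"
    have c0: "card V \<noteq> 0" using fin ne by simp
    have c1: "card V \<noteq> 1"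
    proof
      assume "card V = 1"
      then obtain v where "V = {v}" by (rule card_1_singletonE)
      then show False using Z3_connected_singleton[OF w] ng by blast
    qed
    have no_dense: "\<not> dense X w" if X: "X \<subseteq> V" "2 \<le> card X" "X \<noteq> V" for X
    proof
      assume dX: "dense X w"
      have finX: "finite X" using X fin finite_subset by blast
      have cX: "card X < card V" using X fin by (metis psubsetI psubset_card_mono)
      obtain r where r: "r \<in> X" using X(2) by (metis card.empty ex_in_conv not_numeral_le_zero)
      have ZX: "Z3_connected X w" using IH1[OF cX finX _ w dX] r by blast
      have "card (insert r (V - X)) = Suc (card V - card X)" using fin finX X r by (simp add: card_Diff_subset)
      then have "card (insert r (V - X)) < card V" using X cX by linarith
      then have Z1: "Z3_connected (insert r (V - X)) (contract X r w)"
        by (rule IH1) (use fin w dense_contract[OF fin w X(1) r dense] in \<open>auto intro: multiplicity_fun_contract\<close>)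
      have "Z3_connected V w" unfolding Z3_connected_def
      proof (intro allI impI)
        fix T :: "'v \<Rightarrow> int" assume T: "3 dvd sum T V"
        have "(if r \<in> insert r (V - X) then insert r (V - X) - {r} \<union> X else insert r (V - X)) = V" using X r by auto
        then have "(\<Sum>v\<in>insert r (V - X). if v = r then sum T X else T v) = sum T V"
          using boundary_contract(2)[OF fin w X(1) r, of "insert r (V - X)" T] by simp
        then show "orientable V w T"
          using Z3_connected_contract[OF fin w X(1) r ZX, of T] Z1 T unfolding Z3_connected_def by simp
      qed
      then show False using ng by blast
    qed
    have sparse: "cut w X X \<le> 8 * int (card X) - 10" if "X \<subseteq> V" "2 \<le> card X" "X \<noteq> V" for X
      using that
    proof (induction "card X" arbitrary: X rule: less_induct)
      case less
      have finX: "finite X" using less fin finite_subset by blast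
      show ?case
      proof (rule ccontr)
        assume "\<not> ?case"
        then have big: "8 * int (card X) - 8 \<le> cut w X X" using even_cut_self[OF finX w] by presburger
        have "dense X w"
        proof (rule dense_if_parts_sparse[OF finX w big])
          fix A assume A: "A \<subseteq> X" "A \<noteq> X" "2 \<le> card A"
          then have "card A < card X" using finX by (metis psubsetI psubset_card_mono)
          then have "cut w A A \<le> 8 * int (card A) - 10" using less A by (metis dual_order.trans subset_antisym)
          then show "cut w A A \<le> 8 * int (card A) - 8" by simp
        qed
        then show False using no_dense less by blast
      qed
    qed
    have total_ge: "8 * ?n - 8 \<le> cut w V V"
    proof -
      have "card ((\<lambda>v. {v}) ` V) = card V" by (rule card_image) auto
      moreover have "crossing_sum w V ((\<lambda>v. {v}) ` V) = cut w V V"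
        unfolding crossing_sum_eq[OF fin partition_singletons]
        by (simp add: sum.reindex cut_def multiplicity_fun_diag[OF w])
      ultimately show ?thesis using dense partition_singletons[of V] unfolding dense_def by fastforce
    qed
    have total: "cut w V V = 8 * ?n - 8"
    proof (rule ccontr)
      assume "cut w V V \<noteq> 8 * ?n - 8"
      then have ge: "8 * ?n - 6 \<le> cut w V V" using total_ge even_cut_self[OF fin w] by presburger
      then have "cut w V V \<noteq> 0" using c0 c1 by linarith
      have "\<exists>a\<in>V. \<exists>b\<in>V. w a b \<noteq> 0"
      proof (rule ccontr)
        assume "\<not> ?thesis"
        then have "cut w V V = 0" unfolding cut_def by simp
        then show False using \<open>cut w V V \<noteq> 0\<close> by blast
      qed
      then obtain a b where ab: "a \<in> V" "b \<in> V" "w a b \<noteq> 0" by blast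
      then have ab': "a \<noteq> b" "1 \<le> w a b"
        using multiplicity_fun_diag[OF w, of a] multiplicity_fun_nonneg[OF w, of a b] by auto
      let ?w = "\<lambda>u v. w u v - edge a b u v"
      have m: "multiplicity_fun ?w" using multiplicity_fun_remove_edge[OF w] ab' by blast
      have ce: "cut ?w A A = cut w A A - cut (edge a b) A A" for A
        using cut_add[of ?w "edge a b" A A] by simp
      have cV: "cut ?w V V = cut w V V - 2" unfolding ce using cut_edge_self[OF fin ab'(1)] ab by simp
      have "dense V ?w"
      proof (rule dense_if_parts_sparse[OF fin m])
        show "8 * ?n - 8 \<le> cut ?w V V" using cV ge by simp
        fix A assume A: "A \<subseteq> V" "A \<noteq> V" "2 \<le> card A"
        have "cut ?w A A \<le> cut w A A"
          unfolding ce cut_def using edge_nonneg[of a b] by (simp add: sum_nonneg)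
        then show "cut ?w A A \<le> 8 * int (card A) - 8" using sparse[OF A(1,3,2)] by simp
      qed
      then have "Z3_connected V ?w" using IH2[of ?w] cV m by simp
      then show False using Z3_connected_delete[OF fin ab(1,2) ab'(1)] ng by blast
    qed
    have rest: "cut w V V = cut w (V - {x}) (V - {x}) + 2 * sum (w x) (V - {x})" if "x \<in> V" for x
      using cut_self_insert[of "V - {x}" x w] fin w that by (simp add: insert_absorb)
    have cr: "card (V - {x}) = card V - 1" if "x \<in> V" for x using that fin by simp
    show False
    proof (cases "card V = 2")
      case True
      then obtain x y where V: "V = {x, y}" "x \<noteq> y" by (auto simp: card_2_iff)
      have Vx: "V - {x} = {y}" using V by auto
      have "cut w {y} {y} = 0" using w by (simp add: cut_def multiplicity_fun_diag)
      then have "sum (w x) (V - {x}) = 4" using rest[of x] total True Vx V by simp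
      then have "Z3_connected V w"
        by (intro Z3_connected_drop_vertex[OF fin _ w, of x]) (use V Vx Z3_connected_singleton[OF w] in auto)
      then show False using ng by blast
    next
      case False
      then have n3: "3 \<le> card V" using c0 c1 by linarith
      have deg5: "5 \<le> sum (w x) (V - {x})" if x: "x \<in> V" for x
      proof -
        have "V - {x} \<noteq> V" "2 \<le> card (V - {x})" using x cr[OF x] n3 by auto
        then have "cut w (V - {x}) (V - {x}) \<le> 8 * int (card (V - {x})) - 10" by (intro sparse) auto
        then show ?thesis using rest[OF x] total cr[OF x] n3 by simp
      qed
      show False
      proof (cases "\<exists>x\<in>V. sum (w x) (V - {x}) = 5")
        case True
        then obtain x where x: "x \<in> V" and d5: "sum (w x) (V - {x}) = 5" by blast
        have finVx: "finite (V - {x})" using fin by simp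
        have "\<exists>y\<in>V - {x}. w x y \<noteq> 0" by (rule ccontr) (use d5 in simp)
        then obtain a where a: "a \<in> V - {x}" "1 \<le> w x a"
          using multiplicity_fun_nonneg[OF w, of x] by (metis int_one_le_iff_zero_less order_le_less)
        have wxa: "w x a \<le> 3"
        proof -
          have "cut w {x, a} {x, a} \<le> 8 * int (card {x, a}) - 10"
            using x a n3 by (intro sparse) auto
          moreover have xa: "x \<noteq> a" using a(1) by blast
          moreover have "card {x, a} = 2" using xa by simp
          moreover have "cut w {x, a} {x, a} = 2 * w x a"
            using cut_self_insert[of "{a}" x w] w xa by (simp add: cut_singleton_left multiplicity_fun_diag)
          ultimately show ?thesis by simp
        qed
        have "\<exists>y\<in>V - {x} - {a}. w x y \<noteq> 0"
        proof (rule ccontr)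
          assume "\<not> ?thesis"
          then have "sum (w x) (V - {x} - {a}) = 0" by simp
          then show False using sum.remove[OF finVx a(1), of "w x"] wxa d5 by simp
        qed
        then obtain b where b: "b \<in> V - {x}" "b \<noteq> a" "1 \<le> w x b"
          using multiplicity_fun_nonneg[OF w, of x] by (metis DiffE int_one_le_iff_zero_less order_le_less singletonI)
        let ?w = "\<lambda>u v. w u v - edge x a u v - edge x b u v + edge a b u v"
        let ?w2 = "\<lambda>u v. w u v + edge a b u v"
        have m: "multiplicity_fun ?w" by (rule multiplicity_fun_lift[OF w]) (use a b in auto)
        have agree: "?w u v = ?w2 u v" if "u \<noteq> x" "v \<noteq> x" for u v using that by (auto simp: edge_def)
        have ce: "cut ?w A A = cut w A A + 2 * of_bool (a \<in> A \<and> b \<in> A)" if "A \<subseteq> V - {x}" for A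
        proof -
          have "cut ?w A A = cut ?w2 A A" unfolding cut_def
            by (intro sum.cong refl) (use agree that in blast)
          then show ?thesis using cut_add[of w "edge a b" A A] cut_edge_self[of A a b] b(2) finite_subset[OF that finVx] by simp
        qed
        have "Z3_connected (V - {x}) ?w"
        proof (rule IH1[OF _ finVx _ m])
          show "card (V - {x}) < card V" using cr[OF x] n3 by simp
          show "V - {x} \<noteq> {}" using a by blast
          show "dense (V - {x}) ?w"
          proof (rule dense_if_parts_sparse[OF finVx m])
            show "8 * int (card (V - {x})) - 8 \<le> cut ?w (V - {x}) (V - {x})"
              unfolding ce[OF order.refl] using rest[OF x] d5 total cr[OF x] n3 a b by simp
            fix A assume A: "A \<subseteq> V - {x}" "2 \<le> card A"
            then have "cut w A A \<le> 8 * int (card A) - 10" using x by (intro sparse) auto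
            then show "cut ?w A A \<le> 8 * int (card A) - 8" unfolding ce[OF A(1)] by simp
          qed
        qed
        moreover have "sum (?w x) (V - {x}) = 3"
        proof -
          have "?w x y = w x y - (if y = a then 1 else 0) - (if y = b then 1 else 0)" for y
            using a b by (auto simp: edge_def)
          then have "sum (?w x) (V - {x}) = (\<Sum>y\<in>V - {x}. w x y - (if y = a then 1 else 0) - (if y = b then 1 else 0))"
            by (rule sum.cong[OF refl])
          then show ?thesis using finVx a b d5 by (simp add: sum_subtractf)
        qed
        ultimately have "Z3_connected V ?w" by (intro Z3_connected_drop_vertex[OF fin x m]) auto
        then show False using Z3_connected_lift[OF fin w x, of a b] a b ng by simp
      next
        case False
        have deg6: "6 \<le> sum (w x) (V - {x})" if "x \<in> V" for x using deg5[OF that] False that by force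
        have "6 \<le> cut w A (V - A)" if A: "A \<subseteq> V" "A \<noteq> {}" "A \<noteq> V" for A
        proof -
          have finA: "finite A" "finite (V - A)" using A fin finite_subset by auto
          have pos: "card A \<noteq> 0" "card (V - A) \<noteq> 0" using A finA by auto
          have sV: "card A + card (V - A) = card V" using A finA fin by (simp add: card_Diff_subset card_mono)
          consider "card A = 1" | "card (V - A) = 1" | "2 \<le> card A" "2 \<le> card (V - A)" using pos by linarith
          then show ?thesis
          proof cases
            case 1
            then obtain v where v: "A = {v}" by (rule card_1_singletonE)
            then show ?thesis using deg6[of v] A by (simp add: cut_singleton_left)
          next
            case 2
            then obtain v where v: "V - A = {v}" by (rule card_1_singletonE)
            then have "A = V - {v}" "v \<in> V" using A by auto
            then show ?thesis using deg6[of v] cut_sym[OF w, of A "{v}"] v by (simp add: cut_singleton_left)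
          next
            case 3
            have "cut w A A \<le> 8 * int (card A) - 10" using 3 A by (intro sparse) auto
            moreover have "cut w (V - A) (V - A) \<le> 8 * int (card (V - A)) - 10" using 3 A by (intro sparse) auto
            moreover have "cut w V V = cut w A A + cut w (V - A) (V - A) + 2 * cut w A (V - A)"
            proof -
              have "V = A \<union> (V - A)" using A by auto
              then have "cut w V V = cut w (A \<union> (V - A)) (A \<union> (V - A))" by simp
              also have "\<dots> = cut w A A + cut w A (V - A) + (cut w (V - A) A + cut w (V - A) (V - A))"
                using finA by (simp only: cut_Un_left cut_Un_right Diff_disjoint)
              finally show ?thesis using cut_sym[OF w, of "V - A" A] by simp
            qed
            ultimately show ?thesis using total sV by linarith
          qed
        qed
        then show False using Z3_connected_if_cuts_ge_6[OF fin ne w] ng by blast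
      qed
    qed
  qed
qed

section \<open>Low-degree vertices as hyperedges\<close>

definition crosses :: "'v set set \<Rightarrow> 'v set \<Rightarrow> bool" where
  "crosses R S \<longleftrightarrow> \<not> (\<exists>A\<in>R. S \<subseteq> A)"

text \<open>An element of \<open>I\<close> stands for a hyperedge with vertex set \<open>h i\<close>, and weighs as much as an edge,
which \<open>crossing_sum\<close> counts twice.\<close>

definition hyper_dense :: "'v set \<Rightarrow> ('v \<Rightarrow> 'v \<Rightarrow> int) \<Rightarrow> 'i set \<Rightarrow> ('i \<Rightarrow> 'v set) \<Rightarrow> bool" where
  "hyper_dense V w I h \<longleftrightarrow> (\<forall>R. partition_on V R \<longrightarrow>
    8 * (int (card R) - 1) \<le> crossing_sum w V R + 2 * (\<Sum>i\<in>I. of_bool (crosses R (h i))))"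

lemma crossing_sum_crosses:
  assumes "finite V"
  shows "crossing_sum w V R = (\<Sum>(u, v)\<in>V \<times> V. w u v * of_bool (crosses R {u, v}))"
proof -
  have "(\<Sum>(u, v)\<in>V \<times> V. w u v * of_bool (crosses R {u, v})) =
      (\<Sum>p\<in>V \<times> V. if crosses R {fst p, snd p} then w (fst p) (snd p) else 0)"
    by (rule sum.cong[OF refl]) (simp add: case_prod_beta)
  also have "\<dots> = (\<Sum>p\<in>{p \<in> V \<times> V. crosses R {fst p, snd p}}. w (fst p) (snd p))"
    using sum.inter_filter[of "V \<times> V" "\<lambda>p. w (fst p) (snd p)" "\<lambda>p. crosses R {fst p, snd p}"] assms
    by simp
  also have "{p \<in> V \<times> V. crosses R {fst p, snd p}} = {(u, v). u \<in> V \<and> v \<in> V \<and> \<not> (\<exists>A\<in>R. u \<in> A \<and> v \<in> A)}"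
  proof (rule set_eqI)
    fix p :: "'a \<times> 'a"
    show "p \<in> {p \<in> V \<times> V. crosses R {fst p, snd p}} \<longleftrightarrow>
        p \<in> {(u, v). u \<in> V \<and> v \<in> V \<and> \<not> (\<exists>A\<in>R. u \<in> A \<and> v \<in> A)}"
      by (cases p) (simp add: crosses_def)
  qed
  finally show ?thesis unfolding crossing_sum_def by (simp add: case_prod_beta)
qed

definition merge :: "'v set set \<Rightarrow> 'v set \<Rightarrow> 'v set set" where
  "merge R A = insert (\<Union>{C \<in> R. C \<inter> A \<noteq> {}}) {C \<in> R. C \<inter> A = {}}"

definition refine :: "'v set set \<Rightarrow> 'v set \<Rightarrow> 'v set set \<Rightarrow> 'v set set" where
  "refine R' A R = (R' - {A}) \<union> (\<lambda>C. C \<inter> A) ` {C \<in> R. C \<inter> A \<noteq> {}}"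

text \<open>Uncrossing for partitions: what \<open>merge\<close> gains is lost by \<open>refine\<close>.  A pair or hyperedge inside
\<open>A\<close> is never crossed by the merged partition and is crossed by the refined one only if \<open>R\<close> crosses
it; anything else behaves as in \<open>R\<close> and \<open>R'\<close> respectively.\<close>

lemma merge_refine:
  assumes fin: "finite V" and R: "partition_on V R" and R': "partition_on V R'" and A: "A \<in> R'"
  shows "partition_on V (merge R A)" "partition_on V (refine R' A R)"
    and "card (merge R A) + card (refine R' A R) = card R + card R'"
    and "S \<noteq> {} \<Longrightarrow> of_bool (crosses (merge R A) S) + of_bool (crosses (refine R' A R) S)
      \<le> (of_bool (crosses R S) + of_bool (crosses R' S) :: int)"
proof -
  let ?M = "\<Union>{C \<in> R. C \<inter> A \<noteq> {}}" and ?K = "{C \<in> R. C \<inter> A \<noteq> {}}" and ?L = "{C \<in> R. C \<inter> A = {}}"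
  have AV: "A \<subseteq> V" "A \<noteq> {}" using partition_finite[OF fin R' ] A by blast+
  have UR: "\<Union>R = V" "\<Union>R' = V" and neR: "{} \<notin> R" "{} \<notin> R'"
    using R R' unfolding partition_on_def by blast+
  have dR: "C \<inter> D = {}" if "C \<in> R" "D \<in> R" "C \<noteq> D" for C D
    using R that unfolding partition_on_def disjoint_def by blast
  have dR': "C \<inter> D = {}" if "C \<in> R'" "D \<in> R'" "C \<noteq> D" for C D
    using R' that unfolding partition_on_def disjoint_def by blast
  have AM: "A \<subseteq> ?M" using AV UR by blast
  have finR: "finite R" "finite R'" using partition_finite(1)[OF fin] R R' by blast+
  show "partition_on V (merge R A)"
  proof (rule partition_onI)
    have "R = {C \<in> R. C \<inter> A \<noteq> {}} \<union> ?L" by blast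
    then have "\<Union>R = ?M \<union> \<Union>?L" by (metis Union_Un_distrib)
    then show "\<Union> (merge R A) = V" unfolding merge_def UR(1) by simp
    show "{} \<notin> merge R A" unfolding merge_def using AM AV neR by blast
    have M_L: "disjnt ?M D" if "D \<in> ?L" for D
      unfolding disjnt_def using dR that by blast
    show "disjnt C D" if CD: "C \<in> merge R A" "D \<in> merge R A" "C \<noteq> D" for C D
    proof -
      consider "C \<in> ?L" "D \<in> ?L" | "C = ?M" "D \<in> ?L" | "D = ?M" "C \<in> ?L"
        using CD unfolding merge_def by blast
      then show ?thesis
      proof cases
        case 1 then show ?thesis using dR CD unfolding disjnt_def by blast
      next
        case 2 then show ?thesis using M_L by blast
      next
        case 3 then show ?thesis using M_L disjnt_sym by blast
      qed
    qed
  qed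
  show "partition_on V (refine R' A R)"
  proof (rule partition_onI)
    have UA: "\<Union>((\<lambda>C. C \<inter> A) ` ?K) = A" using UR(1) AV by blast
    have "\<Union> (refine R' A R) = \<Union>(R' - {A}) \<union> A" unfolding refine_def Union_Un_distrib UA ..
    also have "\<dots> = V" using A UR(2) by blast
    finally show "\<Union> (refine R' A R) = V" .
    show "{} \<notin> refine R' A R" unfolding refine_def using neR by blast
    show "disjnt C D" if CD: "C \<in> refine R' A R" "D \<in> refine R' A R" "C \<noteq> D" for C D
    proof -
      consider "C \<in> R' - {A}" "D \<in> R' - {A}" | C' where "C \<in> R' - {A}" "D = C' \<inter> A"
        | C' where "D \<in> R' - {A}" "C = C' \<inter> A" | C' D' where "C' \<in> R" "D' \<in> R" "C = C' \<inter> A" "D = D' \<inter> A"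
        using CD unfolding refine_def by blast
      then show ?thesis
      proof cases
        case 1 then show ?thesis using dR' CD unfolding disjnt_def by blast
      next
        case 2 then show ?thesis using dR'[of C A] A unfolding disjnt_def by blast
      next
        case 3 then show ?thesis using dR'[of D A] A unfolding disjnt_def by blast
      next
        case 4
        then have "C' \<noteq> D'" using CD by blast
        then have "C' \<inter> D' = {}" using dR 4 by blast
        then show ?thesis unfolding 4 disjnt_def by blast
      qed
    qed
  qed
  show "card (merge R A) + card (refine R' A R) = card R + card R'"
  proof -
    have "?M \<notin> ?L" using AM AV by blast
    then have 1: "card (merge R A) = Suc (card ?L)" unfolding merge_def using finR by simp
    have "inj_on (\<lambda>C. C \<inter> A) ?K"
    proof (rule inj_onI)
      fix C D assume "C \<in> ?K" "D \<in> ?K" "C \<inter> A = D \<inter> A"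
      then show "C = D" using dR[of C D] by blast
    qed
    then have 2: "card ((\<lambda>C. C \<inter> A) ` ?K) = card ?K" by (rule card_image)
    have "(R' - {A}) \<inter> (\<lambda>C. C \<inter> A) ` ?K = {}"
    proof (rule ccontr)
      assume "\<not> ?thesis"
      then obtain C where C: "C \<inter> A \<in> R'" "C \<inter> A \<noteq> A" by blast
      then have "C \<inter> A \<inter> A = {}" using dR' A by blast
      then show False using C neR by auto
    qed
    then have "card (refine R' A R) = card (R' - {A}) + card ?K"
      unfolding refine_def using finR 2 by (subst card_Un_disjoint) auto
    moreover have "Suc (card (R' - {A})) = card R'" using card_Suc_Diff1[OF finR(2) A] .
    moreover have "card R = card ?L + card ?K"
    proof -
      have "R = ?L \<union> ?K" by blast
      then have "card R = card (?L \<union> ?K)" by simp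
      also have "\<dots> = card ?L + card ?K" using finR by (intro card_Un_disjoint) auto
      finally show ?thesis .
    qed
    ultimately show ?thesis using 1 by linarith
  qed
  show "of_bool (crosses (merge R A) S) + of_bool (crosses (refine R' A R) S)
      \<le> (of_bool (crosses R S) + of_bool (crosses R' S) :: int)" if S: "S \<noteq> {}"
  proof (cases "S \<subseteq> A")
    case True
    then have "\<not> crosses (merge R A) S" unfolding crosses_def merge_def using AM by blast
    moreover have "crosses R S" if "crosses (refine R' A R) S"
      unfolding crosses_def
    proof
      assume "\<exists>C\<in>R. S \<subseteq> C"
      then obtain C where C: "C \<in> R" "S \<subseteq> C" by blast
      then have "C \<inter> A \<in> refine R' A R" unfolding refine_def using True S by blast
      then show False using that C(2) True unfolding crosses_def by blast
    qed
    ultimately show ?thesis by auto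
  next
    case False
    have "crosses R S" if "crosses (merge R A) S"
      unfolding crosses_def
    proof
      assume "\<exists>C\<in>R. S \<subseteq> C"
      then obtain C where C: "C \<in> R" "S \<subseteq> C" by blast
      show False
      proof (cases "C \<inter> A = {}")
        case True
        then have "C \<in> merge R A" unfolding merge_def using C by blast
        then show False using that C(2) unfolding crosses_def by blast
      next
        case False
        then have "S \<subseteq> ?M" using C by blast
        moreover have "?M \<in> merge R A" unfolding merge_def by (rule insertI1)
        ultimately show False using that unfolding crosses_def by blast
      qed
    qed
    moreover have "crosses R' S" if "crosses (refine R' A R) S"
      unfolding crosses_def
    proof
      assume "\<exists>C\<in>R'. S \<subseteq> C"
      then obtain C where C: "C \<in> R'" "S \<subseteq> C" by blast
      then have "C \<in> refine R' A R" unfolding refine_def using False by blast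
      then show False using that C(2) unfolding crosses_def by blast
    qed
    ultimately show ?thesis by auto
  qed
qed

lemma even_crossing_sum:
  assumes "finite V" "multiplicity_fun w" "partition_on V R"
  shows "even (crossing_sum w V R)"
  unfolding crossing_sum_eq[OF assms(1,3)]
  using even_cut_self[OF assms(1,2)] even_cut_self[OF _ assms(2)] partition_finite(2)[OF assms(1,3)]
  by (intro dvd_diff dvd_sum) blast+

text \<open>Dropping the hyperedge \<open>z\<close> makes a partition deficient only if \<open>z\<close> crosses it and the density
bound was attained; then its surplus is exactly \<open>-2\<close>.  By uncrossing, deficient partitions can be
merged along the part of another one, so the largest part \<open>U\<close> containing \<open>a\<close> in a deficient
partition contains all such parts.  Some \<open>b\<close> of the hyperedge lies outside \<open>U\<close>, and the new edge
from \<open>a\<close> to \<open>b\<close> crosses every deficient partition.\<close>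

lemma hyper_dense_lift:
  assumes fin: "finite V" and w: "multiplicity_fun w" and I: "finite I" "z \<notin> I"
    and h: "\<And>i. i \<in> insert z I \<Longrightarrow> h i \<noteq> {}" "h z \<subseteq> V"
    and a: "a \<in> h z" "a' \<in> h z" "a \<noteq> a'"
    and dense: "hyper_dense V w (insert z I) h"
  shows "\<exists>b\<in>h z - {a}. hyper_dense V (\<lambda>u v. w u v + edge a b u v) I h"
proof -
  \<comment> \<open>The surplus of a partition in the absence of \<open>z\<close>.\<close>
  define s where "s R = crossing_sum w V R + 2 * (\<Sum>i\<in>I. of_bool (crosses R (h i))) - 8 * (int (card R) - 1)" for R
  define deficient where "deficient R \<longleftrightarrow> partition_on V R \<and> s R < 0" for R
  have s_ge: "- 2 * of_bool (crosses R (h z)) \<le> s R" if "partition_on V R" for R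
  proof -
    have "(\<Sum>i\<in>insert z I. of_bool (crosses R (h i)) :: int) =
        of_bool (crosses R (h z)) + (\<Sum>i\<in>I. of_bool (crosses R (h i)))"
      by (rule sum.insert) (use I in auto)
    moreover have "8 * (int (card R) - 1) \<le> crossing_sum w V R + 2 * (\<Sum>i\<in>insert z I. of_bool (crosses R (h i)))"
      using dense that unfolding hyper_dense_def by blast
    ultimately show ?thesis unfolding s_def by linarith
  qed
  have s_even: "even (s R)" if "partition_on V R" for R
    unfolding s_def using even_crossing_sum[OF fin w that] by simp
  have s_m2: "s R = -2" and crossed: "crosses R (h z)" if "deficient R" for R
  proof -
    have "partition_on V R" "s R < 0" using that unfolding deficient_def by blast+
    then show "crosses R (h z)" using s_ge[of R] by (cases "crosses R (h z)") auto
    have "- 2 \<le> s R" using s_ge[OF \<open>partition_on V R\<close>] by (cases "crosses R (h z)") auto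
    moreover have "s R \<noteq> -1" using s_even[OF \<open>partition_on V R\<close>] by auto
    ultimately show "s R = -2" using \<open>s R < 0\<close> by linarith
  qed
  have s_uncross: "s (merge R A) + s (refine R' A R) \<le> s R + s R'"
    if R: "partition_on V R" "partition_on V R'" "A \<in> R'" for R R' A
  proof -
    note mr = merge_refine[OF fin R]
    have "crossing_sum w V (merge R A) + crossing_sum w V (refine R' A R) \<le> crossing_sum w V R + crossing_sum w V R'"
      unfolding crossing_sum_crosses[OF fin] sum.distrib[symmetric]
    proof (rule sum_mono)
      fix p assume "p \<in> V \<times> V"
      obtain u v where p: "p = (u, v)" by fastforce
      have "w u v * (of_bool (crosses (merge R A) {u, v}) + of_bool (crosses (refine R' A R) {u, v}))
          \<le> w u v * (of_bool (crosses R {u, v}) + of_bool (crosses R' {u, v}))"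
        by (rule mult_left_mono[OF mr(4)]) (simp_all add: multiplicity_fun_nonneg[OF w])
      then show "(case p of (u, v) \<Rightarrow> w u v * of_bool (crosses (merge R A) {u, v})) +
            (case p of (u, v) \<Rightarrow> w u v * of_bool (crosses (refine R' A R) {u, v}))
          \<le> (case p of (u, v) \<Rightarrow> w u v * of_bool (crosses R {u, v})) +
            (case p of (u, v) \<Rightarrow> w u v * of_bool (crosses R' {u, v}))"
        unfolding p prod.case by (simp only: distrib_left)
    qed
    moreover have "(\<Sum>i\<in>I. of_bool (crosses (merge R A) (h i))) + (\<Sum>i\<in>I. of_bool (crosses (refine R' A R) (h i)))
        \<le> (\<Sum>i\<in>I. of_bool (crosses R (h i))) + (\<Sum>i\<in>I. of_bool (crosses R' (h i)) :: int)"
      unfolding sum.distrib[symmetric] by (rule sum_mono) (use mr(4) h in blast)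
    moreover have "int (card (merge R A)) + int (card (refine R' A R)) = int (card R) + int (card R')"
      using mr(3) by (metis of_nat_add)
    ultimately show ?thesis unfolding s_def by (simp only: right_diff_distrib)
  qed
  have aV: "a \<in> V" using a h by blast
  have "\<exists>U. (\<forall>R A. deficient R \<and> A \<in> R \<and> a \<in> A \<longrightarrow> A \<subseteq> U) \<and> \<not> h z \<subseteq> U \<and> a \<in> U"
  proof (cases "\<exists>R. deficient R")
    case False
    then show ?thesis using a by (intro exI[of _ "{a}"]) auto
  next
    case True
    define P where "P U \<longleftrightarrow> (\<exists>R. deficient R \<and> U \<in> R \<and> a \<in> U)" for U
    have P_sub: "U \<subseteq> V" if "P U" for U
      using that partition_finite(3)[OF fin] unfolding P_def deficient_def by blast
    obtain R0 where R0: "deficient R0" using True by blast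
    then have "\<Union>R0 = V" unfolding deficient_def partition_on_def by blast
    then obtain U0 where "P U0" using aV R0 unfolding P_def by blast
    have "\<exists>U. P U \<and> (\<forall>U'. P U' \<longrightarrow> card U' \<le> card U)"
      by (rule ex_has_greatest_nat[of P U0 card "Suc (card V)"])
        (use \<open>P U0\<close> P_sub fin in \<open>auto simp: less_Suc_eq_le intro: card_mono\<close>)
    then obtain U where U: "P U" and Umax: "\<And>U'. P U' \<Longrightarrow> card U' \<le> card U" by blast
    obtain R where R: "deficient R" "U \<in> R" "a \<in> U" using U unfolding P_def by blast
    have "A \<subseteq> U" if A: "deficient R'" "A \<in> R'" "a \<in> A" for R' A
    proof -
      have part: "partition_on V R" "partition_on V R'" using R A unfolding deficient_def by blast+
      note mr = merge_refine[OF fin part A(2)]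
      have "s (merge R A) + s (refine R' A R) \<le> -4"
        using s_uncross[OF part A(2)] s_m2[OF R(1)] s_m2[OF A(1)] by linarith
      moreover have "- 2 \<le> s (refine R' A R)" using s_ge[OF mr(2)] by (cases "crosses (refine R' A R) (h z)") auto
      ultimately have dm: "deficient (merge R A)" unfolding deficient_def using mr(1) by auto
      define M where "M = \<Union>{C \<in> R. C \<inter> A \<noteq> {}}"
      have "M \<in> merge R A" unfolding merge_def M_def by (rule insertI1)
      have "U \<in> {C \<in> R. C \<inter> A \<noteq> {}}" using R(2,3) A(3) by blast
      then have "U \<subseteq> M" unfolding M_def by (rule Union_upper)
      have "A \<subseteq> V" using P_sub A unfolding P_def by blast
      then have "A \<subseteq> M" using part(1) unfolding partition_on_def M_def by blast
      have PM: "P M" unfolding P_def using dm \<open>M \<in> merge R A\<close> \<open>U \<subseteq> M\<close> R(3) by blast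
      have "finite M" using P_sub[OF PM] fin finite_subset by blast
      then have "U = M" using Umax[OF PM] \<open>U \<subseteq> M\<close> by (intro card_seteq)
      then show ?thesis using \<open>A \<subseteq> M\<close> by blast
    qed
    moreover have "\<not> h z \<subseteq> U" using crossed[OF R(1)] R(2) unfolding crosses_def by blast
    ultimately show ?thesis using R(3) by (intro exI[of _ U]) blast
  qed
  then obtain U where U: "\<And>R A. deficient R \<Longrightarrow> A \<in> R \<Longrightarrow> a \<in> A \<Longrightarrow> A \<subseteq> U" and "\<not> h z \<subseteq> U" "a \<in> U" by blast
  then obtain b where b: "b \<in> h z" "b \<notin> U" "b \<noteq> a" by blast
  have bV: "b \<in> V" using b h by blast
  have me: "multiplicity_fun (edge a b)"
    unfolding multiplicity_fun_def by (auto simp: edge_sym[of a b] edge_nonneg edge_diag)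
  have "hyper_dense V (\<lambda>u v. w u v + edge a b u v) I h"
    unfolding hyper_dense_def
  proof (intro allI impI)
    fix R assume R: "partition_on V R"
    have add: "crossing_sum (\<lambda>u v. w u v + edge a b u v) V R = crossing_sum w V R + crossing_sum (edge a b) V R"
      unfolding crossing_sum_def by (simp add: sum.distrib case_prod_beta)
    have e: "- s R \<le> crossing_sum (edge a b) V R"
    proof (cases "deficient R")
      case False
      then show ?thesis using R crossing_sum_nonneg[OF me, of V R] unfolding deficient_def by linarith
    next
      case True
      have "cut (edge a b) A A = 0" if "A \<in> R" for A
        using U[OF True that] b cut_edge_self[OF partition_finite(2)[OF fin R that], of a b] by auto
      then have "crossing_sum (edge a b) V R = 2"
        unfolding crossing_sum_eq[OF fin R] using cut_edge_self[OF fin, of a b] b aV bV by simp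
      then show ?thesis using s_m2[OF True] by simp
    qed
    then show "8 * (int (card R) - 1) \<le> crossing_sum (\<lambda>u v. w u v + edge a b u v) V R +
        2 * (\<Sum>i\<in>I. of_bool (crosses R (h i)))"
      unfolding add s_def by linarith
  qed
  then show ?thesis using b by blast
qed

text \<open>A vertex with four edges into \<open>V\<close> keeps degree 2 after one pair of its edges is lifted, which
is enough to remove it.\<close>

theorem Z3_connected_if_hyper_dense:
  assumes "finite I" "finite V" "V \<noteq> {}" "V \<inter> I = {}" "multiplicity_fun w" "hyper_dense V w I h"
    and "\<And>i. i \<in> I \<Longrightarrow> h i \<subseteq> V" "\<And>i. i \<in> I \<Longrightarrow> \<exists>a\<in>h i. \<exists>b\<in>h i. a \<noteq> b"
    and "\<And>i b. i \<in> I \<Longrightarrow> b \<in> h i \<Longrightarrow> 1 \<le> w i b" "\<And>i. i \<in> I \<Longrightarrow> 4 \<le> sum (w i) V"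
  shows "Z3_connected (V \<union> I) w"
  using assms
proof (induction I arbitrary: w rule: finite_induct)
  case empty
  then have "dense V w" unfolding dense_def hyper_dense_def by simp
  then show ?case using empty Z3_connected_if_dense by simp
next
  case (insert z I)
  note fin = \<open>finite V\<close> and w = \<open>multiplicity_fun w\<close>
  have hV: "h z \<subseteq> V" and zV: "z \<notin> V" using insert.prems by blast+
  obtain a a' where a: "a \<in> h z" "a' \<in> h z" "a \<noteq> a'" using insert.prems(7)[of z] by blast
  have "\<exists>b\<in>h z - {a}. hyper_dense V (\<lambda>u v. w u v + edge a b u v) I h"
  proof (rule hyper_dense_lift[OF fin w insert.hyps])
    show "h i \<noteq> {}" if "i \<in> insert z I" for i using insert.prems(7)[OF that] by blast
  qed (use hV a insert.prems in auto)
  then obtain b where b: "b \<in> h z" "b \<noteq> a" and hd: "hyper_dense V (\<lambda>u v. w u v + edge a b u v) I h" by blast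
  have abV: "a \<in> V" "b \<in> V" "a \<noteq> z" "b \<noteq> z" using a b hV zV by blast+
  have w1: "1 \<le> w z a" "1 \<le> w z b" using insert.prems(8) a b by blast+
  let ?w = "\<lambda>u v. w u v - edge z a u v - edge z b u v + edge a b u v"
  have m: "multiplicity_fun ?w" by (rule multiplicity_fun_lift[OF w]) (use abV w1 b in auto)
  have agree: "?w u v = w u v + edge a b u v" if "u \<noteq> z" "v \<noteq> z" for u v
    using that unfolding edge_def by auto
  have "crossing_sum ?w V R = crossing_sum (\<lambda>u v. w u v + edge a b u v) V R" for R
    unfolding crossing_sum_def
  proof (rule sum.cong[OF refl])
    fix p assume "p \<in> {(u, v). u \<in> V \<and> v \<in> V \<and> \<not> (\<exists>A\<in>R. u \<in> A \<and> v \<in> A)}"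
    then have "fst p \<in> V" "snd p \<in> V" by (simp_all add: case_prod_beta)
    then have "fst p \<noteq> z" "snd p \<noteq> z" using zV by metis+
    then show "(case p of (u, v) \<Rightarrow> ?w u v) = (case p of (u, v) \<Rightarrow> w u v + edge a b u v)"
      unfolding case_prod_beta by (rule agree)
  qed
  then have hd': "hyper_dense V ?w I h" using hd unfolding hyper_dense_def by simp
  have nbr: "w i v \<le> ?w i v" if "i \<in> I" "v \<in> V" for i v
  proof -
    have "i \<noteq> z" "v \<noteq> z" using that insert.hyps zV by blast+
    then show ?thesis using agree[of i v] edge_nonneg[of a b i v] by linarith
  qed
  have Z: "Z3_connected (V \<union> I) ?w"
  proof (rule insert.IH[OF fin \<open>V \<noteq> {}\<close> _ m hd'])
    show "V \<inter> I = {}" using insert.prems(3) by blast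
    fix i assume i: "i \<in> I"
    show "h i \<subseteq> V" "\<exists>a\<in>h i. \<exists>b\<in>h i. a \<noteq> b" using insert.prems(6,7) i by blast+
    show "4 \<le> sum (?w i) V"
      using insert.prems(9)[of i] i sum_mono[of V "w i" "?w i", OF nbr[OF i]] by simp
    show "1 \<le> ?w i b" if "b \<in> h i" for b
    proof -
      have "b \<in> V" "1 \<le> w i b" using insert.prems(6,8) i that by blast+
      then show ?thesis using nbr[OF i] by fastforce
    qed
  qed
  have Ve: "V \<union> insert z I - {z} = V \<union> I" using zV insert.hyps by blast
  have fin': "finite (V \<union> insert z I)" using fin insert.hyps by simp
  have "2 \<le> sum (?w z) V"
  proof -
    have "?w z y = w z y - (if y = a then 1 else 0) - (if y = b then 1 else 0)" for y
      using abV b by (auto simp: edge_def)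
    then have "sum (?w z) V = (\<Sum>y\<in>V. w z y - (if y = a then 1 else 0) - (if y = b then 1 else 0))"
      by (rule sum.cong[OF refl])
    also have "\<dots> = sum (w z) V - 2" using fin abV by (simp add: sum_subtractf)
    finally show ?thesis using insert.prems(9)[of z] by simp
  qed
  also have "\<dots> \<le> sum (?w z) (V \<union> I)"
    by (rule sum_mono2) (use fin insert.hyps multiplicity_fun_nonneg[OF m] in auto)
  finally have "Z3_connected (V \<union> insert z I) ?w"
    using Z3_connected_drop_vertex[OF fin' _ m, of z] Z unfolding Ve by blast
  then show ?case using Z3_connected_lift[OF fin' w, of z a b] abV by simp
qed

section \<open>Sparse bonds and contraction\<close>

text \<open>Connectedness of the subgraph induced on \<open>S\<close>, expressed by cuts.\<close>

definition linked :: "('v \<Rightarrow> 'v \<Rightarrow> int) \<Rightarrow> 'v set \<Rightarrow> bool" where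
  "linked w S \<longleftrightarrow> (\<forall>A. A \<subseteq> S \<and> A \<noteq> {} \<and> A \<noteq> S \<longrightarrow> cut w A (S - A) \<noteq> 0)"

lemma linkedD: "linked w S \<Longrightarrow> A \<subseteq> S \<Longrightarrow> A \<noteq> {} \<Longrightarrow> A \<noteq> S \<Longrightarrow> cut w A (S - A) \<noteq> 0"
  unfolding linked_def by simp

lemma cut_zero_mono:
  assumes "multiplicity_fun w" "finite A" "finite B" "cut w A B = 0" "A' \<subseteq> A" "B' \<subseteq> B"
  shows "cut w A' B' = 0"
  using cut_mono[OF assms(1,2,3,5,6)] cut_nonneg[OF assms(1), of A' B'] assms(4) by linarith

lemma cut_contract:
  assumes "finite V" "multiplicity_fun w" "X \<subseteq> V" "r \<in> X" "A \<subseteq> insert r (V - X)"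
  defines "E \<equiv> (if r \<in> A then A - {r} \<union> X else A)"
  shows "cut (contract X r w) A (insert r (V - X) - A) = cut w E (V - E)"
  using boundary_contract(1)[OF assms(1-5), of "\<lambda>_. 0"] unfolding boundary_def E_def by (simp cong: if_cong)

lemma linked_side:
  assumes "multiplicity_fun w" "finite A" "finite B" "linked w S" "cut w A B = 0" "S \<subseteq> A \<union> B" "A \<inter> B = {}"
  shows "S \<subseteq> A \<or> S \<subseteq> B"
proof (rule ccontr)
  assume "\<not> ?thesis"
  then have "S \<inter> A \<noteq> {}" "S \<inter> A \<noteq> S" using assms(6) by blast+
  then have "cut w (S \<inter> A) (S - S \<inter> A) \<noteq> 0" by (intro linkedD[OF assms(4)]) blast+
  moreover have "S - S \<inter> A \<subseteq> B" using assms(6) by blast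
  ultimately show False using cut_zero_mono[OF assms(1-3,5), of "S \<inter> A" "S - S \<inter> A"] by blast
qed

lemma linked_component:
  assumes w: "multiplicity_fun w" and fin: "finite S" and u: "u \<in> S"
  shows "\<exists>K\<subseteq>S. u \<in> K \<and> linked w K \<and> cut w K (S - K) = 0"
proof -
  define P where "P K \<longleftrightarrow> K \<subseteq> S \<and> u \<in> K \<and> cut w K (S - K) = 0" for K
  have "P S" unfolding P_def using u by simp
  then obtain K where K: "P K" and least: "\<And>K'. P K' \<Longrightarrow> card K \<le> card K'"
    using ex_has_least_nat[of P S card] by blast
  have finK: "finite K" using K fin finite_subset unfolding P_def by blast
  have KS: "K \<subseteq> S" "u \<in> K" "cut w K (S - K) = 0" using K unfolding P_def by blast+
  have "linked w K"
    unfolding linked_def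
  proof (intro allI impI notI)
    fix A assume A: "A \<subseteq> K \<and> A \<noteq> {} \<and> A \<noteq> K" and zero: "cut w A (K - A) = 0"
    have piece: "card K \<le> card B" if "B \<subseteq> K" "u \<in> B" "cut w B (K - B) = 0" for B
    proof (rule least)
      have "S - B = (K - B) \<union> (S - K)" using that KS by blast
      then have "cut w B (S - B) = cut w B (K - B) + cut w B (S - K)"
        using fin finK by (simp only: cut_Un_right finite_Diff) (rule cut_Un_right, auto)
      moreover have "cut w B (S - K) = 0"
        by (rule cut_zero_mono[OF w finK _ KS(3) that(1)]) (use fin in auto)
      ultimately show "P B" unfolding P_def using that KS by simp
    qed
    have cA: "card A < card K" using A finK by (intro psubset_card_mono) blast+
    have "card (K - A) < card K" using A finK by (intro psubset_card_mono) blast+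
    moreover have "cut w (K - A) (K - (K - A)) = 0"
      using zero cut_sym[OF w, of A "K - A"] A by (simp add: double_diff)
    ultimately have "u \<notin> K - A" using piece[of "K - A"] by fastforce
    moreover have "u \<notin> A" using piece[of A] A zero cA by fastforce
    ultimately show False using KS by blast
  qed
  then show ?thesis using KS by blast
qed

text \<open>A set without edges to its complement cannot split \<open>X\<close>, so it or its complement survives
contraction.\<close>

lemma linked_contract:
  assumes fin: "finite V" and w: "multiplicity_fun w" and X: "X \<subseteq> V" "r \<in> X" "linked w X"
    and L: "linked (contract X r w) (insert r (V - X))"
  shows "linked w V"
  unfolding linked_def
proof (intro allI impI notI)
  fix A assume A: "A \<subseteq> V \<and> A \<noteq> {} \<and> A \<noteq> V" and zero: "cut w A (V - A) = 0"
  have no: False if B: "B \<subseteq> V" "B \<noteq> {}" "B \<inter> X = {}" "cut w B (V - B) = 0" for B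
  proof -
    have rB: "r \<notin> B" using B X by blast
    have sub: "B \<subseteq> insert r (V - X)" using B by blast
    have "cut (contract X r w) B (insert r (V - X) - B) = cut w B (V - B)"
      using cut_contract[OF fin w X(1,2) sub] unfolding if_not_P[OF rB] .
    moreover have "B \<noteq> insert r (V - X)" using rB by blast
    ultimately show False using linkedD[OF L sub B(2)] B(4) by simp
  qed
  have f: "finite A" "finite (V - A)" using A fin finite_subset by blast+
  have "X \<subseteq> A \<or> X \<subseteq> V - A" by (rule linked_side[OF w f X(3) zero]) (use X in auto)
  then show False
  proof
    assume XA: "X \<subseteq> V - A"
    show False by (rule no[of A]) (use A zero XA in auto)
  next
    assume XA: "X \<subseteq> A"
    have "cut w (V - A) (V - (V - A)) = 0" using zero cut_sym[OF w, of A "V - A"] A by (simp add: double_diff)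
    then show False using no[of "V - A"] A XA by blast
  qed
qed

text \<open>The hypotheses of the theorem in terms of multiplicities: bonds are the cuts with both sides
connected.\<close>

locale sparse_bonds =
  fixes V :: "'v set" and w :: "'v \<Rightarrow> 'v \<Rightarrow> int"
  assumes fin: "finite V" and ne: "V \<noteq> {}" and w: "multiplicity_fun w"
    and cut_ge_4: "\<And>A. A \<subseteq> V \<Longrightarrow> A \<noteq> {} \<Longrightarrow> A \<noteq> V \<Longrightarrow> 4 \<le> cut w A (V - A)"
    and bond: "\<And>A. A \<subseteq> V \<Longrightarrow> A \<noteq> {} \<Longrightarrow> A \<noteq> V \<Longrightarrow> linked w A \<Longrightarrow> linked w (V - A) \<Longrightarrow>
      6 \<le> cut w A (V - A) \<Longrightarrow> 21 \<le> cut w A (V - A)"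
begin

abbreviation d :: "'v set \<Rightarrow> int" where "d A \<equiv> cut w A (V - A)"

lemma fin_sub: "A \<subseteq> V \<Longrightarrow> finite A"
  using fin finite_subset by blast

lemma d_compl: "A \<subseteq> V \<Longrightarrow> d (V - A) = d A"
  using cut_sym[OF w, of A "V - A"] by (simp add: double_diff)

lemma d_Un:
  assumes "A \<subseteq> V" "B \<subseteq> V" "A \<inter> B = {}"
  shows "d (A \<union> B) = d A + d B - 2 * cut w A B"
  using boundary_Un[OF fin w assms, of "\<lambda>_. 0"] unfolding boundary_def by simp

text \<open>A disconnected set is left by the edges of two cuts, each of size at least 4.\<close>

lemma linked_if_small:
  assumes S: "S \<subseteq> V" "d S < 8"
  shows "linked w S"
  unfolding linked_def
proof (intro allI impI notI)
  fix A assume A: "A \<subseteq> S \<and> A \<noteq> {} \<and> A \<noteq> S" and zero: "cut w A (S - A) = 0"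
  have "4 \<le> d A" "4 \<le> d (S - A)" by (rule cut_ge_4; use A S in blast)+
  moreover have "d (A \<union> (S - A)) = d A + d (S - A)" using d_Un[of A "S - A"] A S zero by auto
  moreover have "A \<union> (S - A) = S" using A by blast
  ultimately show False using S(2) by simp
qed

text \<open>Contraction of a connected set preserves the hypotheses because connected sets have connected
preimages.\<close>

lemma orientable_by_contraction:
  assumes X: "X \<subseteq> V" "2 \<le> card X" "linked w X" "Z3_connected X w"
    and IH: "\<And>(V' :: 'v set) w'. card V' < card V \<Longrightarrow> sparse_bonds V' w' \<Longrightarrow> orientable V' w' (\<lambda>_. 0)"
  shows "orientable V w (\<lambda>_. 0)"
proof -
  obtain r where r: "r \<in> X" using X(2) by fastforce
  let ?V = "insert r (V - X)" and ?w = "contract X r w"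
  have finX: "finite X" using X fin_sub by blast
  have "card ?V = Suc (card V - card X)" using fin finX X r by (simp add: card_Diff_subset)
  then have small: "card ?V < card V" using X(1,2) fin card_mono[OF fin X(1)] by linarith
  have m: "multiplicity_fun ?w" by (rule multiplicity_fun_contract[OF w])
  have d': "cut ?w A (?V - A) = d (if r \<in> A then A - {r} \<union> X else A)" if "A \<subseteq> ?V" for A
    by (rule cut_contract[OF fin w X(1) r that])
  have outside: "linked w A" if A: "A \<subseteq> V - X" "linked ?w A" for A
  proof -
    have "cut ?w B (A - B) = cut w B (A - B)" if "B \<subseteq> A" for B
      unfolding cut_def
    proof (intro sum.cong refl)
      fix u v assume "u \<in> B" "v \<in> A - B"
      then have "u \<noteq> r" "v \<noteq> r" using A r that by blast+
      then show "?w u v = w u v" unfolding contract_def by simp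
    qed
    then show ?thesis using A(2) unfolding linked_def by simp
  qed
  have inside: "linked w (A - {r} \<union> X)" if A: "A \<subseteq> ?V" "r \<in> A" "linked ?w A" for A
  proof (rule linked_contract[OF _ w _ r X(3)])
    show "finite (A - {r} \<union> X)" "X \<subseteq> A - {r} \<union> X" using A fin finX finite_subset[of A ?V] by auto
    have "insert r (A - {r} \<union> X - X) = A" using A r by blast
    then show "linked ?w (insert r (A - {r} \<union> X - X))" using A by simp
  qed
  have "sparse_bonds ?V ?w"
  proof
    show "finite ?V" "?V \<noteq> {}" "multiplicity_fun ?w" using fin m by auto
    fix A assume A: "A \<subseteq> ?V" "A \<noteq> {}" "A \<noteq> ?V"
    let ?E = "if r \<in> A then A - {r} \<union> X else A"
    have E: "?E \<subseteq> V" "?E \<noteq> {}" using A X r by auto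
    have E': "?E \<noteq> V"
    proof (cases "r \<in> A")
      case True
      then obtain y where "y \<in> V - X" "y \<notin> A" using A by blast
      then show ?thesis using True by auto
    next
      case False
      then show ?thesis using r X by auto
    qed
    show "4 \<le> cut ?w A (?V - A)" unfolding d'[OF A(1)] by (rule cut_ge_4[OF E E'])
    assume l: "linked ?w A" "linked ?w (?V - A)" "6 \<le> cut ?w A (?V - A)"
    have "linked w ?E \<and> linked w (V - ?E)"
    proof (cases "r \<in> A")
      case True
      have "V - ?E = ?V - A" using True A X r by auto
      moreover have "linked w (?V - A)" using outside[of "?V - A"] l True by blast
      ultimately show ?thesis using inside[OF A(1) True l(1)] True by simp
    next
      case False
      have "V - ?E = ?V - A - {r} \<union> X" using False A X r by auto
      moreover have "linked w (?V - A - {r} \<union> X)" using inside[of "?V - A"] l False by blast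
      moreover have "linked w A" using outside[of A] A l False by blast
      ultimately show ?thesis using False by simp
    qed
    then show "21 \<le> cut ?w A (?V - A)" using bond[OF E E'] l(3) unfolding d'[OF A(1)] by blast
  qed
  then have "orientable ?V ?w (\<lambda>_. 0)" using IH small by blast
  then show ?thesis using Z3_connected_contract[OF fin w X(1) r X(4), of "\<lambda>_. 0"] by (simp cong: if_cong)
qed

end

section \<open>A minimal region bounded by few edges\<close>

lemma linked_pair:
  assumes w: "multiplicity_fun w" and xy: "w x y \<noteq> 0"
  shows "linked w {x, y}"
  unfolding linked_def
proof (intro allI impI)
  fix A assume A: "A \<subseteq> {x, y} \<and> A \<noteq> {} \<and> A \<noteq> {x, y}"
  have ne: "x \<noteq> y" using xy multiplicity_fun_diag[OF w, of x] by auto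
  have "A \<in> Pow {x, y}" using A by simp
  then have xA: "A = {x} \<or> A = {y}" using A unfolding Pow_insert by auto
  have e: "{x, y} - {x} = {y}" "{x, y} - {y} = {x}" using ne by blast+
  have "cut w {x} ({x, y} - {x}) \<noteq> 0" unfolding e cut_singleton_left using xy by simp
  moreover have "cut w {y} ({x, y} - {y}) \<noteq> 0"
    unfolding e cut_singleton_left using xy multiplicity_fun_sym[OF w, of x y] by simp
  ultimately show "cut w A ({x, y} - A) \<noteq> 0" using xA by metis
qed

text \<open>Minimality of \<open>X\<close> is expressed by \<open>least\<close>.  The bound on \<open>d X\<close> is trivial for \<open>X = V\<close>, so the
whole vertex set and a proper region are treated alike.\<close>

locale minimal_region = sparse_bonds V w
  for V :: "'v set" and w :: "'v \<Rightarrow> 'v \<Rightarrow> int" +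
  fixes X :: "'v set"
  assumes simple: "\<And>u v. u \<in> V \<Longrightarrow> v \<in> V \<Longrightarrow> w u v \<le> 1"
    and X: "X \<subseteq> V" "2 \<le> card X" "d X \<le> 5"
    and least: "\<And>A. A \<subseteq> X \<Longrightarrow> A \<noteq> X \<Longrightarrow> 2 \<le> card A \<Longrightarrow> 6 \<le> d A"
begin

lemma finX: "finite X"
  using X fin_sub by blast

lemma deg: "v \<in> V \<Longrightarrow> d {v} = sum (w v) V"
  using sum.remove[OF fin, of v "w v"] multiplicity_fun_diag[OF w, of v] by (simp add: cut_singleton_left)

lemma ne_singleton: "v \<in> X \<Longrightarrow> {v} \<noteq> X"
  using X(2) by fastforce

lemma deg_ge_4:
  assumes "v \<in> X"
  shows "4 \<le> d {v}"
proof (rule cut_ge_4)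
  show "{v} \<noteq> V" using ne_singleton[OF assms] X(1) assms by blast
qed (use X assms in auto)

lemma deg_le_if_neighbours:
  assumes v: "v \<in> V" and S: "S \<subseteq> V" and zero: "cut w {v} (V - S - {v}) = 0"
  shows "d {v} \<le> int (card S)"
proof -
  have "d {v} \<le> cut w {v} (V - S - {v}) + cut w {v} (S - {v})"
  proof -
    have "V - {v} = (V - S - {v}) \<union> (S - {v})" using S by blast
    then have "d {v} = cut w {v} ((V - S - {v}) \<union> (S - {v}))" by simp
    also have "\<dots> = cut w {v} (V - S - {v}) + cut w {v} (S - {v})"
      by (rule cut_Un_right) (use fin fin_sub[OF S] in auto)
    finally show ?thesis by simp
  qed
  also have "\<dots> = sum (w v) (S - {v})" unfolding zero by (simp add: cut_singleton_left)
  also have "\<dots> \<le> (\<Sum>u\<in>S - {v}. 1)" by (rule sum_mono) (use simple[OF v] S in blast)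
  also have "\<dots> \<le> int (card S)" using card_mono[of S "S - {v}"] fin_sub[OF S] by simp
  finally show ?thesis .
qed

text \<open>Let \<open>K\<close> be the component of \<open>u\<close> outside \<open>S\<close>.  Both \<open>K\<close> and its complement are connected: the
complement consists of \<open>S\<close> and other components, each joined to \<open>S\<close>.  So \<open>K\<close> gives a bond of size at
most \<open>d S\<close>, hence at most 5.  By minimality of \<open>X\<close> either \<open>K\<close> is a single vertex, or \<open>K\<close> contains
the outside of \<open>X\<close>, and then the complement of \<open>K\<close> would be a single vertex, hence equal to \<open>S\<close>,
although at least 6 edges leave \<open>S\<close>.\<close>

lemma thin_region:
  assumes S: "S \<subseteq> X" "S \<noteq> {}" "linked w S" "6 \<le> d S" "d S \<le> 20" and u: "u \<in> X" "u \<notin> S"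
  shows "d {u} \<le> 5" "cut w {u} (V - S - {u}) = 0"
proof -
  have SV: "S \<subseteq> V" "finite S" using S X fin_sub by blast+
  obtain K where K: "K \<subseteq> V - S" "u \<in> K" "linked w K" and zero: "cut w K (V - S - K) = 0"
    using linked_component[OF w, of "V - S" u] fin u X by blast
  have KV: "K \<subseteq> V" "K \<noteq> {}" "K \<noteq> V" "finite K" using K S SV fin_sub by blast+
  have "linked w (V - K)"
    unfolding linked_def
  proof (intro allI impI notI)
    fix A assume A: "A \<subseteq> V - K \<and> A \<noteq> {} \<and> A \<noteq> V - K" and Azero: "cut w A (V - K - A) = 0"
    have no: False if B: "B \<subseteq> V - K" "B \<noteq> {}" "cut w B (V - K - B) = 0" "S \<inter> B = {}" for B
    proof -
      have fB: "finite B" using B fin_sub by blast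
      have "B \<subseteq> V - S - K" using B by blast
      then have "cut w K B = 0" by (intro cut_zero_mono[OF w KV(4) _ zero]) (use fin in auto)
      moreover have "V - B = (V - K - B) \<union> K" using B KV by blast
      then have "d B = cut w B ((V - K - B) \<union> K)" by (rule arg_cong)
      moreover have "cut w B ((V - K - B) \<union> K) = cut w B (V - K - B) + cut w B K"
        by (rule cut_Un_right) (use fin KV in auto)
      ultimately have "d B = 0" using B(3) cut_sym[OF w, of K B] by simp
      moreover have "4 \<le> d B" by (rule cut_ge_4) (use B KV in auto)
      ultimately show False by simp
    qed
    have f: "finite A" "finite (V - K - A)" using A fin fin_sub by auto
    have "S \<subseteq> A \<or> S \<subseteq> V - K - A" by (rule linked_side[OF w f S(3) Azero]) (use K SV in auto)
    then show False
    proof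
      assume "S \<subseteq> V - K - A"
      then show False by (intro no[of A]) (use A Azero in auto)
    next
      assume SA: "S \<subseteq> A"
      have "V - K - (V - K - A) = A" using A by (simp add: double_diff)
      then have "cut w (V - K - A) (V - K - (V - K - A)) = 0" using Azero cut_sym[OF w, of A] by simp
      then show False by (intro no[of "V - K - A"]) (use A SA in auto)
    qed
  qed
  then have "6 \<le> d K \<Longrightarrow> 21 \<le> d K" using bond[OF KV(1-3) K(3)] by blast
  moreover have "d K \<le> 20"
  proof -
    have "V - K = S \<union> (V - S - K)" using K SV by blast
    then have "d K = cut w K (S \<union> (V - S - K))" by (rule arg_cong)
    also have "\<dots> = cut w K S + cut w K (V - S - K)" by (rule cut_Un_right) (use fin SV in auto)
    also have "\<dots> = cut w S K" using zero cut_sym[OF w] by simp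
    also have "\<dots> \<le> d S" by (rule cut_mono[OF w SV(2)]) (use fin K in auto)
    finally show ?thesis using S(5) by simp
  qed
  ultimately have dK: "d K \<le> 5" by linarith
  have "K = {u}"
  proof (cases "K \<subseteq> X")
    case True
    have "K \<noteq> X" using S K by blast
    then have "\<not> 2 \<le> card K" using least[OF True] dK by fastforce
    moreover have "card K \<noteq> 0" using KV by simp
    ultimately have "card K = 1" by linarith
    then show ?thesis using K(2) by (metis card_1_singletonE singletonD)
  next
    case False
    then have KX: "K \<inter> (V - X) \<noteq> {}" using KV by blast
    have "d (V - X) < 8" using d_compl[OF X(1)] X(3) by simp
    then have L: "linked w (V - X)" by (intro linked_if_small) auto
    have "V - X \<subseteq> K \<or> V - X \<subseteq> V - S - K"
      by (rule linked_side[OF w KV(4) _ L zero]) (use fin S in auto)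
    then have "V - K \<subseteq> X" using KX by blast
    moreover have "V - K \<noteq> X" using u K by blast
    moreover have dVK: "d (V - K) \<le> 5" using d_compl[OF KV(1)] dK by simp
    ultimately have "\<not> 2 \<le> card (V - K)" using least[of "V - K"] by fastforce
    then have "card (V - K) \<le> card S" using S(2) SV(2) card_0_eq[of S] by linarith
    then have "S = V - K" using K SV fin by (intro card_seteq) auto
    then show ?thesis using S(4) dVK by simp
  qed
  then show "d {u} \<le> 5" "cut w {u} (V - S - {u}) = 0" using dK zero by simp_all
qed

definition big :: "'v set" where "big = {v \<in> X. 6 \<le> d {v}}"

definition small :: "'v set" where "small = X - big"

definition big_neighbours :: "'v \<Rightarrow> 'v set" where
  "big_neighbours u = {b \<in> big. 1 \<le> w u b}"

lemma big_sub: "big \<subseteq> X" and small_sub: "small \<subseteq> X" and finB: "finite big" and finS: "finite small"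
  and big_small: "big \<inter> small = {}" "X = big \<union> small"
  using finX unfolding big_def small_def by auto

lemma small_deg: "u \<in> small \<Longrightarrow> d {u} \<le> 5"
  unfolding small_def big_def by auto

text \<open>Apply \<open>thin_region\<close> to the component of a big vertex within \<open>S\<close>; a big vertex outside would
have degree at most 5.\<close>

lemma separating_big:
  assumes S: "S \<subseteq> X" "S \<inter> big \<noteq> {}" "\<not> big \<subseteq> S"
  shows "21 \<le> d S"
proof -
  obtain b b' where b: "b \<in> big" "b \<in> S" "b' \<in> big" "b' \<notin> S" using S by blast
  have SV: "S \<subseteq> V" "finite S" using S X fin_sub by blast+
  obtain K where K: "K \<subseteq> S" "b \<in> K" "linked w K" "cut w K (S - K) = 0"
    using linked_component[OF w SV(2) b(2)] by blast
  have KX: "K \<subseteq> X" "K \<noteq> X" "K \<noteq> {}" using K S b big_sub by blast+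
  have finK: "finite K" using KX finX finite_subset by blast
  have 6: "6 \<le> d K"
  proof (cases "2 \<le> card K")
    case True
    then show ?thesis using least KX by blast
  next
    case False
    have "card K \<noteq> 0" using KX finK by simp
    then have "card K = 1" using False by linarith
    then have "K = {b}" using K(2) by (metis card_1_singletonE singletonD)
    then show ?thesis using b(1) unfolding big_def by simp
  qed
  have "21 \<le> d K"
  proof (rule ccontr)
    assume "\<not> ?thesis"
    then have "d {b'} \<le> 5" by (intro thin_region(1)[OF KX(1,3) K(3) 6]) (use b K big_sub in auto)
    then show False using b(3) unfolding big_def by simp
  qed
  moreover have "d S = d K + d (S - K)"
  proof -
    have "K \<union> (S - K) = S" using K by blast
    then show ?thesis using d_Un[of K "S - K"] K SV by auto
  qed
  ultimately show ?thesis using cut_nonneg[OF w, of "S - K" "V - (S - K)"] by linarith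
qed

text \<open>Two adjacent small vertices form a connected set left by at most 8 edges, so any third vertex
of \<open>X\<close> would have all its edges to these two and degree at most 2.\<close>

lemma small_independent:
  assumes u: "u \<in> small" "v \<in> small"
  shows "w u v = 0"
proof (rule ccontr)
  assume nz: "w u v \<noteq> 0"
  have uv: "u \<in> X" "v \<in> X" "u \<in> V" "v \<in> V" using u small_sub X by blast+
  have "w u v = 1" using nz simple[OF uv(3,4)] multiplicity_fun_nonneg[OF w, of u v] by linarith
  have ne: "u \<noteq> v" using nz multiplicity_fun_diag[OF w] by blast
  have duv: "d {u, v} = d {u} + d {v} - 2"
    using d_Un[of "{u}" "{v}"] ne uv \<open>w u v = 1\<close> by (simp add: cut_singleton_left insert_commute)
  have "X \<noteq> {u, v}" using duv deg_ge_4[OF uv(1)] deg_ge_4[OF uv(2)] X(3) by auto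
  then obtain x where x: "x \<in> X" "x \<notin> {u, v}" using uv by blast
  have 6: "6 \<le> d {u, v}" by (rule least) (use uv ne \<open>X \<noteq> {u, v}\<close> in auto)
  have L: "linked w {u, v}" by (rule linked_pair[OF w nz])
  have 20: "d {u, v} \<le> 20" using duv small_deg[OF u(1)] small_deg[OF u(2)] by simp
  have "cut w {x} (V - {u, v} - {x}) = 0"
    by (rule thin_region(2)[OF _ _ L 6 20 x]) (use uv in auto)
  then have "d {x} \<le> int (card {u, v})" by (intro deg_le_if_neighbours) (use x uv X in auto)
  then show False using deg_ge_4[OF x(1)] ne by simp
qed

lemma sum_small: "u \<in> small \<Longrightarrow> sum (w u) small = 0"
  using small_independent by simp

lemma sum_X: "u \<in> small \<Longrightarrow> sum (w u) X = sum (w u) big"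
  using sum.union_disjoint[OF finB finS big_small(1), of "w u"] sum_small[of u] big_small(2) by simp

lemma small_deg_split:
  assumes u: "u \<in> small"
  shows "d {u} = sum (w u) big + sum (w u) (V - X)"
proof -
  have "u \<in> V" using u small_sub X by blast
  moreover have "sum (w u) V = sum (w u) (V - X) + sum (w u) X" using sum.subset_diff[OF X(1) fin] .
  ultimately show ?thesis using deg sum_X[OF u] by simp
qed

text \<open>If few edges joined \<open>u\<close> to the rest of \<open>X\<close>, moving \<open>u\<close> out of \<open>X\<close> would give a smaller region
bounded by few edges.\<close>

lemma small_sum_big:
  assumes u: "u \<in> small"
  shows "3 \<le> sum (w u) big"
proof -
  have uX: "u \<in> X" "u \<in> V" using u small_sub X by blast+
  have c: "cut w {u} (X - {u}) \<le> sum (w u) big"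
    using sum.remove[OF finX uX(1), of "w u"] multiplicity_fun_nonneg[OF w, of u u] sum_X[OF u]
    by (simp add: cut_singleton_left)
  have "{u} \<union> (X - {u}) = X" using uX by blast
  then have dX: "d X = d {u} + d (X - {u}) - 2 * cut w {u} (X - {u})"
    using d_Un[of "{u}" "X - {u}"] uX X(1) by auto
  have card: "card (X - {u}) = card X - 1" using uX finX by simp
  show ?thesis
  proof (cases "2 \<le> card (X - {u})")
    case True
    then have "6 \<le> d (X - {u})" using least[of "X - {u}"] uX by blast
    then show ?thesis using dX X(3) deg_ge_4[OF uX(1)] c by linarith
  next
    case False
    then have "card (X - {u}) = 1" using card X(2) by linarith
    then obtain v where v: "X - {u} = {v}" by (rule card_1_singletonE)
    then have vX: "v \<in> X" "v \<in> V" using X by blast+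
    have "cut w {u} (X - {u}) \<le> 1" using simple[OF uX(2) vX(2)] unfolding v by (simp add: cut_singleton_left)
    then show ?thesis using dX X(3) deg_ge_4[OF uX(1)] deg_ge_4[OF vX(1)] unfolding v by linarith
  qed
qed

lemma big_nonempty: "big \<noteq> {}"
proof
  assume b: "big = {}"
  obtain u where "u \<in> X" using X(2) by fastforce
  then have "u \<in> small" using b unfolding small_def by simp
  then show False using small_sum_big b by fastforce
qed

lemma no_big_neighbour: "b \<in> big \<Longrightarrow> b \<notin> big_neighbours u \<Longrightarrow> w u b = 0"
  using multiplicity_fun_nonneg[OF w, of u b] unfolding big_neighbours_def by simp

lemma two_big_neighbours:
  assumes u: "u \<in> small"
  shows "\<exists>a\<in>big_neighbours u. \<exists>b\<in>big_neighbours u. a \<noteq> b"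
proof (rule ccontr)
  assume no: "\<not> ?thesis"
  have sub: "big_neighbours u \<subseteq> big" unfolding big_neighbours_def by blast
  have f: "finite (big_neighbours u)" using sub finB finite_subset by blast
  have "sum (w u) big = sum (w u) (big_neighbours u)"
    by (rule sum.mono_neutral_right[OF finB sub]) (use no_big_neighbour in blast)
  also have "\<dots> \<le> (\<Sum>b\<in>big_neighbours u. 1)"
    by (rule sum_mono) (use simple u small_sub big_sub sub X in blast)
  also have "\<dots> \<le> 1" using no f by (simp add: card_le_Suc0_iff_eq)
  finally show False using small_sum_big[OF u] by simp
qed

text \<open>Only the small vertices without edges to the outside of \<open>X\<close> serve as hyperedges: they have at
least four edges to big vertices.  The others are added at the end.\<close>

definition inner :: "'v set" where
  "inner = {u \<in> small. sum (w u) (V - X) = 0}"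

text \<open>The small vertices whose neighbours all lie in \<open>A\<close> are joined to \<open>A\<close>, so that the edges
leaving the result come from hyperedges that cross, from edges between big vertices, or from edges
leaving \<open>X\<close>.\<close>

definition absorb :: "'v set \<Rightarrow> 'v set" where
  "absorb A = A \<union> {u \<in> small. big_neighbours u \<subseteq> A}"

lemma cut_absorb:
  assumes A: "A \<subseteq> big"
  shows "d (absorb A) = cut w A (big - A) + cut w A (V - X)
    + (\<Sum>u\<in>small. if big_neighbours u \<subseteq> A then sum (w u) (V - X) else sum (w u) A)"
proof -
  define M where "M = {u \<in> small. big_neighbours u \<subseteq> A}"
  define N where "N = small - M"
  have f: "finite A" "finite M" "finite N" "finite (big - A)" "finite (V - X)"
    using A finB finS fin finite_subset unfolding M_def N_def by auto
  have Ms: "M \<subseteq> small" unfolding M_def by blast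
  have disj: "A \<inter> M = {}" using A Ms big_small by blast
  have "absorb A = A \<union> M" unfolding absorb_def M_def ..
  moreover have "V - (A \<union> M) = ((big - A) \<union> N) \<union> (V - X)"
    unfolding N_def using A Ms big_small X(1) big_sub small_sub by blast
  moreover have "((big - A) \<union> N) \<inter> (V - X) = {}" "(big - A) \<inter> N = {}"
    unfolding N_def using big_small by blast+
  ultimately have "d (absorb A) = cut w A (big - A) + cut w A N + cut w A (V - X)
      + (cut w M (big - A) + cut w M N + cut w M (V - X))"
    using f disj by (simp add: cut_Un_left cut_Un_right)
  moreover have "cut w M (big - A) = 0"
    unfolding cut_def
  proof (intro sum.neutral ballI)
    fix u b assume "u \<in> M" "b \<in> big - A"
    then show "w u b = 0" unfolding M_def by (intro no_big_neighbour) auto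
  qed
  moreover have "cut w M N = 0"
    unfolding cut_def
  proof (intro sum.neutral ballI)
    fix u v assume "u \<in> M" "v \<in> N"
    then show "w u v = 0" unfolding M_def N_def by (intro small_independent) auto
  qed
  moreover have "cut w M (V - X) + cut w A N =
      (\<Sum>u\<in>small. if big_neighbours u \<subseteq> A then sum (w u) (V - X) else sum (w u) A)"
  proof -
    have "small = M \<union> N" "M \<inter> N = {}" unfolding N_def using Ms by blast+
    then have "(\<Sum>u\<in>small. if big_neighbours u \<subseteq> A then sum (w u) (V - X) else sum (w u) A) =
        (\<Sum>u\<in>M. if big_neighbours u \<subseteq> A then sum (w u) (V - X) else sum (w u) A) +
        (\<Sum>u\<in>N. if big_neighbours u \<subseteq> A then sum (w u) (V - X) else sum (w u) A)"
      using sum.union_disjoint[OF f(2,3)] by simp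
    also have "\<dots> = cut w M (V - X) + cut w N A"
      unfolding cut_def by (intro arg_cong2[where f = "(+)"] sum.cong refl) (auto simp: M_def N_def)
    finally show ?thesis using cut_sym[OF w, of A N] by simp
  qed
  ultimately show ?thesis by simp
qed

text \<open>Sum the bound 21 over the parts.  A crossing small vertex accounts for at most 5 edges; if it
is not in \<open>inner\<close>, then for at most 4, which is charged, like all other edges at the boundary of
\<open>X\<close>, to its edges leaving \<open>X\<close> at a rate of 4.  As at most 5 edges leave \<open>X\<close>, the number \<open>x\<close> of
doubly counted edges and the number \<open>c\<close> of hyperedges satisfy \<open>21 * q \<le> x + 5 * c + 20\<close>, and
\<open>8 * (q - 1) \<le> x + 2 * c\<close> follows.\<close>

lemma big_hyper_dense: "hyper_dense big w inner big_neighbours"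
  unfolding hyper_dense_def
proof (intro allI impI)
  fix Q assume Q: "partition_on big Q"
  define c where "c = (\<Sum>u\<in>inner. of_bool (crosses Q (big_neighbours u)) :: int)"
  have c0: "0 \<le> c" unfolding c_def by (rule sum_nonneg) simp
  have x0: "0 \<le> crossing_sum w big Q" by (rule crossing_sum_nonneg[OF w])
  note part = partition_finite[OF finB Q]
  have "8 * (int (card Q) - 1) \<le> crossing_sum w big Q + 2 * c"
  proof (cases "card Q \<le> 1")
    case True
    then have "int (card Q) - 1 \<le> 0" by simp
    then show ?thesis using c0 x0 unfolding right_diff_distrib by linarith
  next
    case False
    have bound: "21 \<le> d (absorb A)" if A: "A \<in> Q" for A
    proof (rule separating_big)
      have A': "A \<subseteq> big" "A \<noteq> {}" using part A by blast+
      have meet: "absorb A \<inter> big = A" unfolding absorb_def using A' big_small by blast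
      show "absorb A \<subseteq> X" unfolding absorb_def using A' big_sub small_sub by blast
      show "absorb A \<inter> big \<noteq> {}" using meet A' by simp
      show "\<not> big \<subseteq> absorb A"
      proof
        assume "big \<subseteq> absorb A"
        then have "A = big" using meet by blast
        have "C = A" if "C \<in> Q" for C
          using Q A that part(3,4)[OF that] \<open>A = big\<close> unfolding partition_on_def disjoint_def by blast
        then have "Q \<subseteq> {A}" by blast
        then have "card Q \<le> card {A}" by (intro card_mono) auto
        then show False using False by simp
      qed
    qed
    let ?cr = "\<lambda>u. crosses Q (big_neighbours u)" and ?g = "\<lambda>u. sum (w u) (V - X)"
    have "21 * int (card Q) = (\<Sum>A\<in>Q. 21)" by simp
    also have "\<dots> \<le> (\<Sum>A\<in>Q. d (absorb A))" by (rule sum_mono) (rule bound)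
    also have "\<dots> = (\<Sum>A\<in>Q. cut w A (big - A)) + (\<Sum>A\<in>Q. cut w A (V - X)) +
        (\<Sum>A\<in>Q. \<Sum>u\<in>small. if big_neighbours u \<subseteq> A then ?g u else sum (w u) A)"
      using cut_absorb[OF part(3)] by (simp add: sum.distrib)
    also have "(\<Sum>A\<in>Q. cut w A (big - A)) = crossing_sum w big Q"
      by (rule crossing_sum_cuts[OF finB Q, symmetric])
    also have "(\<Sum>A\<in>Q. cut w A (V - X)) = cut w big (V - X)"
      unfolding cut_def by (rule partition_sum[OF finB Q])
    also have "(\<Sum>A\<in>Q. \<Sum>u\<in>small. if big_neighbours u \<subseteq> A then ?g u else sum (w u) A) =
        (\<Sum>u\<in>small. \<Sum>A\<in>Q. if big_neighbours u \<subseteq> A then ?g u else sum (w u) A)"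
      by (rule sum.swap)
    also have "\<dots> \<le> (\<Sum>u\<in>small. 5 * of_bool (u \<in> inner \<and> ?cr u) + 4 * ?g u)"
    proof (rule sum_mono)
      fix u assume u: "u \<in> small"
      have g0: "0 \<le> ?g u" by (rule sum_nonneg) (rule multiplicity_fun_nonneg[OF w])
      show "(\<Sum>A\<in>Q. if big_neighbours u \<subseteq> A then ?g u else sum (w u) A)
          \<le> 5 * of_bool (u \<in> inner \<and> ?cr u) + 4 * ?g u"
      proof (cases "?cr u")
        case True
        have "(\<Sum>A\<in>Q. if big_neighbours u \<subseteq> A then ?g u else sum (w u) A) = (\<Sum>A\<in>Q. sum (w u) A)"
          by (rule sum.cong[OF refl], rule if_not_P) (use True in \<open>auto simp: crosses_def\<close>)
        also have "\<dots> = d {u} - ?g u" using partition_sum[OF finB Q] small_deg_split[OF u] by simp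
        finally show ?thesis
          using True small_deg[OF u] g0 u unfolding inner_def by (cases "?g u = 0") auto
      next
        case False
        then obtain A where A: "A \<in> Q" "big_neighbours u \<subseteq> A" unfolding crosses_def by blast
        have "(if big_neighbours u \<subseteq> C then ?g u else sum (w u) C) = 0" if C: "C \<in> Q - {A}" for C
        proof -
          have CA: "C \<inter> A = {}" using Q A C unfolding partition_on_def disjoint_def by blast
          moreover have "\<not> big_neighbours u \<subseteq> C" using CA A two_big_neighbours[OF u] by blast
          moreover have "sum (w u) C = 0"
          proof (rule sum.neutral, intro ballI)
            fix b assume "b \<in> C"
            then show "w u b = 0" using CA A C part(3)[of C] by (intro no_big_neighbour) blast+
          qed
          ultimately show ?thesis by simp
        qed
        then have "(\<Sum>A\<in>Q. if big_neighbours u \<subseteq> A then ?g u else sum (w u) A) = ?g u"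
          using sum.remove[OF part(1) A(1), of "\<lambda>A. if big_neighbours u \<subseteq> A then ?g u else sum (w u) A"] A(2)
          by simp
        then show ?thesis using g0 by simp
      qed
    qed
    also have "\<dots> = 5 * c + 4 * cut w small (V - X)"
    proof -
      have "c = (\<Sum>u\<in>small. of_bool (u \<in> inner \<and> ?cr u))"
        unfolding c_def by (rule sum.mono_neutral_cong_left) (use finS in \<open>auto simp: inner_def\<close>)
      then show ?thesis unfolding cut_def by (simp add: sum.distrib sum_distrib_left)
    qed
    finally have "21 * int (card Q) \<le> crossing_sum w big Q + cut w big (V - X) + (5 * c + 4 * cut w small (V - X))"
      by simp
    moreover have "cut w big (V - X) + cut w small (V - X) = d X"
      using cut_Un_left[OF finB finS big_small(1), of w "V - X"] big_small(2) by simp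
    ultimately have "21 * int (card Q) \<le> crossing_sum w big Q + 5 * c + 20"
      using X(3) cut_nonneg[OF w, of big "V - X"] by linarith
    moreover have "2 \<le> int (card Q)" using False by simp
    ultimately show ?thesis using x0 c0 unfolding right_diff_distrib by linarith
  qed
  then show "8 * (int (card Q) - 1) \<le> crossing_sum w big Q + 2 * (\<Sum>i\<in>inner. of_bool (crosses Q (big_neighbours i)))"
    unfolding c_def .
qed

theorem Z3_connected_region: "Z3_connected X w"
proof -
  have inner: "inner \<subseteq> small" "finite inner" using finS unfolding inner_def by auto
  have disj: "big \<inter> inner = {}" using inner big_small by blast
  have Z: "Z3_connected (big \<union> inner) w"
  proof (rule Z3_connected_if_hyper_dense[OF inner(2) finB big_nonempty disj w big_hyper_dense])
    fix u assume u: "u \<in> inner"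
    then have us: "u \<in> small" using inner by blast
    show "big_neighbours u \<subseteq> big" unfolding big_neighbours_def by blast
    show "\<exists>a\<in>big_neighbours u. \<exists>b\<in>big_neighbours u. a \<noteq> b" by (rule two_big_neighbours[OF us])
    show "1 \<le> w u b" if "b \<in> big_neighbours u" for b using that unfolding big_neighbours_def by blast
    have "u \<in> X" using us small_sub by blast
    then show "4 \<le> sum (w u) big" using deg_ge_4[of u] small_deg_split[OF us] u unfolding inner_def by simp
  qed
  have "Z3_connected (big \<union> inner \<union> J) w" if "finite J" "J \<subseteq> small - inner" for J
    using that
  proof (induction J rule: finite_induct)
    case empty
    then show ?case using Z by simp
  next
    case (insert x J)
    let ?Y = "big \<union> inner \<union> insert x J"
    have "x \<in> small" "x \<notin> inner" "x \<notin> J" using insert.prems insert.hyps by blast+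
    then have "x \<notin> big \<union> inner \<union> J" using big_small(1) by blast
    then have e: "?Y - {x} = big \<union> inner \<union> J" by blast
    have fY: "finite ?Y" using insert finB inner by simp
    have "sum (w x) big \<le> sum (w x) (big \<union> inner \<union> J)"
      by (rule sum_mono2) (use insert finB inner multiplicity_fun_nonneg[OF w] in auto)
    then have "2 \<le> sum (w x) (?Y - {x})" using small_sum_big[of x] insert.prems unfolding e by simp
    moreover have "Z3_connected (?Y - {x}) w" unfolding e using insert by blast
    ultimately show ?case using Z3_connected_drop_vertex[OF fY _ w, of x] by blast
  qed
  from this[of "small - inner"] finS have "Z3_connected (big \<union> inner \<union> (small - inner)) w" by simp
  moreover have "big \<union> inner \<union> (small - inner) = X" using big_small inner by blast
  ultimately show ?thesis by simp
qed

end

text \<open>Either a pair of parallel edges or a minimal region is contracted.\<close>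

theorem orientable_if_sparse_bonds:
  fixes V :: "'v set"
  assumes "sparse_bonds V w"
  shows "orientable V w (\<lambda>_. 0)"
  using assms
proof (induction "card V" arbitrary: V w rule: less_induct)
  case less
  interpret sparse_bonds V w by (rule less.prems)
  note contract = orientable_by_contraction[OF _ _ _ _ less.hyps]
  show ?case
  proof (cases "card V = 1")
    case True
    then obtain v where "V = {v}" by (rule card_1_singletonE)
    then show ?thesis using Z3_connected_singleton[OF w] unfolding Z3_connected_def by simp
  next
    case False
    moreover have "card V \<noteq> 0" using fin ne by simp
    ultimately have V2: "2 \<le> card V" by linarith
    show ?thesis
    proof (cases "\<exists>x\<in>V. \<exists>y\<in>V. 2 \<le> w x y")
      case True
      then obtain x y where xy: "x \<in> V" "y \<in> V" "2 \<le> w x y" by blast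
      then have ne': "x \<noteq> y" using multiplicity_fun_diag[OF w, of x] by auto
      have e: "{x, y} - {x} = {y}" using ne' by blast
      have "Z3_connected {x, y} w"
        by (rule Z3_connected_drop_vertex[of _ x])
          (use w xy e Z3_connected_singleton[OF w] in auto)
      moreover have "linked w {x, y}" by (rule linked_pair[OF w]) (use xy in simp)
      ultimately show ?thesis using contract[of "{x, y}"] xy ne' by simp
    next
      case False
      define P where "P Y \<longleftrightarrow> Y \<subseteq> V \<and> 2 \<le> card Y \<and> (Y = V \<or> d Y \<le> 5)" for Y
      have "P V" unfolding P_def using V2 by blast
      then obtain X where X: "P X" and min: "\<And>Y. P Y \<Longrightarrow> card X \<le> card Y"
        using ex_has_least_nat[of P V card] by blast
      have X': "X \<subseteq> V" "2 \<le> card X" "d X \<le> 5" using X unfolding P_def by auto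
      interpret minimal_region V w X
      proof
        show "w u v \<le> 1" if "u \<in> V" "v \<in> V" for u v using False that by force
        fix A assume A: "A \<subseteq> X" "A \<noteq> X" "2 \<le> card A"
        have "card A < card X" using A fin_sub[OF X'(1)] by (intro psubset_card_mono) blast+
        then have "\<not> P A" using min by fastforce
        then show "6 \<le> d A" using A X' unfolding P_def by auto
      qed (rule X')+
      have "linked w X" by (rule linked_if_small) (use X' in auto)
      then show ?thesis using contract[OF X'(1,2)] Z3_connected_region by blast
    qed
  qed
qed

section \<open>Cuts and bonds of multigraphs\<close>

definition multiplicity :: "('v, 'e) multigraph \<Rightarrow> 'v \<Rightarrow> 'v \<Rightarrow> int" where
  "multiplicity G u v = int (card {e \<in> edges G. ends G e = {u, v}})"

definition between :: "('v, 'e) multigraph \<Rightarrow> 'v set \<Rightarrow> 'v set \<Rightarrow> 'e set" where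
  "between G A B = {e \<in> edges G. \<exists>u\<in>A. \<exists>v\<in>B. ends G e = {u, v}}"

lemma between_commute: "between G A B = between G B A"
proof -
  have "between G A B \<subseteq> between G B A" for A B
  proof
    fix e assume "e \<in> between G A B"
    then obtain u v where e: "e \<in> edges G" "u \<in> A" "v \<in> B" "ends G e = {u, v}"
      unfolding between_def by blast
    have "ends G e = {v, u}" using e(4) by (simp add: insert_commute)
    then show "e \<in> between G B A" unfolding between_def using e(1-3) by blast
  qed
  then show ?thesis by blast
qed

lemma between_mono: "A \<subseteq> A' \<Longrightarrow> B \<subseteq> B' \<Longrightarrow> between G A B \<subseteq> between G A' B'"
  unfolding between_def by blast

lemma delete_edges_simps [simp]:
  "vertices (delete_edges G S) = vertices G" "edges (delete_edges G S) = edges G - S"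
  "ends (delete_edges G S) = ends G"
  unfolding delete_edges_def by simp_all

lemma between_delete_edges: "between (delete_edges G S) A B = between G A B - S"
  unfolding between_def by auto

lemma finite_loopless_multigraph_delete:
  assumes "finite_loopless_multigraph G"
  shows "finite_loopless_multigraph (delete_edges G S)"
proof -
  interpret finite_loopless_multigraph G by (rule assms)
  show ?thesis by unfold_locales (use finite_vertices finite_edges ends_edge in auto)
qed

context finite_loopless_multigraph
begin

abbreviation same_component :: "'v rel" where
  "same_component \<equiv> {(u, v) \<in> vertices G \<times> vertices G. (u, v) \<in> (adjacency G)\<^sup>*}"

lemma adjacency_closed:
  assumes "between G A (vertices G - A) = {}" "(u, v) \<in> (adjacency G)\<^sup>*" "u \<in> A"
  shows "v \<in> A"
  using assms(2,3)
proof (induction rule: rtrancl_induct)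
  case (step y z)
  then obtain e where e: "e \<in> edges G" "ends G e = {y, z}" unfolding adjacency_def by auto
  then have "z \<in> vertices G" using ends_edge[OF e(1)] by simp
  then show ?case using assms(1) e step unfolding between_def by blast
qed simp

lemma components_eq_one:
  assumes "vertices G \<noteq> {}"
    and cross: "\<And>A. A \<subseteq> vertices G \<Longrightarrow> A \<noteq> {} \<Longrightarrow> A \<noteq> vertices G \<Longrightarrow> between G A (vertices G - A) \<noteq> {}"
  shows "card (components G) = 1"
proof -
  have all: "(u, v) \<in> same_component" if uv: "u \<in> vertices G" "v \<in> vertices G" for u v
  proof -
    define A where "A = {x \<in> vertices G. (u, x) \<in> (adjacency G)\<^sup>*}"
    have "between G A (vertices G - A) = {}"
    proof (rule ccontr)
      assume "\<not> ?thesis"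
      then obtain e x y where e: "e \<in> edges G" "x \<in> A" "y \<in> vertices G - A" "ends G e = {x, y}"
        unfolding between_def by blast
      then have "(x, y) \<in> adjacency G" unfolding adjacency_def by blast
      then show False using e unfolding A_def by (auto intro: rtrancl_into_rtrancl)
    qed
    moreover have "u \<in> A" "A \<subseteq> vertices G" unfolding A_def using uv by auto
    ultimately have "A = vertices G" using cross[of A] by blast
    then show ?thesis using uv unfolding A_def by blast
  qed
  have "components G = {vertices G}"
  proof
    show "components G \<subseteq> {vertices G}"
    proof
      fix C assume "C \<in> components G"
      then obtain u where u: "u \<in> vertices G" "C = same_component `` {u}"
        unfolding components_def by (rule quotientE)
      then show "C \<in> {vertices G}" using all by blast
    qed
    obtain u where u: "u \<in> vertices G" using assms(1) by blast
    then have "same_component `` {u} \<in> components G" unfolding components_def by (rule quotientI)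
    moreover have "same_component `` {u} = vertices G" using all u by blast
    ultimately show "{vertices G} \<subseteq> components G" by simp
  qed
  then show ?thesis by simp
qed

lemma finite_components: "finite (components G)"
  unfolding components_def using finite_vertices by (rule finite_quotient) auto

lemma two_components:
  assumes A: "A \<subseteq> vertices G" "A \<noteq> {}" "A \<noteq> vertices G" "between G A (vertices G - A) = {}"
  shows "2 \<le> card (components G)"
proof -
  obtain u v where uv: "u \<in> A" "v \<in> vertices G - A" using A by blast
  let ?C = "\<lambda>x. same_component `` {x}"
  have "?C u \<in> components G" "?C v \<in> components G"
    unfolding components_def by (rule quotientI; use uv A in blast)+
  moreover have "?C u \<noteq> ?C v"
  proof
    assume "?C u = ?C v"
    moreover have "v \<in> ?C v" using uv by blast
    ultimately have "(u, v) \<in> (adjacency G)\<^sup>*" by blast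
    then show False using adjacency_closed[OF A(4)] uv by blast
  qed
  ultimately have "card {?C u, ?C v} \<le> card (components G)"
    by (intro card_mono[OF finite_components]) blast
  then show ?thesis using \<open>?C u \<noteq> ?C v\<close> by simp
qed

lemma multiplicity_fun_multiplicity: "multiplicity_fun (multiplicity G)"
  unfolding multiplicity_fun_def
proof (intro conjI allI)
  fix u v
  show "multiplicity G u v = multiplicity G v u" unfolding multiplicity_def by (simp add: insert_commute)
  show "0 \<le> multiplicity G u v" unfolding multiplicity_def by simp
  have "{e \<in> edges G. ends G e = {v, v}} = {}" using ends_edge by fastforce
  then show "multiplicity G v v = 0" unfolding multiplicity_def by (simp only: card.empty of_nat_0)
qed

lemma cut_multiplicity:
  assumes "finite A" "finite B" "A \<inter> B = {}"
  shows "cut (multiplicity G) A B = int (card (between G A B))"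
proof -
  let ?P = "\<lambda>p. {e \<in> edges G. ends G e = {fst p, snd p}}"
  have "between G A B = (\<Union>p\<in>A \<times> B. ?P p)" unfolding between_def by fastforce
  also have "card \<dots> = (\<Sum>p\<in>A \<times> B. card (?P p))"
  proof (rule card_UN_disjoint)
    show "finite (A \<times> B)" using assms by blast
    show "\<forall>p\<in>A \<times> B. finite (?P p)" using finite_edges by simp
    show "\<forall>p\<in>A \<times> B. \<forall>q\<in>A \<times> B. p \<noteq> q \<longrightarrow> ?P p \<inter> ?P q = {}"
    proof (intro ballI impI)
      fix p q assume pq: "p \<in> A \<times> B" "q \<in> A \<times> B" "p \<noteq> q"
      have "{fst p, snd p} \<noteq> {fst q, snd q}"
      proof
        assume "{fst p, snd p} = {fst q, snd q}"
        then have "p = q \<or> fst p = snd q" by (auto simp: doubleton_eq_iff prod_eq_iff)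
        then show False using pq assms(3) by (auto simp: mem_Times_iff)
      qed
      then show "?P p \<inter> ?P q = {}" by auto
    qed
  qed
  finally show ?thesis
    unfolding cut_pairs by (simp add: multiplicity_def case_prod_beta)
qed

text \<open>Removing fewer edges than the whole cut leaves an edge between the two connected sides.\<close>

lemma edge_cut_if_linked:
  assumes conn: "card (components G) = 1"
    and A: "A \<subseteq> vertices G" "A \<noteq> {}" "A \<noteq> vertices G"
    and l: "linked (multiplicity G) A" "linked (multiplicity G) (vertices G - A)"
  shows "edge_cut G (between G A (vertices G - A))"
proof -
  let ?V = "vertices G" and ?S = "between G A (vertices G - A)" and ?w = "multiplicity G"
  have fin: "finite C" if "C \<subseteq> ?V" for C using that finite_vertices finite_subset by blast
  have del: "finite_loopless_multigraph (delete_edges G T)" for T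
    by (rule finite_loopless_multigraph_delete) unfold_locales
  have "between (delete_edges G ?S) A (?V - A) = {}" unfolding between_delete_edges by blast
  then have "2 \<le> card (components (delete_edges G ?S))"
    using finite_loopless_multigraph.two_components[OF del, of A] A by simp
  then have sep: "separating G ?S" using conn unfolding separating_def between_def by auto
  have "\<not> separating G T" if T: "T \<subset> ?S" for T
  proof -
    have "card (components (delete_edges G T)) = 1"
    proof (rule finite_loopless_multigraph.components_eq_one[OF del])
      show "vertices (delete_edges G T) \<noteq> {}" using A by auto
      fix B assume B: "B \<subseteq> vertices (delete_edges G T)" "B \<noteq> {}" "B \<noteq> vertices (delete_edges G T)"
      then have B': "B \<subseteq> ?V" "B \<noteq> ?V" by simp_all
      have "between G B (?V - B) - T \<noteq> {}"
      proof
        assume none: "between G B (?V - B) - T = {}"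
        have side: "C \<subseteq> B \<or> C \<subseteq> ?V - B"
          if C: "C \<subseteq> ?V" "linked ?w C" "between G C C \<inter> ?S = {}" for C
        proof -
          have "between G (C \<inter> B) (C - B) \<subseteq> between G B (?V - B)" by (rule between_mono) (use C in blast)+
          moreover have "between G (C \<inter> B) (C - B) \<subseteq> between G C C" by (rule between_mono) blast+
          ultimately have "between G (C \<inter> B) (C - B) = {}" using none T C(3) by blast
          then have "cut ?w (C \<inter> B) (C - B) = 0"
            using cut_multiplicity[of "C \<inter> B" "C - B"] fin[OF C(1)] by auto
          then show ?thesis
            using linked_side[OF multiplicity_fun_multiplicity, of "C \<inter> B" "C - B" C] C(1,2) fin[OF C(1)] by auto
        qed
        have 1: "between G A A \<inter> ?S = {}"
          unfolding between_def by (auto simp: doubleton_eq_iff)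
        have 2: "between G (?V - A) (?V - A) \<inter> ?S = {}"
          unfolding between_def by (auto simp: doubleton_eq_iff)
        have "B = A \<or> B = ?V - A"
          using side[OF A(1) l(1) 1] side[OF _ l(2) 2] B B' by blast
        then have "between G B (?V - B) = ?S"
        proof
          assume "B = ?V - A"
          then have "?V - B = A" using A(1) by blast
          then show ?thesis using \<open>B = ?V - A\<close> between_commute by metis
        qed simp
        then show False using none T by blast
      qed
      then show "between (delete_edges G T) B (vertices (delete_edges G T) - B) \<noteq> {}"
        unfolding between_delete_edges by simp
    qed
    then show ?thesis using conn unfolding separating_def by simp
  qed
  then show ?thesis using sep unfolding edge_cut_def by blast
qed

lemma sparse_bonds_multiplicity:
  assumes conn: "edge_connected 4 G" and cuts: "\<not> (\<exists>S. edge_cut G S \<and> card S \<in> {6..20})"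
  shows "sparse_bonds (vertices G) (multiplicity G)"
proof
  let ?V = "vertices G"
  have "connected_multigraph (delete_edges G {})" using conn unfolding edge_connected_def by simp
  moreover have "delete_edges G {} = G" unfolding delete_edges_def by simp
  ultimately have one: "card (components G) = 1" unfolding connected_multigraph_def by simp
  show "finite ?V" by (rule finite_vertices)
  show "?V \<noteq> {}" using one unfolding components_def by auto
  show "multiplicity_fun (multiplicity G)" by (rule multiplicity_fun_multiplicity)
  fix A assume A: "A \<subseteq> ?V" "A \<noteq> {}" "A \<noteq> ?V"
  let ?S = "between G A (?V - A)"
  have c: "cut (multiplicity G) A (?V - A) = int (card ?S)"
    using A finite_vertices finite_subset by (intro cut_multiplicity) blast+
  have "\<not> card ?S < 4"
  proof
    assume "card ?S < 4"
    moreover have "?S \<subseteq> edges G" unfolding between_def by blast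
    ultimately have "card (components (delete_edges G ?S)) = 1"
      using conn unfolding edge_connected_def connected_multigraph_def by blast
    moreover have "2 \<le> card (components (delete_edges G ?S))"
    proof (rule finite_loopless_multigraph.two_components)
      show "finite_loopless_multigraph (delete_edges G ?S)"
        by (rule finite_loopless_multigraph_delete) unfold_locales
      show "between (delete_edges G ?S) A (vertices (delete_edges G ?S) - A) = {}"
        unfolding between_delete_edges by simp
    qed (use A in simp_all)
    ultimately show False by simp
  qed
  then show "4 \<le> cut (multiplicity G) A (?V - A)" unfolding c by simp
  assume "linked (multiplicity G) A" "linked (multiplicity G) (?V - A)" "6 \<le> cut (multiplicity G) A (?V - A)"
  moreover from this have "edge_cut G ?S" using edge_cut_if_linked[OF one A] by blast
  ultimately have "card ?S \<notin> {6..20}" "6 \<le> card ?S" using cuts c by auto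
  then show "21 \<le> cut (multiplicity G) A (?V - A)" unfolding c by simp
qed

end

section \<open>From orientations modulo three to flows\<close>

text \<open>Net outflow at \<open>v\<close> for the values \<open>x\<close> on arcs with tails \<open>t\<close> and heads \<open>h\<close>.\<close>

definition excess :: "'e set \<Rightarrow> ('e \<Rightarrow> 'v) \<Rightarrow> ('e \<Rightarrow> 'v) \<Rightarrow> ('e \<Rightarrow> int) \<Rightarrow> 'v \<Rightarrow> int" where
  "excess E t h x v = (\<Sum>e\<in>E. (of_bool (t e = v) - of_bool (h e = v)) * x e)"

text \<open>Along such a step three units of excess can be moved from \<open>u\<close> to \<open>v\<close> by exchanging the values
\<open>1\<close> and \<open>-2\<close> on one arc.\<close>

definition residual :: "'e set \<Rightarrow> ('e \<Rightarrow> 'v) \<Rightarrow> ('e \<Rightarrow> 'v) \<Rightarrow> ('e \<Rightarrow> int) \<Rightarrow> 'v \<Rightarrow> 'v \<Rightarrow> bool" where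
  "residual E t h x u v \<longleftrightarrow> (\<exists>e\<in>E. t e = u \<and> h e = v \<and> x e = 1 \<or> h e = u \<and> t e = v \<and> x e = -2)"

text \<open>The path is listed from its end to its start.  As its vertices are distinct, switching the
last arc does not affect the earlier steps.\<close>

lemma augment_path:
  assumes "finite E" "\<forall>e\<in>E. x e \<in> {1, -2}" "ps \<noteq> []" "distinct ps"
    and "successively (\<lambda>v u. residual E t h x u v) ps"
  shows "\<exists>x'. (\<forall>e\<in>E. x' e \<in> {1, -2}) \<and>
    (\<forall>v. excess E t h x' v = excess E t h x v - 3 * of_bool (v = last ps) + 3 * of_bool (v = hd ps))"
  using assms
proof (induction ps arbitrary: x)
  case (Cons b ps)
  show ?case
  proof (cases ps)
    case Nil
    then show ?thesis using Cons.prems(2) by (intro exI[of _ x]) auto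
  next
    case (Cons a qs)
    have ab: "residual E t h x a b" and rest: "successively (\<lambda>v u. residual E t h x u v) ps"
      using Cons.prems(5) unfolding Cons by (simp_all add: successively.simps)
    obtain e where e: "e \<in> E" "t e = a \<and> h e = b \<and> x e = 1 \<or> h e = a \<and> t e = b \<and> x e = -2"
      using ab unfolding residual_def by blast
    have b: "b \<notin> set ps" "distinct ps" using Cons.prems(4) by auto
    define y where "y = x(e := - 1 - x e)"
    have y: "\<forall>e\<in>E. y e \<in> {1, -2}" unfolding y_def using Cons.prems(2) e(1) by auto
    have ex: "excess E t h y v = excess E t h x v - 3 * of_bool (v = a) + 3 * of_bool (v = b)" for v
    proof -
      let ?c = "of_bool (t e = v) - of_bool (h e = v) :: int"
      have "excess E t h y v = ?c * y e + (\<Sum>e'\<in>E - {e}. (of_bool (t e' = v) - of_bool (h e' = v)) * y e')"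
        unfolding excess_def by (rule sum.remove[OF Cons.prems(1) e(1)])
      also have "(\<Sum>e'\<in>E - {e}. (of_bool (t e' = v) - of_bool (h e' = v)) * y e') =
          (\<Sum>e'\<in>E - {e}. (of_bool (t e' = v) - of_bool (h e' = v)) * x e')"
        by (rule sum.cong[OF refl]) (simp add: y_def)
      also have "\<dots> = excess E t h x v - ?c * x e"
        unfolding excess_def
        using sum.remove[OF Cons.prems(1) e(1), of "\<lambda>e'. (of_bool (t e' = v) - of_bool (h e' = v)) * x e'"]
        by linarith
      finally have "excess E t h y v = excess E t h x v + ?c * (y e - x e)" by (simp add: right_diff_distrib)
      moreover have "?c * (y e - x e) = - 3 * of_bool (v = a) + 3 * of_bool (v = b)"
        using e(2) unfolding y_def by (auto simp: of_bool_def)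
      ultimately show ?thesis by linarith
    qed
    have res: "residual E t h y u v" if uv: "u \<noteq> b" "v \<noteq> b" "residual E t h x u v" for u v
    proof -
      obtain e' where e': "e' \<in> E" "t e' = u \<and> h e' = v \<and> x e' = 1 \<or> h e' = u \<and> t e' = v \<and> x e' = -2"
        using uv(3) unfolding residual_def by blast
      then have "e' \<noteq> e" using e(2) uv(1,2) by metis
      then show ?thesis using e' unfolding residual_def y_def by (intro bexI[of _ e']) auto
    qed
    have "successively (\<lambda>v u. residual E t h y u v) ps"
    proof (rule successively_mono[OF rest])
      fix v u assume "v \<in> set ps" "u \<in> set ps" "residual E t h x u v"
      then show "residual E t h y u v" using b(1) by (intro res) auto
    qed
    then obtain x' where "\<forall>e\<in>E. x' e \<in> {1, -2}"
      "\<forall>v. excess E t h x' v = excess E t h y v - 3 * of_bool (v = last ps) + 3 * of_bool (v = hd ps)"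
      using Cons.IH[OF Cons.prems(1) y _ b(2)] Cons by blast
    then show ?thesis unfolding ex using Cons by (intro exI[of _ x']) auto
  qed
qed simp

text \<open>Choose the values with the least total absolute excess.  If some vertex \<open>s\<close> has positive
excess, let \<open>R\<close> be the set of vertices reachable by residual steps.  No vertex of \<open>R\<close> has negative
excess, since otherwise a path would reduce the total.  But all arcs leaving \<open>R\<close> have value \<open>-2\<close> and
all arcs entering it have value \<open>1\<close>, so the excess of \<open>R\<close> is not positive.\<close>

lemma flow_if_excess_dvd_3:
  fixes E :: "'e set" and V :: "'v set"
  assumes fin: "finite V" "finite E" and th: "\<forall>e\<in>E. t e \<in> V \<and> h e \<in> V"
    and three: "\<forall>v\<in>V. 3 dvd excess E t h (\<lambda>_. 1) v"
  shows "\<exists>x. (\<forall>e\<in>E. x e \<in> {1, -2}) \<and> (\<forall>v\<in>V. excess E t h x v = 0)"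
proof -
  let ?ex = "excess E t h"
  define ok where "ok x \<longleftrightarrow> (\<forall>e\<in>E. x e \<in> {1, -2})" for x :: "'e \<Rightarrow> int"
  define m where "m x = nat (\<Sum>v\<in>V. \<bar>?ex x v\<bar>)" for x
  have "ok (\<lambda>_. 1)" unfolding ok_def by simp
  then obtain x where x: "ok x" and least: "\<And>y. ok y \<Longrightarrow> m x \<le> m y"
    using ex_has_least_nat[of ok "\<lambda>_. 1" m] by blast
  have dvd: "3 dvd ?ex x v" if v: "v \<in> V" for v
  proof -
    have "3 dvd (\<Sum>e\<in>E. (of_bool (t e = v) - of_bool (h e = v)) * (x e - 1))"
      using x unfolding ok_def by (intro dvd_sum dvd_mult) auto
    moreover have "(\<Sum>e\<in>E. (of_bool (t e = v) - of_bool (h e = v)) * (x e - 1)) = ?ex x v - ?ex (\<lambda>_. 1) v"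
      unfolding excess_def by (simp add: right_diff_distrib sum_subtractf)
    ultimately have "3 dvd (?ex x v - ?ex (\<lambda>_. 1) v)" by simp
    then have "3 dvd (?ex x v - ?ex (\<lambda>_. 1) v + ?ex (\<lambda>_. 1) v)" using three v by (intro dvd_add) auto
    then show ?thesis by simp
  qed
  have sum_ex: "(\<Sum>v\<in>A. ?ex x v) = (\<Sum>e\<in>E. (of_bool (t e \<in> A) - of_bool (h e \<in> A)) * x e)" if "A \<subseteq> V" for A
  proof -
    have fA: "finite A" using that fin finite_subset by blast
    have "(\<Sum>v\<in>A. ?ex x v) = (\<Sum>e\<in>E. (\<Sum>v\<in>A. of_bool (t e = v) - of_bool (h e = v)) * x e)"
      unfolding excess_def sum_distrib_right by (rule sum.swap)
    moreover have "(\<Sum>v\<in>A. of_bool (t e = v) - of_bool (h e = v)) = (of_bool (t e \<in> A) - of_bool (h e \<in> A) :: int)" for e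
      unfolding of_bool_def sum_subtractf using fA by simp
    ultimately show ?thesis by (simp only:)
  qed
  have "?ex x s \<le> 0" if s: "s \<in> V" for s
  proof (rule ccontr)
    assume pos: "\<not> ?ex x s \<le> 0"
    define path where "path ps \<longleftrightarrow> ps \<noteq> [] \<and> distinct ps \<and> set ps \<subseteq> V \<and> last ps = s \<and>
      successively (\<lambda>v u. residual E t h x u v) ps" for ps
    define R where "R = {v. \<exists>ps. path ps \<and> hd ps = v}"
    have RV: "R \<subseteq> V" unfolding R_def path_def by auto
    have sR: "s \<in> R" unfolding R_def path_def using s by (auto intro!: exI[of _ "[s]"])
    have closed: "v \<in> R" if uv: "u \<in> R" "residual E t h x u v" for u v
    proof -
      obtain ps where ps: "path ps" "hd ps = u" using uv(1) unfolding R_def by blast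
      have v: "v \<in> V" using uv(2) th unfolding residual_def by blast
      show ?thesis
      proof (cases "v \<in> set ps")
        case True
        then obtain as bs where "ps = as @ v # bs" by (meson split_list)
        then have "path (v # bs)" using ps(1) unfolding path_def by (auto simp: successively_append_iff)
        then show ?thesis unfolding R_def by force
      next
        case False
        have "path (v # ps)"
          using ps uv(2) v False unfolding path_def by (cases ps) (auto simp: successively.simps)
        then show ?thesis unfolding R_def by force
      qed
    qed
    have nonneg: "0 \<le> ?ex x v" if v: "v \<in> R" for v
    proof (rule ccontr)
      assume neg: "\<not> 0 \<le> ?ex x v"
      obtain ps where ps: "path ps" "hd ps = v" using v unfolding R_def by blast
      obtain x' where x': "ok x'"
        and ex': "\<And>u. ?ex x' u = ?ex x u - 3 * of_bool (u = s) + 3 * of_bool (u = v)"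
        using augment_path[of E x ps t h] fin(2) x ps unfolding path_def ok_def by auto
      have vs: "v \<noteq> s" and vV: "v \<in> V" using neg pos v RV by auto
      have s3: "3 \<le> ?ex x s" using dvd[OF s] pos by presburger
      have v3: "?ex x v \<le> -3" using dvd[OF vV] neg by presburger
      have "(\<Sum>u\<in>V. \<bar>?ex x' u\<bar>) < (\<Sum>u\<in>V. \<bar>?ex x u\<bar>)"
      proof (rule sum_strict_mono_ex1[OF fin(1)])
        show "\<forall>u\<in>V. \<bar>?ex x' u\<bar> \<le> \<bar>?ex x u\<bar>" unfolding ex' using s3 v3 vs by (auto simp: of_bool_def)
        show "\<exists>u\<in>V. \<bar>?ex x' u\<bar> < \<bar>?ex x u\<bar>"
          by (rule bexI[OF _ s]) (use s3 vs in \<open>simp add: ex'\<close>)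
      qed
      moreover have "0 \<le> (\<Sum>u\<in>V. \<bar>?ex x' u\<bar>)" by (rule sum_nonneg) simp
      ultimately have "m x' < m x" unfolding m_def by linarith
      then show False using least[OF x'] by simp
    qed
    have "?ex x s \<le> (\<Sum>v\<in>R. ?ex x v)"
      by (rule member_le_sum[OF sR]) (use nonneg RV fin finite_subset in auto)
    also have "\<dots> \<le> 0"
      unfolding sum_ex[OF RV]
    proof (rule sum_nonpos)
      fix e assume e: "e \<in> E"
      have "x e = 1 \<or> x e = -2" using x e unfolding ok_def by blast
      moreover have "x e = 1 \<Longrightarrow> residual E t h x (t e) (h e)" "x e = -2 \<Longrightarrow> residual E t h x (h e) (t e)"
        using e unfolding residual_def by blast+
      ultimately show "(of_bool (t e \<in> R) - of_bool (h e \<in> R)) * x e \<le> 0"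
        using closed by (auto simp: of_bool_def)
    qed
    finally show False using pos by simp
  qed
  moreover have "(\<Sum>v\<in>V. - ?ex x v) = 0"
    unfolding sum_negf sum_ex[OF order.refl] using th by simp
  ultimately have "\<forall>v\<in>V. - ?ex x v = 0"
    by (subst sum_nonneg_eq_0_iff[symmetric]) (use fin in auto)
  then show ?thesis using x unfolding ok_def by auto
qed

text \<open>For each pair of adjacent vertices, half of \<open>w u v + f u v\<close> of the parallel edges are directed
from \<open>u\<close> to \<open>v\<close>.\<close>

lemma (in finite_loopless_multigraph) orientation_of_net_orientation:
  assumes f: "net_orientation (vertices G) (multiplicity G) f"
  shows "\<exists>t h. (\<forall>e\<in>edges G. {t e, h e} = ends G e) \<and>
    (\<forall>v\<in>vertices G. excess (edges G) t h (\<lambda>_. 1) v = sum (f v) (vertices G))"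
proof -
  let ?V = "vertices G" and ?E = "edges G" and ?w = "multiplicity G"
  have fD: "f u v = - f v u" "\<bar>f u v\<bar> \<le> ?w u v" "even (f u v - ?w u v)" if "u \<in> ?V" "v \<in> ?V" for u v
    using f that unfolding net_orientation_def by blast+
  have "\<forall>P. \<exists>t. (\<exists>u\<in>?V. \<exists>v\<in>?V. u \<noteq> v \<and> P = {u, v}) \<longrightarrow> (\<forall>e. t e \<in> P) \<and>
    (\<forall>u\<in>P. \<forall>v\<in>P. u \<noteq> v \<longrightarrow> 2 * int (card {e \<in> ?E. ends G e = P \<and> t e = u}) = ?w u v + f u v)"
  proof (intro allI)
    fix P
    show "\<exists>t. (\<exists>u\<in>?V. \<exists>v\<in>?V. u \<noteq> v \<and> P = {u, v}) \<longrightarrow> (\<forall>e. t e \<in> P) \<and>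
      (\<forall>u\<in>P. \<forall>v\<in>P. u \<noteq> v \<longrightarrow> 2 * int (card {e \<in> ?E. ends G e = P \<and> t e = u}) = ?w u v + f u v)"
    proof (cases "\<exists>u\<in>?V. \<exists>v\<in>?V. u \<noteq> v \<and> P = {u, v}")
      case False
      then show ?thesis by blast
    next
      case True
      then obtain u v where uv: "u \<in> ?V" "v \<in> ?V" "u \<noteq> v" "P = {u, v}" by blast
      let ?M = "{e \<in> ?E. ends G e = P}"
      have finM: "finite ?M" using finite_edges by simp
      have w: "?w u v = int (card ?M)" "?w v u = int (card ?M)"
        unfolding multiplicity_def uv(4) by (simp_all add: insert_commute)
      have "even (?w u v + f u v)" using fD(3)[OF uv(1,2)] by simp
      then obtain k where k: "?w u v + f u v = 2 * k" by (rule evenE)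
      have "0 \<le> k" "k \<le> int (card ?M)" using fD(2)[OF uv(1,2)] k w by linarith+
      then have "nat k \<le> card ?M" by linarith
      then obtain K where "K \<subseteq> ?M" "card K = nat k" by (rule obtain_subset_with_card_n)
      then have K: "K \<subseteq> ?M" "int (card K) = k" using \<open>0 \<le> k\<close> by simp_all
      define t where "t e = (if e \<in> K then u else v)" for e
      have "{e \<in> ?E. ends G e = P \<and> t e = u} = K" "{e \<in> ?E. ends G e = P \<and> t e = v} = ?M - K"
        unfolding t_def using K(1) uv(3) by auto
      moreover have "int (card (?M - K)) = int (card ?M) - k"
        using K card_Diff_subset[of K ?M] card_mono[OF finM K(1)] finite_subset[OF K(1) finM] by simp
      ultimately have "2 * int (card {e \<in> ?E. ends G e = P \<and> t e = u}) = ?w u v + f u v"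
        "2 * int (card {e \<in> ?E. ends G e = P \<and> t e = v}) = ?w v u + f v u"
        using K(2) k w fD(1)[OF uv(1,2)] by simp_all
      then have "2 * int (card {e \<in> ?E. ends G e = P \<and> t e = a}) = ?w a b + f a b"
        if "a \<in> P" "b \<in> P" "a \<noteq> b" for a b
        using that uv(4) by auto
      moreover have "\<forall>e. t e \<in> P" unfolding t_def uv(4) by simp
      ultimately show ?thesis by (intro exI[of _ t]) blast
    qed
  qed
  then obtain T where T: "\<And>u v. u \<in> ?V \<Longrightarrow> v \<in> ?V \<Longrightarrow> u \<noteq> v \<Longrightarrow> (\<forall>e. T {u, v} e \<in> {u, v}) \<and>
    2 * int (card {e \<in> ?E. ends G e = {u, v} \<and> T {u, v} e = u}) = ?w u v + f u v"
    by (subst (asm) choice_iff) blast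
  define t where "t e = T (ends G e) e" for e
  \<comment> \<open>The other end of \<open>e\<close>.\<close>
  define h where "h e = (SOME y. ends G e = {t e, y})" for e
  have two: "\<exists>u\<in>?V. \<exists>v\<in>?V. u \<noteq> v \<and> ends G e = {u, v}" if "e \<in> ?E" for e
  proof -
    have "ends G e \<subseteq> ?V" "card (ends G e) = 2" using ends_edge[OF that] by blast+
    then show ?thesis by (auto simp: card_2_iff)
  qed
  have th: "ends G e = {t e, h e}" if e: "e \<in> ?E" for e
  proof -
    obtain u v where uv: "u \<in> ?V" "v \<in> ?V" "u \<noteq> v" "ends G e = {u, v}" using two[OF e] by blast
    then have "t e = u \<or> t e = v" using T[OF uv(1-3)] unfolding t_def by auto
    then have "\<exists>y. ends G e = {t e, y}" using uv(4) by auto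
    then show ?thesis unfolding h_def by (rule someI_ex)
  qed
  have thV: "t e \<in> ?V" "h e \<in> ?V" "t e \<noteq> h e" if e: "e \<in> ?E" for e
    using two[OF e] th[OF e] by (auto simp: doubleton_eq_iff)
  define N where "N u v = (\<Sum>e\<in>?E. of_bool (t e = u \<and> h e = v) :: int)" for u v
  have N: "N u v - N v u = f u v" if uv: "u \<in> ?V" "v \<in> ?V" for u v
  proof (cases "u = v")
    case True
    then show ?thesis using fD(1)[OF uv] by simp
  next
    case False
    have count: "2 * N u v = ?w u v + f u v" if uv: "u \<in> ?V" "v \<in> ?V" "u \<noteq> v" for u v
    proof -
      have "N u v = int (card {e \<in> ?E. t e = u \<and> h e = v})"
        unfolding N_def using finite_edges by (simp add: Int_def)
      also have "{e \<in> ?E. t e = u \<and> h e = v} = {e \<in> ?E. ends G e = {u, v} \<and> T {u, v} e = u}"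
      proof -
        have "t e = u \<and> h e = v \<longleftrightarrow> ends G e = {u, v} \<and> T {u, v} e = u" if "e \<in> ?E" for e
          using th[OF that] thV[OF that] unfolding t_def by (auto simp: doubleton_eq_iff)
        then show ?thesis by blast
      qed
      finally show ?thesis using T[OF uv] by simp
    qed
    have "?w u v = ?w v u" by (rule multiplicity_fun_sym[OF multiplicity_fun_multiplicity])
    then show ?thesis using count[OF uv False] count[OF uv(2,1)] False fD(1)[OF uv] by simp
  qed
  have "excess ?E t h (\<lambda>_. 1) v = sum (f v) ?V" if v: "v \<in> ?V" for v
  proof -
    have "(\<Sum>e\<in>?E. of_bool (t e = v) :: int) = (\<Sum>e\<in>?E. \<Sum>u\<in>?V. of_bool (t e = v \<and> h e = u))"
      by (rule sum.cong[OF refl]) (use thV finite_vertices in \<open>simp add: of_bool_def\<close>)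
    also have "\<dots> = (\<Sum>u\<in>?V. N v u)" unfolding N_def by (rule sum.swap)
    finally have 1: "(\<Sum>e\<in>?E. of_bool (t e = v) :: int) = (\<Sum>u\<in>?V. N v u)" .
    have "(\<Sum>e\<in>?E. of_bool (h e = v) :: int) = (\<Sum>e\<in>?E. \<Sum>u\<in>?V. of_bool (t e = u \<and> h e = v))"
      by (rule sum.cong[OF refl]) (use thV finite_vertices in \<open>simp add: of_bool_def\<close>)
    also have "\<dots> = (\<Sum>u\<in>?V. N u v)" unfolding N_def by (rule sum.swap)
    finally have 2: "(\<Sum>e\<in>?E. of_bool (h e = v) :: int) = (\<Sum>u\<in>?V. N u v)" .
    have "excess ?E t h (\<lambda>_. 1) v = (\<Sum>u\<in>?V. N v u - N u v)"
      unfolding excess_def sum_subtractf using 1 2 by (simp add: sum_subtractf)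
    also have "\<dots> = sum (f v) ?V" by (rule sum.cong[OF refl]) (rule N[OF v])
    finally show ?thesis .
  qed
  then show ?thesis using th by (intro exI[of _ t] exI[of _ h]) auto
qed

theorem theoremA2:
  fixes G :: "('v, 'e) multigraph"
  assumes "finite_loopless_multigraph G"
    and "edge_connected 4 G"
    and "\<not> (\<exists>S. edge_cut G S \<and> card S \<in> {6..20})"
  shows "\<exists>D f. nowhere_zero_flow 3 G D f"
proof -
  interpret finite_loopless_multigraph G by (rule assms(1))
  let ?V = "vertices G" and ?E = "edges G"
  obtain g where g: "net_orientation ?V (multiplicity G) g" and g3: "\<forall>v\<in>?V. 3 dvd (0 - sum (g v) ?V)"
    using orientable_if_sparse_bonds[OF sparse_bonds_multiplicity[OF assms(2,3)]]
    unfolding orientable_def by blast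
  obtain t h where th: "\<forall>e\<in>?E. {t e, h e} = ends G e"
    and ex: "\<forall>v\<in>?V. excess ?E t h (\<lambda>_. 1) v = sum (g v) ?V"
    using orientation_of_net_orientation[OF g] by blast
  have "\<forall>e\<in>?E. t e \<in> ?V \<and> h e \<in> ?V"
  proof
    fix e assume e: "e \<in> ?E"
    have "{t e, h e} \<subseteq> ?V" using th ends_edge[OF e] e by metis
    then show "t e \<in> ?V \<and> h e \<in> ?V" by blast
  qed
  moreover have "\<forall>v\<in>?V. 3 dvd excess ?E t h (\<lambda>_. 1) v" using ex g3 by simp
  ultimately obtain x where x: "\<forall>e\<in>?E. x e \<in> {1, -2}" and zero: "\<forall>v\<in>?V. excess ?E t h x v = 0"
    using flow_if_excess_dvd_3[OF finite_vertices finite_edges] by blast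
  define D where "D = \<lparr>verts = ?V, arcs = ?E, tail = (\<lambda>e. if x e = 1 then t e else h e),
    head = (\<lambda>e. if x e = 1 then h e else t e)\<rparr>"
  define f :: "'e \<Rightarrow> nat" where "f e = (if x e = 1 then 1 else 2)" for e
  have "orientation G D" unfolding orientation_def D_def using th by (auto simp: insert_commute)
  moreover have "\<forall>e\<in>?E. f e \<in> {1..3 - 1}" unfolding f_def by simp
  moreover have "(\<Sum>e\<in>out_arcs D v. f e) = (\<Sum>e\<in>in_arcs D v. f e)" if v: "v \<in> ?V" for v
  proof -
    have sums: "int (\<Sum>e\<in>{e \<in> ?E. P e}. f e) = (\<Sum>e\<in>?E. of_bool (P e) * int (f e))" for P
      unfolding sum.inter_filter[OF finite_edges] of_nat_sum by (rule sum.cong[OF refl]) simp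
    have "int (\<Sum>e\<in>out_arcs D v. f e) - int (\<Sum>e\<in>in_arcs D v. f e) =
        (\<Sum>e\<in>?E. of_bool (tail D e = v) * int (f e)) - (\<Sum>e\<in>?E. of_bool (head D e = v) * int (f e))"
      unfolding out_arcs_def in_arcs_def using sums[of "\<lambda>e. tail D e = v"] sums[of "\<lambda>e. head D e = v"]
      by (simp add: D_def)
    also have "\<dots> = excess ?E t h x v"
      unfolding excess_def sum_subtractf[symmetric]
      by (rule sum.cong[OF refl]) (use x in \<open>auto simp: D_def f_def\<close>)
    also have "\<dots> = 0" using zero v by blast
    finally have "int (\<Sum>e\<in>out_arcs D v. f e) = int (\<Sum>e\<in>in_arcs D v. f e)" by linarith
    then show ?thesis by (simp only: of_nat_eq_iff)
  qed
  ultimately have "nowhere_zero_flow 3 G D f" unfolding nowhere_zero_flow_def by blast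
  then show ?thesis by blast
qed

end
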